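(* There is a constant $C>0$ depending only on $C_F=\max_{1\le i\le N}|\mathcal M_i|$, the maximum number of interfaces per subdomain (and on nothing else: in particular not on the mesh sizes, the coefficients $\rho,\varepsilon$, the subdomains or the tolerance), such that for every tolerance $\Theta\ge 1$, the adaptive BDDC preconditioned operator $$\hat G = E_D\,\tilde S^{-1}E_D^T\, I_\Gamma^T\,\tilde S\, I_\Gamma:\hat{\boldsymbol W}\to\hat{\boldsymbol W}$$ constructed (as in the context) with tolerance $\Theta$ satisfies the condition number bound $$\kappa(\hat G)=\frac{\lambda_{\max}(\hat G)}{\lambda_{\min}(\hat G)}\le C\,\Theta .$$
   Context: **Discretization.** $\Omega\subset\mathbb R^2$ is a bounded polygonal domain, $\varepsilon\ge 0$ and $\rho\ge\rho_{\min}>0$ are bounded coefficient functions on $\Omega$. $\bar\Omega=\bigcup_{i=1}^N\bar\Omega_i$ with disjoint polygonal subdomains such that $\partial\Omega_i\cap\partial\Omega_j$ ($i\ne j$) is empty, a vertex or a common edge. Each $\Omega_i$ has its own regular or quasi-uniform triangulation $\mathcal T_i$ of mesh size $h_i$ (meshes need not match). Fix $s\ge1$. $X(\Omega_i)$ is the space of continuous functions on $\bar\Omega_i$ that are polynomials of degree $\le s$ on each element of $\mathcal T_i$ and vanish on $\partial\Omega_i\cap\partial\Omega$; $X^{(i)}$ is its extension by zero to $\Omega$; $X_h=\oplus_i X^{(i)}$. The common edges are called interfaces and are enumerated $F_1,\dots,F_M$; $\Gamma$ is their union. If $F_k=\partial\Omega_i\cap\partial\Omega_j$, the nonmortar side is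 the one with the larger mesh size (one side is chosen if equal). $M(F_k)$ is the standard mortar Lagrange multiplier space on $F_k$ for the nonmortar trace mesh (continuous, piecewise polynomial of degree $\le s$, of degree $\le s-1$ on the two end elements); $n_k=\dim M(F_k)$; $M_{F_k}$ is its extension by zero to $\Gamma$, with basis $\varphi^k_1,\dots,\varphi^k_{n_k}$; $M_h=\oplus_k M_{F_k}$. $\mathcal M_i=\{k: F_k\subset\partial\Omega_i\setminus\partial\Omega\}$. All spaces of pairs below lie in $L^2(\Omega)\times L^2(\Gamma)$ with its inner product $(\cdot,\cdot)$; $L^T$ is the adjoint of $L$ with respect to these inner products. **Forms.** $\tilde a_i(u,v)=\int_{\Omega_i}(\rho\nabla u\cdot\nabla v+\varepsilon uv)\,dx$; $b_i(v,\mu)=\sum_{r}\int_{\partial\Omega_i\cap\partial\Omega_r}\sigma_{ir}\,v|_{\Omega_i}\,\mu\,dS$, the sum over $r$ such that $\partial\Omega_i\cap\partial\Omega_r$ is an interface, $\sigma_{ir}=1$ if $i<r$ and $-1$ if $i>r$. For $\boldsymbol u=(u,\lambda),\boldsymbol v=(v,q)\in X_h\times M_h$, $$A_i(\boldsymbol u,\boldsymbol v)=-\big(\tilde a_i(u,v)+b_i(v,\lambda)+b_i(u,q)\big),\qquad A=\sum_{i=1}^N A_i .$$ Standing assumptions: each $\tilde a_i$ is coercive on $X^{(i)}$; and for $\lambda\in\oplus_{k\in\mathcal M_i}M_{F_k}$, $b_i(v,\lambda)=0$ for all $v\in X^{(i)}$ implies $\lambda=0$ (so the local Schur complements are symmetric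 positive definite). **Basis functions and spaces.** $\boldsymbol V_I^{(i)}=\{(v,0):v\in X^{(i)}\}$, $\boldsymbol V_I=\oplus_i\boldsymbol V_I^{(i)}$, $\boldsymbol V_{F_k}=\{(0,\lambda):\lambda\in M_{F_k}\}$, $\boldsymbol V^{(i)}=\boldsymbol V_I^{(i)}\oplus(\oplus_{k\in\mathcal M_i}\boldsymbol V_{F_k})$. For $F_k=\partial\Omega_i\cap\partial\Omega_j$, $\nu\in\{i,j\}$, $1\le l\le n_k$: - $\boldsymbol\phi^k_l\in\boldsymbol V_I\oplus\boldsymbol V_{F_k}$ has second component $\varphi^k_l$ and $A(\boldsymbol\phi^k_l,\boldsymbol v)=0$ for all $\boldsymbol v\in\boldsymbol V_I$; - $\boldsymbol\phi^{k,\nu}_l\in\boldsymbol V_I^{(\nu)}\oplus\boldsymbol V_{F_k}$ has second component $\varphi^k_l$ and $A_\nu(\boldsymbol\phi^{k,\nu}_l,\boldsymbol v)=0$ for all $\boldsymbol v\in\boldsymbol V_I^{(\nu)}$; - $\bar{\boldsymbol\phi}^{k,\nu}_l\in\boldsymbol V^{(\nu)}$ has second component equal to $\varphi^k_l$ on $F_k$ and $A_\nu(\bar{\boldsymbol\phi}^{k,\nu}_l,\boldsymbol v)=0$ for all $\boldsymbol v\in\boldsymbol V_I^{(\nu)}\oplus(\oplus_{m\in\mathcal M_\nu,m\ne k}\boldsymbol V_{F_m})$. $\boldsymbol W_k,\boldsymbol W_k^{(\nu)},\bar{\boldsymbol W}_k^{(\nu)}$ are the spans over $l$ of these three families (each a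 basis), and $\hat{\boldsymbol W}=\oplus_{k=1}^M\boldsymbol W_k$. **Scaling and transformation.** For each $F_k=\partial\Omega_i\cap\partial\Omega_j$ there are given nonsingular $n_k\times n_k$ scaling matrices $\vec D^{(i)}_{F_k},\vec D^{(j)}_{F_k}$ with sum the identity; the scaling operators $D^{(\nu)}_{F_k}$ act on $\boldsymbol W_k^{(i)}$ and $\boldsymbol W_k^{(j)}$ by multiplying coefficient vectors in the bases $\{\boldsymbol\phi^{k,i}_l\}$, $\{\boldsymbol\phi^{k,j}_l\}$ by $\vec D^{(\nu)}_{F_k}$. For the given tolerance $\Theta\ge1$ there are a nonsingular matrix $\vec T_{F_k}$ and a splitting $n_k=n^k_\Delta+n^k_\Pi$; the operator $T_{F_k}$ acts on $\boldsymbol W_k,\boldsymbol W_k^{(\nu)},\bar{\boldsymbol W}_k^{(\nu)}$ ($\nu=i,j$) by multiplying coefficient vectors in the bases $\{\boldsymbol\phi^k_l\}_{l=1}^{n_k}$, $\{\boldsymbol\phi^{k,\nu}_l\}_{l=1}^{n_k}$, $\{\bar{\boldsymbol\phi}^{k,\nu}_l\}_{l=1}^{n_k}$, respectively, by $\vec T_{F_k}$. It is required that for all $(w_l)\in\mathbb R^{n_\Delta^k}$, $(v_l)\in\mathbb R^{n_\Pi^k}$, with $\boldsymbol w_\Delta^{(\nu)}=\sum_{l\le n_\Delta^k}w_lT_{F_k}\boldsymbol\phi^{k,\nu}_l$, $\bar{\boldsymbol w}^{(i)}_\Delta=\sum_{l\le n_\Delta^k}w_lT_{F_k}\bar{\boldsymbol\phi}^{k,i}_l$,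 $\bar{\boldsymbol w}^{(i)}_\Pi=\sum_{l\le n_\Pi^k}v_lT_{F_k}\bar{\boldsymbol\phi}^{k,i}_{n_\Delta^k+l}$, $$A_i(D^{(j)}_{F_k}\boldsymbol w_\Delta^{(i)},D^{(j)}_{F_k}\boldsymbol w_\Delta^{(i)})+A_j(D^{(i)}_{F_k}\boldsymbol w_\Delta^{(j)},D^{(i)}_{F_k}\boldsymbol w_\Delta^{(j)})\le\Theta\,A_i(\bar{\boldsymbol w}^{(i)}_\Delta+\bar{\boldsymbol w}^{(i)}_\Pi,\bar{\boldsymbol w}^{(i)}_\Delta+\bar{\boldsymbol w}^{(i)}_\Pi),$$ and likewise with the roles of $i$ and $j$ exchanged. New bases: $\hat{\boldsymbol\phi}^k_l=T_{F_k}\boldsymbol\phi^k_l$ of $\boldsymbol W_k$ and $\tilde{\boldsymbol\phi}^{k,\nu}_l=T_{F_k}\boldsymbol\phi^{k,\nu}_l$ of $\boldsymbol W_k^{(\nu)}$. $\boldsymbol W_{k,\Delta}$, $\boldsymbol W_{k,\Pi}$ are the spans of $\hat{\boldsymbol\phi}^k_l$ for $l\le n_\Delta^k$, resp. $l>n_\Delta^k$; $\boldsymbol W^{(\nu)}_{k,\Delta}$ is the span of $\tilde{\boldsymbol\phi}^{k,\nu}_l$, $l\le n_\Delta^k$. Put $\boldsymbol W_\Pi=\oplus_k\boldsymbol W_{k,\Pi}$ (so $\hat{\boldsymbol W}=\oplus_k\boldsymbol W_{k,\Delta}\oplus\boldsymbol W_\Pi$), $\boldsymbol W_\Delta^{(i)}=\oplus_{k\in\mathcal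 M_i}\boldsymbol W_{k,\Delta}^{(i)}$, $\tilde{\boldsymbol W}=(\oplus_{i=1}^N\boldsymbol W_\Delta^{(i)})\oplus\boldsymbol W_\Pi$. Linear basis-change maps: $T_k^{(i)}:\boldsymbol W_k\to\boldsymbol W_k^{(i)}$, $\hat{\boldsymbol\phi}^k_l\mapsto\tilde{\boldsymbol\phi}^{k,i}_l$; $T^k_{(i)}$ its inverse; $T^{(i,j)}:\boldsymbol W_k^{(i)}\to\boldsymbol W_k^{(j)}$, $\tilde{\boldsymbol\phi}^{k,i}_l\mapsto\tilde{\boldsymbol\phi}^{k,j}_l$. Second scaling operators: $\check D^{(\nu)}_{F_k}$ ($\nu=i,j$) act on $\boldsymbol W_k,\boldsymbol W_k^{(i)},\boldsymbol W_k^{(j)}$ by multiplying coefficient vectors in the bases $\{\hat{\boldsymbol\phi}^k_l\},\{\tilde{\boldsymbol\phi}^{k,i}_l\},\{\tilde{\boldsymbol\phi}^{k,j}_l\}$ by given matrices $\vec{\check D}^{(\nu)}_{F_k}$, with $\check D^{(i)}_{F_k}+\check D^{(j)}_{F_k}=I$ and, for all $\boldsymbol w\in\boldsymbol W^{(i)}_{k,\Delta}$, $$A_i(\check D^{(j)}_{F_k}\boldsymbol w,\check D^{(j)}_{F_k}\boldsymbol w)+A_j(\check D^{(i)}_{F_k}T^{(i,j)}\boldsymbol w,\check D^{(i)}_{F_k}T^{(i,j)}\boldsymbol w)\le A_i(D^{(j)}_{F_k}\boldsymbol w,D^{(j)}_{F_k}\boldsymbol w)+A_j(D^{(i)}_{F_k}T^{(i,j)}\boldsymbol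 w,D^{(i)}_{F_k}T^{(i,j)}\boldsymbol w)$$ (e.g. $\vec{\check D}^{(\nu)}_{F_k}=\vec T_{F_k}^{-1}\vec D^{(\nu)}_{F_k}\vec T_{F_k}$). **Operators.** For $\tilde{\boldsymbol u}=\sum_i\sum_{k\in\mathcal M_i}\tilde{\boldsymbol u}^{(i)}_{k,\Delta}+\sum_k\tilde{\boldsymbol u}_{k,\Pi}\in\tilde{\boldsymbol W}$ put $\tilde{\boldsymbol u}^{(i)}=\sum_{k\in\mathcal M_i}(\tilde{\boldsymbol u}^{(i)}_{k,\Delta}+T_k^{(i)}\tilde{\boldsymbol u}_{k,\Pi})$ and $\tilde A(\tilde{\boldsymbol u},\tilde{\boldsymbol v})=\sum_iA_i(\tilde{\boldsymbol u}^{(i)},\tilde{\boldsymbol v}^{(i)})$; $\tilde S:\tilde{\boldsymbol W}\to\tilde{\boldsymbol W}$ is the symmetric positive definite operator with $(\tilde S\tilde{\boldsymbol u},\tilde{\boldsymbol v})=\tilde A(\tilde{\boldsymbol u},\tilde{\boldsymbol v})$. $I_\Gamma:\hat{\boldsymbol W}\to\tilde{\boldsymbol W}$ is linear with $I_\Gamma\boldsymbol w=\boldsymbol w$ on $\boldsymbol W_\Pi$ and $I_\Gamma\boldsymbol w=T_k^{(i)}\boldsymbol w+T_k^{(j)}\boldsymbol w$ for $\boldsymbol w\in\boldsymbol W_{k,\Delta}$, $F_k=\partial\Omega_i\cap\partial\Omega_j$. $R^{(i)}_{\Delta,\Gamma}=\sum_{k\in\mathcal M_i}\check D^{(i)}_{F_k}T^k_{(i)}R^{(i)}_{k,\Delta}:\boldsymbol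 W_\Delta^{(i)}\to\hat{\boldsymbol W}$, where $R^{(i)}_{k,\Delta}:\boldsymbol W_\Delta^{(i)}\to\boldsymbol W_{k,\Delta}^{(i)}$ is the projection along the direct sum. The averaging operator is $E_D=\sum_{i=1}^NR^{(i)}_{\Delta,\Gamma}R^{(i)}_\Delta+R_\Pi:\tilde{\boldsymbol W}\to\hat{\boldsymbol W}$, where $R_\Delta^{(i)}:\tilde{\boldsymbol W}\to\boldsymbol W_\Delta^{(i)}$ and $R_\Pi:\tilde{\boldsymbol W}\to\boldsymbol W_\Pi$ are the projections along the direct sum. $\hat S=I_\Gamma^T\tilde SI_\Gamma$ is the Schur complement operator, and $E_D\tilde S^{-1}E_D^T$ is the adaptive BDDC preconditioner. $\hat G$ is self-adjoint with respect to $(\hat S\cdot,\cdot)$; $\lambda_{\max},\lambda_{\min}$ denote its extreme eigenvalues. *)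

theory Defs
  imports
    "HOL-Analysis.Analysis"
    "HOL-Library.Function_Algebras"
    "HOL-Library.Set_Algebras"
    "Jordan_Normal_Form.Matrix"
begin

(* Matrices and coefficient vectors, whose size varies with the interface, are those of
   Jordan_Normal_Form; they are indexed from 0.  The infix notations below would clash
   with those of HOL-Analysis. *)
no_notation vec_index (infixl "$" 100)
no_notation scalar_prod (infix "\<bullet>" 70)

(* Sums of subspaces, written V + W and \<Sum>i\<in>I. V i, are those of Set_Algebras. *)
instantiation "fun" :: (type, real_vector) real_vector
begin

definition scaleR_fun :: "real \<Rightarrow> ('a \<Rightarrow> 'b) \<Rightarrow> 'a \<Rightarrow> 'b"
  where "scaleR_fun c f = (\<lambda>x. c *\<^sub>R f x)"

instance
  by standard (auto simp: scaleR_fun_def plus_fun_def scaleR_add_right scaleR_add_left)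

end

section \<open>Linear algebra\<close>

definition is_basis :: "nat \<Rightarrow> (nat \<Rightarrow> 'v::real_vector) \<Rightarrow> 'v set \<Rightarrow> bool"
  where "is_basis n b V \<longleftrightarrow> inj_on b {..<n} \<and> independent (b ` {..<n}) \<and> span (b ` {..<n}) = V"

definition lin_comb :: "nat \<Rightarrow> (nat \<Rightarrow> 'v::real_vector) \<Rightarrow> real Matrix.vec \<Rightarrow> 'v"
  where "lin_comb n b c = (\<Sum>l<n. vec_index c l *\<^sub>R b l)"

definition coords :: "nat \<Rightarrow> (nat \<Rightarrow> 'v::real_vector) \<Rightarrow> 'v \<Rightarrow> real Matrix.vec"
  where "coords n b w = (THE c. c \<in> carrier_vec n \<and> w = lin_comb n b c)"

definition mat_op :: "nat \<Rightarrow> (nat \<Rightarrow> 'v::real_vector) \<Rightarrow> real Matrix.mat \<Rightarrow> 'v \<Rightarrow> 'v"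
  where "mat_op n b A w = lin_comb n b (A *\<^sub>v coords n b w)"

definition basis_change :: "nat \<Rightarrow> (nat \<Rightarrow> 'v::real_vector) \<Rightarrow> (nat \<Rightarrow> 'v) \<Rightarrow> 'v \<Rightarrow> 'v"
  where "basis_change n b b' w = lin_comb n b' (coords n b w)"

(* Component i of w along the (direct) sum of the subspaces V j, j \<in> I. *)
definition dsum_proj :: "'i set \<Rightarrow> ('i \<Rightarrow> 'v::real_vector set) \<Rightarrow> 'i \<Rightarrow> 'v \<Rightarrow> 'v"
  where "dsum_proj I V i w =
    (THE d. (\<forall>j\<in>I. d j \<in> V j) \<and> (\<forall>j. j \<notin> I \<longrightarrow> d j = 0) \<and> w = (\<Sum>j\<in>I. d j)) i"

(* Adjoint of a map defined on the subspace V of an inner product space with form ip. *)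
definition adjoint_on :: "('v \<Rightarrow> 'v \<Rightarrow> real) \<Rightarrow> 'v set \<Rightarrow> ('v \<Rightarrow> 'v) \<Rightarrow> 'v \<Rightarrow> 'v"
  where "adjoint_on ip V L y = (THE x. x \<in> V \<and> (\<forall>v\<in>V. ip (L v) y = ip v x))"

definition eigenvalues_on :: "'v::real_vector set \<Rightarrow> ('v \<Rightarrow> 'v) \<Rightarrow> real set"
  where "eigenvalues_on V G = {c. \<exists>w\<in>V. w \<noteq> 0 \<and> G w = c *\<^sub>R w}"

section \<open>Polygons, meshes, integrals\<close>

type_synonym plane = "real^2"

(* E is the set of (closed) edges.  The edges are part of the data, so a vertex with a
   straight angle is allowed.  The condition on the interior excludes slits. *)
definition polygonal_domain :: "plane set \<Rightarrow> plane set set \<Rightarrow> bool"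
  where "polygonal_domain U E \<longleftrightarrow>
    open U \<and> connected U \<and> bounded U \<and> U \<noteq> {} \<and> interior (closure U) = U \<and>
    triangulation E \<and> (\<forall>e\<in>E. 1 simplex e) \<and> \<Union>E = frontier U"

definition vertices :: "plane set set \<Rightarrow> plane set"
  where "vertices S = {v. \<exists>K\<in>S. v extreme_point_of K}"

(* The last condition is automatic except at vertices with a straight angle. *)
definition mesh_of :: "plane set \<Rightarrow> plane set set \<Rightarrow> plane set set \<Rightarrow> bool"
  where "mesh_of U E \<T> \<longleftrightarrow>
    triangulation \<T> \<and> (\<forall>K\<in>\<T>. 2 simplex K) \<and> \<Union>\<T> = closure U \<and> vertices E \<subseteq> vertices \<T>"

definition mesh_size :: "plane set set \<Rightarrow> real"
  where "mesh_size \<T> = Max (diameter ` \<T>)"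

definition regular_mesh :: "real \<Rightarrow> plane set set \<Rightarrow> bool"
  where "regular_mesh \<gamma> \<T> \<longleftrightarrow> (\<forall>K\<in>\<T>. \<exists>x. cball x (\<gamma> * diameter K) \<subseteq> K)"

definition quasi_uniform_mesh :: "real \<Rightarrow> plane set set \<Rightarrow> bool"
  where "quasi_uniform_mesh \<gamma> \<T> \<longleftrightarrow> (\<forall>K\<in>\<T>. \<exists>x. cball x (\<gamma> * mesh_size \<T>) \<subseteq> K)"

(* On a segment, restrictions of bivariate polynomials of total degree at most d are exactly
   the polynomials of degree at most d in arc length. *)
definition polynomial_on :: "nat \<Rightarrow> plane set \<Rightarrow> (plane \<Rightarrow> real) \<Rightarrow> bool"
  where "polynomial_on d S f \<longleftrightarrow>
    (\<exists>c :: nat \<Rightarrow> nat \<Rightarrow> real. \<forall>x\<in>S. f x = (\<Sum>a\<le>d. \<Sum>b\<le>d - a. c a b * (x $ 1) ^ a * (x $ 2) ^ b))"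

definition zero_ext :: "plane set \<Rightarrow> (plane \<Rightarrow> real) \<Rightarrow> plane \<Rightarrow> real"
  where "zero_ext S f = (\<lambda>x. if x \<in> S then f x else 0)"

definition grad :: "(plane \<Rightarrow> real) \<Rightarrow> plane \<Rightarrow> plane"
  where "grad f x = (THE D. GDERIV f x :> D)"

(* Line integral over a closed segment; the value does not depend on the orientation chosen. *)
definition edge_integral :: "plane set \<Rightarrow> (plane \<Rightarrow> real) \<Rightarrow> real"
  where "edge_integral e f =
    (case SOME (a, b). e = closed_segment a b of
      (a, b) \<Rightarrow> dist a b * (LINT t:{0..1}|lebesgue. f (linepath a b t)))"

section \<open>Mortar discretization and BDDC operators\<close>

type_synonym pairfun = "(plane \<Rightarrow> real) \<times> (plane \<Rightarrow> real)"

(* Subdomains carry the indices 1..nsub and interfaces the indices 1..nif. *)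
record bddc_data =
  Omega :: "plane set"
  rho :: "plane \<Rightarrow> real"
  eps :: "plane \<Rightarrow> real"
  nsub :: nat
  Sub :: "nat \<Rightarrow> plane set"
  Edges :: "nat \<Rightarrow> plane set set"             \<comment> \<open>edges of the polygon \<open>Sub i\<close>\<close>
  mesh :: "nat \<Rightarrow> plane set set"
  mesh_const :: real                             \<comment> \<open>shape constant of the meshes\<close>
  fe_deg :: nat
  nif :: nat
  iface :: "nat \<Rightarrow> nat \<times> nat"                \<comment> \<open>the subdomains \<open>i < j\<close> sharing interface \<open>k\<close>\<close>
  nonmortar :: "nat \<Rightarrow> nat"                   \<comment> \<open>nonmortar subdomain of interface \<open>k\<close>\<close>
  mbasis :: "nat \<Rightarrow> nat \<Rightarrow> plane \<Rightarrow> real"  \<comment> \<open>multiplier basis on interface \<open>k\<close>\<close>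
  nDelta :: "nat \<Rightarrow> nat"
  Tmat :: "nat \<Rightarrow> real Matrix.mat"
  Dmat :: "nat \<Rightarrow> nat \<Rightarrow> real Matrix.mat"          \<comment> \<open>interface, subdomain\<close>
  Dcheck_mat :: "nat \<Rightarrow> nat \<Rightarrow> real Matrix.mat"    \<comment> \<open>interface, subdomain\<close>

locale bddc =
  fixes P :: bddc_data
begin

abbreviation "N \<equiv> nsub P"
abbreviation "M \<equiv> nif P"

definition common :: "nat \<Rightarrow> nat \<Rightarrow> plane set"
  where "common i j = frontier (Sub P i) \<inter> frontier (Sub P j)"

definition is_interface :: "nat \<Rightarrow> nat \<Rightarrow> bool"
  where "is_interface i j \<longleftrightarrow>
    i \<in> {1..N} \<and> j \<in> {1..N} \<and> i \<noteq> j \<and> common i j \<in> Edges P i \<inter> Edges P j"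

(* Both orderings of the two subdomains adjacent to interface k. *)
definition sides :: "nat \<Rightarrow> (nat \<times> nat) set"
  where "sides k = {iface P k, prod.swap (iface P k)}"

definition F_closed :: "nat \<Rightarrow> plane set"
  where "F_closed k = common (fst (iface P k)) (snd (iface P k))"

(* Interfaces are taken without their end points, which may lie on the boundary of Omega. *)
definition F :: "nat \<Rightarrow> plane set"
  where "F k = rel_interior (F_closed k)"

definition ifaces_of :: "nat \<Rightarrow> nat set"
  where "ifaces_of i = {k \<in> {1..M}. F k \<subseteq> frontier (Sub P i) - frontier (Omega P)}"

definition C_F :: nat
  where "C_F = Max ((\<lambda>i. card (ifaces_of i)) ` {1..N})"

subsection \<open>Spaces and forms\<close>

definition fe_functions :: "nat \<Rightarrow> (plane \<Rightarrow> real) set"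
  where "fe_functions i = {v. continuous_on (closure (Sub P i)) v \<and>
    (\<forall>K\<in>mesh P i. polynomial_on (fe_deg P) K v) \<and>
    (\<forall>x\<in>frontier (Sub P i) \<inter> frontier (Omega P). v x = 0)}"

(* Elements of the direct sum of the X i jump across interfaces.  As L2 functions they are
   represented by the function vanishing outside the open subdomains; their one-sided
   boundary values are recovered by trace. *)
definition X :: "nat \<Rightarrow> (plane \<Rightarrow> real) set"
  where "X i = zero_ext (Sub P i) ` fe_functions i"

definition trace :: "nat \<Rightarrow> (plane \<Rightarrow> real) \<Rightarrow> plane \<Rightarrow> real"
  where "trace i v x = Lim (at x within Sub P i) v"

definition trace_mesh :: "nat \<Rightarrow> plane set \<Rightarrow> plane set set"
  where "trace_mesh i e = {d. \<exists>K\<in>mesh P i. d edge_of K \<and> d \<subseteq> e}"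

definition multipliers :: "nat \<Rightarrow> (plane \<Rightarrow> real) set"
  where "multipliers k = {m. continuous_on (F_closed k) m \<and>
    (\<forall>d\<in>trace_mesh (nonmortar P k) (F_closed k).
      polynomial_on (fe_deg P) d m \<and>
      ((\<exists>v\<in>d. v extreme_point_of F_closed k) \<longrightarrow> polynomial_on (fe_deg P - 1) d m))}"

definition MF :: "nat \<Rightarrow> (plane \<Rightarrow> real) set"
  where "MF k = zero_ext (F k) ` multipliers k"

definition ndof :: "nat \<Rightarrow> nat"
  where "ndof k = dim (MF k)"

definition ip :: "pairfun \<Rightarrow> pairfun \<Rightarrow> real"
  where "ip = (\<lambda>(u, p) (v, q).
    (LINT x:Omega P|lebesgue. u x * v x) + (\<Sum>k=1..M. edge_integral (F_closed k) (\<lambda>x. p x * q x)))"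

definition a_form :: "nat \<Rightarrow> (plane \<Rightarrow> real) \<Rightarrow> (plane \<Rightarrow> real) \<Rightarrow> real"
  where "a_form i u v =
    (LINT x:Sub P i|lebesgue. rho P x * (grad u x \<bullet> grad v x) + eps P x * u x * v x)"

definition H1_norm_sq :: "nat \<Rightarrow> (plane \<Rightarrow> real) \<Rightarrow> real"
  where "H1_norm_sq i v = (LINT x:Sub P i|lebesgue. (norm (grad v x))\<^sup>2 + (v x)\<^sup>2)"

definition b_form :: "nat \<Rightarrow> (plane \<Rightarrow> real) \<Rightarrow> (plane \<Rightarrow> real) \<Rightarrow> real"
  where "b_form i v p = (\<Sum>r | is_interface i r.
    edge_integral (common i r) (\<lambda>x. (if i < r then 1 else - 1) * trace i v x * p x))"

definition A_loc :: "nat \<Rightarrow> pairfun \<Rightarrow> pairfun \<Rightarrow> real"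
  where "A_loc i = (\<lambda>(u, p) (v, q). - (a_form i u v + b_form i v p + b_form i u q))"

definition A_form :: "pairfun \<Rightarrow> pairfun \<Rightarrow> real"
  where "A_form u v = (\<Sum>i=1..N. A_loc i u v)"

definition V_I_loc :: "nat \<Rightarrow> pairfun set"
  where "V_I_loc i = {(v, 0) | v. v \<in> X i}"

definition V_I :: "pairfun set"
  where "V_I = (\<Sum>i\<in>{1..N}. V_I_loc i)"

definition V_F :: "nat \<Rightarrow> pairfun set"
  where "V_F k = {(0, p) | p. p \<in> MF k}"

definition V_loc :: "nat \<Rightarrow> pairfun set"
  where "V_loc i = V_I_loc i + (\<Sum>k\<in>ifaces_of i. V_F k)"

subsection \<open>Basis functions\<close>

definition phi :: "nat \<Rightarrow> nat \<Rightarrow> pairfun"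
  where "phi k l = (THE w. w \<in> V_I + V_F k \<and> snd w = mbasis P k l \<and> (\<forall>v\<in>V_I. A_form w v = 0))"

definition phi_loc :: "nat \<Rightarrow> nat \<Rightarrow> nat \<Rightarrow> pairfun"
  where "phi_loc k \<nu> l = (THE w. w \<in> V_I_loc \<nu> + V_F k \<and> snd w = mbasis P k l \<and>
    (\<forall>v\<in>V_I_loc \<nu>. A_loc \<nu> w v = 0))"

definition phi_bar :: "nat \<Rightarrow> nat \<Rightarrow> nat \<Rightarrow> pairfun"
  where "phi_bar k \<nu> l = (THE w. w \<in> V_loc \<nu> \<and> (\<forall>x\<in>F k. snd w x = mbasis P k l x) \<and>
    (\<forall>v\<in>V_I_loc \<nu> + (\<Sum>m\<in>ifaces_of \<nu> - {k}. V_F m). A_loc \<nu> w v = 0))"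

definition T_op :: "nat \<Rightarrow> (nat \<Rightarrow> pairfun) \<Rightarrow> pairfun \<Rightarrow> pairfun"
  where "T_op k b = mat_op (ndof k) b (Tmat P k)"

definition phi_hat :: "nat \<Rightarrow> nat \<Rightarrow> pairfun"
  where "phi_hat k l = T_op k (phi k) (phi k l)"

definition phi_tilde :: "nat \<Rightarrow> nat \<Rightarrow> nat \<Rightarrow> pairfun"
  where "phi_tilde k \<nu> l = T_op k (phi_loc k \<nu>) (phi_loc k \<nu> l)"

definition phi_bar_tilde :: "nat \<Rightarrow> nat \<Rightarrow> nat \<Rightarrow> pairfun"
  where "phi_bar_tilde k \<nu> l = T_op k (phi_bar k \<nu>) (phi_bar k \<nu> l)"

definition W :: "nat \<Rightarrow> pairfun set"
  where "W k = span (phi k ` {..<ndof k})"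

definition W_hat :: "pairfun set"
  where "W_hat = (\<Sum>k\<in>{1..M}. W k)"

definition W_Delta :: "nat \<Rightarrow> pairfun set"
  where "W_Delta k = span (phi_hat k ` {..<nDelta P k})"

definition W_Pi_k :: "nat \<Rightarrow> pairfun set"
  where "W_Pi_k k = span (phi_hat k ` {nDelta P k..<ndof k})"

definition W_Pi :: "pairfun set"
  where "W_Pi = (\<Sum>k\<in>{1..M}. W_Pi_k k)"

definition W_loc_Delta :: "nat \<Rightarrow> nat \<Rightarrow> pairfun set"
  where "W_loc_Delta k i = span (phi_tilde k i ` {..<nDelta P k})"

definition W_dual :: "nat \<Rightarrow> pairfun set"
  where "W_dual i = (\<Sum>k\<in>ifaces_of i. W_loc_Delta k i)"

definition W_tilde :: "pairfun set"
  where "W_tilde = (\<Sum>i\<in>{1..N}. W_dual i) + W_Pi"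

subsection \<open>Scaling, and the requirement defining the adaptive primal space\<close>

(* The scaling operator of side \<nu> acting on the space W_k of side \<mu>. *)
definition D_op :: "nat \<Rightarrow> nat \<Rightarrow> nat \<Rightarrow> pairfun \<Rightarrow> pairfun"
  where "D_op k \<nu> \<mu> = mat_op (ndof k) (phi_loc k \<mu>) (Dmat P k \<nu>)"

definition D_check :: "nat \<Rightarrow> nat \<Rightarrow> pairfun \<Rightarrow> pairfun"
  where "D_check k \<nu> = mat_op (ndof k) (phi_hat k) (Dcheck_mat P k \<nu>)"

definition D_check_loc :: "nat \<Rightarrow> nat \<Rightarrow> nat \<Rightarrow> pairfun \<Rightarrow> pairfun"
  where "D_check_loc k \<nu> \<mu> = mat_op (ndof k) (phi_tilde k \<mu>) (Dcheck_mat P k \<nu>)"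

definition T_to_loc :: "nat \<Rightarrow> nat \<Rightarrow> pairfun \<Rightarrow> pairfun"
  where "T_to_loc k i = basis_change (ndof k) (phi_hat k) (phi_tilde k i)"

definition T_from_loc :: "nat \<Rightarrow> nat \<Rightarrow> pairfun \<Rightarrow> pairfun"
  where "T_from_loc k i = basis_change (ndof k) (phi_tilde k i) (phi_hat k)"

definition T_swap :: "nat \<Rightarrow> nat \<Rightarrow> nat \<Rightarrow> pairfun \<Rightarrow> pairfun"
  where "T_swap k i j = basis_change (ndof k) (phi_tilde k i) (phi_tilde k j)"

definition adaptive_bound :: "real \<Rightarrow> nat \<Rightarrow> nat \<Rightarrow> nat \<Rightarrow> bool"
  where "adaptive_bound \<Theta> k i j \<longleftrightarrow>
    (\<forall>w \<in> carrier_vec (nDelta P k). \<forall>v \<in> carrier_vec (ndof k - nDelta P k).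
      let w_Delta = (\<lambda>\<nu>. \<Sum>l<nDelta P k. vec_index w l *\<^sub>R phi_tilde k \<nu> l);
          wb_Delta = (\<Sum>l<nDelta P k. vec_index w l *\<^sub>R phi_bar_tilde k i l);
          wb_Pi = (\<Sum>l<ndof k - nDelta P k. vec_index v l *\<^sub>R phi_bar_tilde k i (nDelta P k + l))
      in A_loc i (D_op k j i (w_Delta i)) (D_op k j i (w_Delta i)) +
         A_loc j (D_op k i j (w_Delta j)) (D_op k i j (w_Delta j))
         \<le> \<Theta> * A_loc i (wb_Delta + wb_Pi) (wb_Delta + wb_Pi))"

definition check_bound :: "nat \<Rightarrow> nat \<Rightarrow> nat \<Rightarrow> bool"
  where "check_bound k i j \<longleftrightarrow>
    (\<forall>w \<in> W_loc_Delta k i.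
      let w' = T_swap k i j w
      in A_loc i (D_check_loc k j i w) (D_check_loc k j i w) +
         A_loc j (D_check_loc k i j w') (D_check_loc k i j w')
         \<le> A_loc i (D_op k j i w) (D_op k j i w) + A_loc j (D_op k i j w') (D_op k i j w'))"

subsection \<open>Operators\<close>

(* The decompositions of W_tilde and W_hat are indexed by an option type: None stands for
   the primal summand W_Pi. *)
definition R_Delta :: "nat \<Rightarrow> pairfun \<Rightarrow> pairfun"
  where "R_Delta i = dsum_proj (insert None (Some ` {1..N})) (case_option W_Pi W_dual) (Some i)"

definition R_Pi :: "pairfun \<Rightarrow> pairfun"
  where "R_Pi = dsum_proj (insert None (Some ` {1..N})) (case_option W_Pi W_dual) None"

definition R_k_Delta :: "nat \<Rightarrow> nat \<Rightarrow> pairfun \<Rightarrow> pairfun"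
  where "R_k_Delta i k = dsum_proj (ifaces_of i) (\<lambda>m. W_loc_Delta m i) k"

definition R_k_Pi :: "nat \<Rightarrow> pairfun \<Rightarrow> pairfun"
  where "R_k_Pi k = dsum_proj {1..M} W_Pi_k k"

definition local_part :: "nat \<Rightarrow> pairfun \<Rightarrow> pairfun"
  where "local_part i u =
    (\<Sum>k\<in>ifaces_of i. R_k_Delta i k (R_Delta i u) + T_to_loc k i (R_k_Pi k (R_Pi u)))"

definition A_tilde :: "pairfun \<Rightarrow> pairfun \<Rightarrow> real"
  where "A_tilde u v = (\<Sum>i=1..N. A_loc i (local_part i u) (local_part i v))"

definition S_tilde :: "pairfun \<Rightarrow> pairfun"
  where "S_tilde u = (THE s. s \<in> W_tilde \<and> (\<forall>v\<in>W_tilde. ip s v = A_tilde u v))"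

definition S_tilde_inv :: "pairfun \<Rightarrow> pairfun"
  where "S_tilde_inv = inv_into W_tilde S_tilde"

definition hat_Delta :: "nat \<Rightarrow> pairfun \<Rightarrow> pairfun"
  where "hat_Delta k = dsum_proj (insert None (Some ` {1..M})) (case_option W_Pi W_Delta) (Some k)"

definition hat_Pi :: "pairfun \<Rightarrow> pairfun"
  where "hat_Pi = dsum_proj (insert None (Some ` {1..M})) (case_option W_Pi W_Delta) None"

definition I_Gamma :: "pairfun \<Rightarrow> pairfun"
  where "I_Gamma w = hat_Pi w +
    (\<Sum>k=1..M. T_to_loc k (fst (iface P k)) (hat_Delta k w) + T_to_loc k (snd (iface P k)) (hat_Delta k w))"

definition R_Delta_Gamma :: "nat \<Rightarrow> pairfun \<Rightarrow> pairfun"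
  where "R_Delta_Gamma i w = (\<Sum>k\<in>ifaces_of i. D_check k i (T_from_loc k i (R_k_Delta i k w)))"

definition E_D :: "pairfun \<Rightarrow> pairfun"
  where "E_D u = (\<Sum>i=1..N. R_Delta_Gamma i (R_Delta i u)) + R_Pi u"

definition S_hat :: "pairfun \<Rightarrow> pairfun"
  where "S_hat = adjoint_on ip W_hat I_Gamma \<circ> S_tilde \<circ> I_Gamma"

definition G_hat :: "pairfun \<Rightarrow> pairfun"
  where "G_hat = (E_D \<circ> S_tilde_inv \<circ> adjoint_on ip W_tilde E_D) \<circ> S_hat"

definition lambda_max :: real
  where "lambda_max = Max (eigenvalues_on W_hat G_hat)"

definition lambda_min :: real
  where "lambda_min = Min (eigenvalues_on W_hat G_hat)"

definition cond_number :: real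
  where "cond_number = lambda_max / lambda_min"

end

locale mortar_discretization = bddc +
  assumes Omega: "\<exists>E. polygonal_domain (Omega P) E"
    and rho_measurable: "rho P \<in> borel_measurable (lebesgue_on (Omega P))"
    and rho_bounded: "bounded (rho P ` Omega P)"
    and rho_pos: "\<exists>rho_min>0. \<forall>x\<in>Omega P. rho_min \<le> rho P x"
    and eps_measurable: "eps P \<in> borel_measurable (lebesgue_on (Omega P))"
    and eps_bounded: "bounded (eps P ` Omega P)"
    and eps_nonneg: "\<forall>x\<in>Omega P. 0 \<le> eps P x"
    and subdomains: "\<forall>i\<in>{1..N}. polygonal_domain (Sub P i) (Edges P i)"
    and subdomains_disjoint: "\<forall>i\<in>{1..N}. \<forall>j\<in>{1..N}. i \<noteq> j \<longrightarrow> Sub P i \<inter> Sub P j = {}"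
    and subdomains_cover: "closure (Omega P) = (\<Union>i\<in>{1..N}. closure (Sub P i))"
    and conforming: "\<forall>i\<in>{1..N}. \<forall>j\<in>{1..N}. i \<noteq> j \<longrightarrow>
      common i j = {} \<or>
      (\<exists>v \<in> vertices (Edges P i) \<inter> vertices (Edges P j). common i j = {v}) \<or>
      common i j \<in> Edges P i \<inter> Edges P j"
    and meshes: "\<forall>i\<in>{1..N}. mesh_of (Sub P i) (Edges P i) (mesh P i)"
    and mesh_const_pos: "0 < mesh_const P"
    and mesh_regularity: "\<forall>i\<in>{1..N}.
      regular_mesh (mesh_const P) (mesh P i) \<or> quasi_uniform_mesh (mesh_const P) (mesh P i)"
    and fe_deg: "1 \<le> fe_deg P"
    and interfaces: "bij_betw (iface P) {1..M} {(i, j). i < j \<and> is_interface i j}"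
    and some_interface: "1 \<le> M" \<comment> \<open>otherwise \<open>W_hat\<close> is trivial and has no eigenvalues\<close>
    and nonmortar: "\<forall>k\<in>{1..M}. \<exists>(i, j)\<in>sides k.
      nonmortar P k = i \<and> mesh_size (mesh P j) \<le> mesh_size (mesh P i)"
    and mbasis: "\<forall>k\<in>{1..M}. is_basis (ndof k) (mbasis P k) (MF k)"
    and coercive: "\<forall>i\<in>{1..N}. \<exists>\<alpha>>0. \<forall>v\<in>X i. \<alpha> * H1_norm_sq i v \<le> a_form i v v"
    and multiplier_injective: "\<forall>i\<in>{1..N}. \<forall>p \<in> (\<Sum>k\<in>ifaces_of i. MF k).
      (\<forall>v\<in>X i. b_form i v p = 0) \<longrightarrow> p = 0"

locale adaptive_bddc = mortar_discretization +
  fixes \<Theta> :: real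
  assumes D_matrices: "\<forall>k\<in>{1..M}. \<forall>(i, j)\<in>sides k.
      Dmat P k i \<in> carrier_mat (ndof k) (ndof k) \<and> invertible_mat (Dmat P k i) \<and>
      Dmat P k i + Dmat P k j = 1\<^sub>m (ndof k)"
    and T_matrix: "\<forall>k\<in>{1..M}. Tmat P k \<in> carrier_mat (ndof k) (ndof k) \<and> invertible_mat (Tmat P k)"
    and splitting: "\<forall>k\<in>{1..M}. nDelta P k \<le> ndof k"
    and adaptive: "\<forall>k\<in>{1..M}. \<forall>(i, j)\<in>sides k. adaptive_bound \<Theta> k i j"
    and Dcheck_matrices: "\<forall>k\<in>{1..M}. \<forall>(i, j)\<in>sides k.
      Dcheck_mat P k i \<in> carrier_mat (ndof k) (ndof k) \<and>
      Dcheck_mat P k i + Dcheck_mat P k j = 1\<^sub>m (ndof k)"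
    and check: "\<forall>k\<in>{1..M}. \<forall>(i, j)\<in>sides k. check_bound k i j"

end

theory Submission
  imports Defs "Jordan_Normal_Form.Char_Poly"
begin

text \<open>
  Eliminating the subdomain unknowns turns every space of the method into a space of multipliers on
  the interfaces, and each \<open>A_loc i\<close> into a symmetric positive definite Schur complement form.
  Because \<open>E_D \<circ> I_Gamma\<close> is the identity, every eigenvalue of \<open>G_hat\<close> is at least 1, and it is at most
  \<open>K\<close> whenever \<open>I_Gamma \<circ> E_D\<close> has squared energy norm at most \<open>K\<close>.  In \<open>u - I_Gamma (E_D u)\<close> only
  the difference of the two dual parts on each interface survives, scaled by the opposite weight;
  the requirement on the primal space, together with the minimality of the energy of
  \<open>phi_bar\<close>, bounds its energy by \<open>2 * \<Theta>\<close> times that of \<open>u\<close> on the two adjacent subdomains.  Summation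
  over the at most \<open>C_F\<close> interfaces of each subdomain gives \<open>K = (2 + 4 * C_F\<^sup>2) * \<Theta>\<close>.
\<close>

no_notation vec_index (infixl "$" 100)
no_notation scalar_prod (infix "\<bullet>" 70)

section \<open>Polygons sharing an edge\<close>

text \<open>The spaces and operators are given by definite descriptions and projections along direct
  sums, so they mean something only once existence and uniqueness are shown. Passing to multipliers
  pays off because basis functions, scalings and transformations act on coefficients, and these do
  not change under the injective maps into the spaces of pairs.

  Two facts are not formal. An open interface has exactly two neighbours, meets no other interface
  and stays off the outer boundary; otherwise sums over subdomains and over interfaces could not be
  exchanged. And in a partially coupled pair the two dual multipliers of an interface add up in the
  second component, so only the subdomain functions tell them apart, through injectivity of the
  multiplier coupling.

  The requirement on the primal space bounds a dual part only by the energy of its own subdomain.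
  Hence the jump is split into two dual parts, the source of the factor 2. One factor
  \<open>C_F\<close> comes from adding the jumps within a subdomain, the other from counting the
  energy of a subdomain once for each of its interfaces.\<close>

lemma one_simplex_cases:
  fixes e :: "plane set"
  assumes "1 simplex e"
  obtains a b where "a \<noteq> b" "e = closed_segment a b"
proof -
  obtain C where C: "\<not> affine_dependent C" "int (card C) = 1 + 1" "e = convex hull C"
    using assms by (auto simp: simplex)
  hence "card C = 2" by simp
  then obtain a b where "C = {a, b}" "a \<noteq> b" by (auto simp: card_2_iff)
  thus thesis using C that by (simp add: segment_convex_hull)
qed

lemma face_meets_rel_interior:
  fixes S T :: "'a::euclidean_space set"
  assumes "T face_of S" "x \<in> T" "x \<in> rel_interior S" 
  shows "T = S"
  using assms by (meson disjoint_iff face_of_disjoint_rel_interior)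

text \<open>Locally a polygon lies on exactly one side of each of its edges: not on neither, since the edge is in
  its closure, and not on both, since it is the interior of its closure.\<close>
lemma polygon_edge_half_balls:
  assumes U: "polygonal_domain U E" and e: "e \<in> E" and x: "x \<in> rel_interior e"
    and n: "affine hull e = {y. n \<bullet> y = c}"
  shows "\<exists>r>0. (ball x r \<inter> {y. n \<bullet> y > c} \<subseteq> U \<and> ball x r \<inter> {y. n \<bullet> y < c} \<inter> U = {}) \<or>
    (ball x r \<inter> {y. n \<bullet> y < c} \<subseteq> U \<and> ball x r \<inter> {y. n \<bullet> y > c} \<inter> U = {})"
proof -
  have op: "open U" and int: "interior (closure U) = U" and tri: "triangulation E"
    and s1: "\<And>e. e \<in> E \<Longrightarrow> 1 simplex e" and fr: "\<Union>E = frontier U"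
    using U by (auto simp: polygonal_domain_def)
  \<comment> \<open>Two edges meet in a common face of both. If it contains a relative interior
    point of \<open>e\<close>, it is all of \<open>e\<close>, which would then be a proper face of
    the equally one-dimensional \<open>e'\<close>.\<close>
  have other: "x \<notin> e'" if "e' \<in> E" "e' \<noteq> e" for e'
  proof
    assume "x \<in> e'"
    have "e \<inter> e' face_of e" "e' \<inter> e face_of e'"
      using tri that e by (simp_all add: triangulation_def)
    hence "e \<inter> e' face_of e" "e \<inter> e' face_of e'" by (simp_all add: Int_commute)
    moreover have "x \<in> e" using x rel_interior_subset by blast
    ultimately have "e \<inter> e' = e" using face_meets_rel_interior[of "e \<inter> e'" e x] x \<open>x \<in> e'\<close> by auto
    hence f: "e face_of e'" using \<open>e \<inter> e' face_of e'\<close> by simp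
    have "aff_dim e = 1" "aff_dim e' = 1"
      using s1[OF e] s1[OF that(1)] by (auto simp: aff_dim_simplex)
    moreover have "convex e'" using s1[OF that(1)] by (rule convex_simplex)
    ultimately show False using face_of_aff_dim_lt[OF _ f] that by auto
  qed
  have cl: "closed (\<Union>(E - {e}))"
    by (rule closed_Union) (use tri s1 closed_simplex in \<open>auto simp: triangulation_def\<close>)
  have "x \<notin> \<Union>(E - {e})" using other by auto
  then obtain r1 where r1: "r1 > 0" "ball x r1 \<inter> \<Union>(E - {e}) = {}"
    using cl by (metis Compl_iff open_Compl openE disjoint_eq_subset_Compl)
  obtain r2 where r2: "r2 > 0" "ball x r2 \<inter> affine hull e \<subseteq> e"
    using x by (auto simp: mem_rel_interior_ball)
  define r where "r = min r1 r2"
  have r: "r > 0" using r1 r2 by (simp add: r_def)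
  have br: "ball x r \<subseteq> ball x r1" "ball x r \<subseteq> ball x r2" by (auto simp: r_def)
  have "frontier U \<subseteq> \<Union>(E - {e}) \<union> e" "e \<subseteq> frontier U" using fr e by blast+
  hence "ball x r \<inter> frontier U \<subseteq> e" "ball x r \<inter> affine hull e \<subseteq> frontier U"
    using br r1(2) r2(2) by blast+
  moreover have "e \<subseteq> affine hull e" by (rule hull_subset)
  ultimately have line: "ball x r \<inter> frontier U = ball x r \<inter> {y. n \<bullet> y = c}"
    using n by blast
  define H1 H2 where "H1 = ball x r \<inter> {y. n \<bullet> y > c}" and "H2 = ball x r \<inter> {y. n \<bullet> y < c}"
  \<comment> \<open>By \<open>line\<close>, the open half-balls miss the frontier of
    \<open>U\<close>; being connected, each lies inside \<open>U\<close> or is disjoint from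
    it.\<close>
  have dich: "H \<subseteq> U \<or> H \<inter> U = {}" if "H = H1 \<or> H = H2" for H
  proof -
    have "convex H" using that convex_halfspace_gt convex_halfspace_lt
      by (auto simp: H1_def H2_def intro!: convex_Int)
    hence "connected H" by (rule convex_connected)
    moreover have "H \<inter> frontier U = {}" using that line by (auto simp: H1_def H2_def)
    ultimately show ?thesis using connected_Int_frontier[of H U] by blast
  qed
  have un: "ball x r \<subseteq> H1 \<union> H2 \<union> (ball x r \<inter> frontier U)"
    unfolding line by (auto simp: H1_def H2_def)
  have xf: "x \<in> frontier U" using x e fr rel_interior_subset by blast
  have "\<not> (H1 \<subseteq> U \<and> H2 \<subseteq> U)"
  proof
    assume "H1 \<subseteq> U \<and> H2 \<subseteq> U"
    moreover have "frontier U \<subseteq> closure U" by (simp add: frontier_def)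
    ultimately have "ball x r \<subseteq> closure U" using un closure_subset[of U] by blast
    hence "x \<in> interior (closure U)" using r by (meson centre_in_ball interior_maximal open_ball subsetD)
    thus False using int xf op by (simp add: frontier_def interior_open)
  qed
  moreover have "\<not> (H1 \<inter> U = {} \<and> H2 \<inter> U = {})"
  proof
    assume *: "H1 \<inter> U = {} \<and> H2 \<inter> U = {}"
    have "x \<in> closure U" using xf by (simp add: frontier_def)
    then obtain y where y: "y \<in> U" "y \<in> ball x r" using r by (metis closure_approachable dist_commute mem_ball)
    hence "y \<in> frontier U" using un * by blast
    thus False using y op by (simp add: frontier_def interior_open)
  qed
  ultimately show ?thesis using dich[of H1] dich[of H2] r unfolding H1_def H2_def by blast
qed

text \<open>Kept as pure set algebra: \<open>H\<close> and \<open>H'\<close> are the open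
  half-planes and \<open>L\<close> the line between them. Since both halves of \<open>B\<close> are
  nonempty, the disjoint sets \<open>U\<close> and \<open>U'\<close> cannot occupy the same
  one.\<close>

lemma opposite_halves:
  assumes "B \<subseteq> B1" "B \<subseteq> B2"
    and "(B1 \<inter> H \<subseteq> U \<and> B1 \<inter> H' \<inter> U = {}) \<or> (B1 \<inter> H' \<subseteq> U \<and> B1 \<inter> H \<inter> U = {})"
    and "(B2 \<inter> H \<subseteq> U' \<and> B2 \<inter> H' \<inter> U' = {}) \<or> (B2 \<inter> H' \<subseteq> U' \<and> B2 \<inter> H \<inter> U' = {})"
    and "U \<inter> U' = {}" "B \<inter> L \<subseteq> V" "H \<union> H' \<union> L = UNIV" "B \<inter> H \<noteq> {}" "B \<inter> H' \<noteq> {}"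
  shows "B \<subseteq> U \<union> U' \<union> V"
proof -
  have *: "B \<inter> H \<subseteq> U \<and> B \<inter> H' \<inter> U = {} \<or> B \<inter> H' \<subseteq> U \<and> B \<inter> H \<inter> U = {}"
    using assms(1,3) by auto
  have **: "B \<inter> H \<subseteq> U' \<and> B \<inter> H' \<inter> U' = {} \<or> B \<inter> H' \<subseteq> U' \<and> B \<inter> H \<inter> U' = {}"
    using assms(2,4) by auto
  obtain y y' where "y \<in> B \<inter> H" "y' \<in> B \<inter> H'" using assms(8,9) by auto
  hence "B \<inter> H \<subseteq> U \<union> U' \<and> B \<inter> H' \<subseteq> U \<union> U'"
    using * ** assms(5) by auto
  thus ?thesis using assms(6,7) by auto
qed

text \<open>Each polygon lies on one side of the common edge, and disjointness makes the sides
  different, so together they fill a neighbourhood. This leaves no room there for a third subdomain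
  or for the outer boundary.\<close>

lemma shared_edge_ball:
  assumes "polygonal_domain U E" "polygonal_domain U' E'" "U \<inter> U' = {}"
    and e: "e \<in> E" "e \<in> E'" and x: "x \<in> rel_interior e"
  shows "\<exists>r>0. ball x r \<subseteq> closure U \<union> closure U'"
proof -
  have s1: "1 simplex e" using assms by (auto simp: polygonal_domain_def)
  hence "aff_dim e = int DIM(plane) - 1" by (simp add: aff_dim_simplex)
  then obtain n c where n: "n \<noteq> 0" "affine hull e = {y. n \<bullet> y = c}"
    using aff_dim_eq_hyperplane[of e] by auto
  obtain r1 where r1: "r1 > 0" "(ball x r1 \<inter> {y. n \<bullet> y > c} \<subseteq> U \<and> ball x r1 \<inter> {y. n \<bullet> y < c} \<inter> U = {}) \<or>
    (ball x r1 \<inter> {y. n \<bullet> y < c} \<subseteq> U \<and> ball x r1 \<inter> {y. n \<bullet> y > c} \<inter> U = {})"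
    using polygon_edge_half_balls[OF assms(1) e(1) x n(2)] by blast
  obtain r2 where r2: "r2 > 0" "(ball x r2 \<inter> {y. n \<bullet> y > c} \<subseteq> U' \<and> ball x r2 \<inter> {y. n \<bullet> y < c} \<inter> U' = {}) \<or>
    (ball x r2 \<inter> {y. n \<bullet> y < c} \<subseteq> U' \<and> ball x r2 \<inter> {y. n \<bullet> y > c} \<inter> U' = {})"
    using polygon_edge_half_balls[OF assms(2) e(2) x n(2)] by blast
  have frs: "e \<subseteq> frontier U" using assms by (auto simp: polygonal_domain_def)
  have xl: "n \<bullet> x = c" using x n(2) rel_interior_subset hull_subset[of e affine] by blast
  obtain r3 where r3: "r3 > 0" "ball x r3 \<inter> affine hull e \<subseteq> e"
    using x by (auto simp: mem_rel_interior_ball)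
  define r where "r = min r1 (min r2 r3)"
  have r: "r > 0" using r1 r2 r3 by (simp add: r_def)
  \<comment> \<open>A step of length \<open>r / 2\<close> along the normal, in either direction,
    reaches both half-planes inside the ball.\<close>
  have ne: "\<exists>y\<in>ball x r. n \<bullet> y > c" "\<exists>y\<in>ball x r. n \<bullet> y < c"
  proof -
    define t where "t = r / 2 / norm n"
    have t: "t > 0" using r n by (simp add: t_def)
    have "norm (t *\<^sub>R n) < r" using r n by (simp add: t_def)
    hence b: "x + t *\<^sub>R n \<in> ball x r" "x - t *\<^sub>R n \<in> ball x r" by (auto simp: dist_norm)
    have "t * (n \<bullet> n) > 0" using t n by simp
    hence "n \<bullet> (x + t *\<^sub>R n) > c" "n \<bullet> (x - t *\<^sub>R n) < c"
      using xl by (simp_all add: inner_add_right inner_diff_right)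
    thus "\<exists>y\<in>ball x r. n \<bullet> y > c" "\<exists>y\<in>ball x r. n \<bullet> y < c"
      using b by blast+
  qed
  have sub: "ball x r \<subseteq> ball x r1" "ball x r \<subseteq> ball x r2" "ball x r \<subseteq> ball x r3" by (auto simp: r_def)
  have "ball x r \<inter> {y. n \<bullet> y = c} \<subseteq> closure U" 
    using r3 sub(3) frs unfolding n(2)[symmetric] by (auto simp: frontier_def)
  moreover have "{y. n \<bullet> y > c} \<union> {y. n \<bullet> y < c} \<union> {y. n \<bullet> y = c} = UNIV" by auto
  moreover have "ball x r \<inter> {y. n \<bullet> y > c} \<noteq> {}" "ball x r \<inter> {y. n \<bullet> y < c} \<noteq> {}" using ne by auto
  ultimately have "ball x r \<subseteq> U \<union> U' \<union> closure U"
    using opposite_halves[OF sub(1,2) r1(2) r2(2) assms(3)] by simp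
  hence "ball x r \<subseteq> closure U \<union> closure U'"
    using closure_subset[of U] closure_subset[of U'] by blast
  thus ?thesis using r by blast
qed

section \<open>Incidence of subdomains and interfaces\<close>

context mortar_discretization
begin

lemma open_Sub: "i \<in> {1..N} \<Longrightarrow> open (Sub P i)"
  using subdomains by (auto simp: polygonal_domain_def)

lemma bounded_Sub: "i \<in> {1..N} \<Longrightarrow> bounded (Sub P i)"
  using subdomains by (auto simp: polygonal_domain_def)

lemma Sub_subset_Omega: "i \<in> {1..N} \<Longrightarrow> Sub P i \<subseteq> Omega P"
proof -
  assume i: "i \<in> {1..N}"
  have "Sub P i \<subseteq> closure (Omega P)" using i subdomains_cover closure_subset by fastforce
  hence "Sub P i \<subseteq> interior (closure (Omega P))" using open_Sub[OF i] by (rule interior_maximal)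
  thus ?thesis using Omega by (auto simp: polygonal_domain_def)
qed

lemma iface_sides:
  assumes "k \<in> {1..M}"
  shows "fst (iface P k) < snd (iface P k)" "is_interface (fst (iface P k)) (snd (iface P k))"
    "fst (iface P k) \<in> {1..N}" "snd (iface P k) \<in> {1..N}"
proof -
  have "iface P k \<in> {(i, j). i < j \<and> is_interface i j}" using interfaces assms by (meson bij_betwE)
  thus "fst (iface P k) < snd (iface P k)" "is_interface (fst (iface P k)) (snd (iface P k))"
    "fst (iface P k) \<in> {1..N}" "snd (iface P k) \<in> {1..N}"
    by (auto simp: is_interface_def case_prod_beta)
qed

lemma common_segment:
  assumes "is_interface i j"
  obtains a b where "a \<noteq> b" "common i j = closed_segment a b"
proof -
  have "1 simplex common i j" using assms subdomains by (auto simp: is_interface_def polygonal_domain_def)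
  thus thesis using one_simplex_cases that by blast
qed

lemma F_neighbourhood:
  assumes "k \<in> {1..M}" "x \<in> F k"
  shows "\<exists>r>0. ball x r \<subseteq> closure (Sub P (fst (iface P k))) \<union> closure (Sub P (snd (iface P k)))"
  using shared_edge_ball[of "Sub P (fst (iface P k))" "Edges P (fst (iface P k))"
    "Sub P (snd (iface P k))" "Edges P (snd (iface P k))" "F_closed k" x]
    iface_sides[OF assms(1)] subdomains subdomains_disjoint assms(2)
  by (auto simp: is_interface_def F_closed_def F_def)

text \<open>Near \<open>x\<close> the plane is covered by the closures of the two adjacent
  subdomains, which an open set disjoint from both subdomains cannot meet.\<close>

lemma F_frontier_imp_side:
  assumes k: "k \<in> {1..M}" and x: "x \<in> F k" and r: "r \<in> {1..N}" and fr: "x \<in> frontier (Sub P r)"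
  shows "r = fst (iface P k) \<or> r = snd (iface P k)"
proof (rule ccontr)
  assume n: "\<not> ?thesis"
  define i j where "i = fst (iface P k)" and "j = snd (iface P k)"
  have ij: "i \<in> {1..N}" "j \<in> {1..N}" using iface_sides[OF k] by (auto simp: i_def j_def)
  obtain d where d: "d > 0" "ball x d \<subseteq> closure (Sub P i) \<union> closure (Sub P j)"
    using F_neighbourhood[OF k x] by (auto simp: i_def j_def)
  have dis: "Sub P r \<inter> Sub P i = {}" "Sub P r \<inter> Sub P j = {}"
    using n r ij subdomains_disjoint by (auto simp: i_def j_def)
  hence "Sub P r \<inter> closure (Sub P i) = {}" "Sub P r \<inter> closure (Sub P j) = {}"
    using open_Sub[OF r] open_Int_closure_eq_empty by blast+
  hence "Sub P r \<inter> ball x d = {}" using d by blast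
  moreover have "x \<in> closure (Sub P r)" using fr by (simp add: frontier_def)
  ultimately show False using d(1) by (metis closure_iff_nhds_not_empty centre_in_ball open_ball order_refl Int_commute)
qed

lemma F_subset_F_closed: "F k \<subseteq> F_closed k"
  unfolding F_def by (rule rel_interior_subset)

lemma F_subset_frontier:
  assumes "i = fst (iface P k) \<or> i = snd (iface P k)"
  shows "F k \<subseteq> frontier (Sub P i)"
  using assms F_subset_F_closed[of k] by (auto simp: F_closed_def common_def)

lemma F_closed_segment:
  assumes "k \<in> {1..M}"
  obtains a b where "a \<noteq> b" "F_closed k = closed_segment a b" "F k = open_segment a b"
  using common_segment[OF iface_sides(2)[OF assms]] that
  by (metis F_closed_def F_def rel_interior_closed_segment)

lemma F_nonempty: "k \<in> {1..M} \<Longrightarrow> F k \<noteq> {}"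
  by (metis F_closed_segment open_segment_eq_empty)

text \<open>\<open>ifaces_of\<close> is defined geometrically; this ties it to the index data
  \<open>iface\<close>. A side is recognized at any single point of the open edge, and the
  neighbourhood of such a point within the closure of \<open>Omega\<close> keeps the edge off the
  outer boundary.\<close>

lemma mem_ifaces_of:
  assumes k: "k \<in> {1..M}" and i: "i \<in> {1..N}"
  shows "k \<in> ifaces_of i \<longleftrightarrow> i = fst (iface P k) \<or> i = snd (iface P k)"
proof
  assume "k \<in> ifaces_of i"
  moreover obtain x where "x \<in> F k" using F_nonempty[OF k] by blast
  ultimately show "i = fst (iface P k) \<or> i = snd (iface P k)"
    using F_frontier_imp_side[OF k _ i] by (auto simp: ifaces_of_def)
next
  assume *: "i = fst (iface P k) \<or> i = snd (iface P k)"
  have "x \<notin> frontier (Omega P)" if "x \<in> F k" for x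
  proof -
    have cl: "closure (Sub P (fst (iface P k))) \<union> closure (Sub P (snd (iface P k))) \<subseteq> closure (Omega P)"
      using subdomains_cover iface_sides[OF k] by auto
    have "x \<in> interior (closure (Omega P))"
      using F_neighbourhood[OF k that] cl by (meson mem_interior subset_trans)
    thus ?thesis using Omega by (auto simp: polygonal_domain_def frontier_def interior_open)
  qed
  thus "k \<in> ifaces_of i" using F_subset_frontier[OF *] k by (auto simp: ifaces_of_def)
qed

lemma ifaces_of_subset: "ifaces_of i \<subseteq> {1..M}" and finite_ifaces_of: "finite (ifaces_of i)"
  by (auto simp: ifaces_of_def)

text \<open>A common point lies on the frontiers of both subdomains of \<open>m\<close>, which must
  then be the sides of \<open>k\<close>. As \<open>iface\<close> lists the smaller index first, the
  two index pairs coincide.\<close>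

lemma F_disjoint:
  assumes k: "k \<in> {1..M}" and m: "m \<in> {1..M}" and x: "x \<in> F k" "x \<in> F_closed m"
  shows "k = m"
proof -
  have "x \<in> frontier (Sub P (fst (iface P m)))" "x \<in> frontier (Sub P (snd (iface P m)))"
    using x by (auto simp: F_closed_def common_def)
  hence "fst (iface P m) = fst (iface P k) \<and> snd (iface P m) = snd (iface P k)"
    using F_frontier_imp_side[OF k x(1), of "fst (iface P m)"]
      F_frontier_imp_side[OF k x(1), of "snd (iface P m)"]
      iface_sides(1)[OF k] iface_sides(1,3,4)[OF m] by auto
  hence "iface P m = iface P k" by (simp add: prod_eq_iff)
  moreover have "inj_on (iface P) {1..M}" using interfaces by (simp add: bij_betw_def)
  ultimately show ?thesis using k m by (simp add: inj_on_eq_iff)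
qed

end

lemma scaleR_fun_apply [simp]: "(c *\<^sub>R f) x = c *\<^sub>R f x"
  by (simp add: scaleR_fun_def)

lemma sum_fun_apply: "(\<Sum>i\<in>I. f i) x = (\<Sum>i\<in>I. f i x)"
  for f :: "'i \<Rightarrow> 'a \<Rightarrow> 'b::comm_monoid_add"
  by (induction I rule: infinite_finite_induct) auto

section \<open>Bounded measurable functions and integrals\<close>

text \<open>Gradients of finite element functions are known only off a null set, so integrands have
  to be compared there. The equality of values is taken from the gauge integral.\<close>

lemma set_integral_spike:
  fixes f g :: "'a::euclidean_space \<Rightarrow> real"
  assumes f: "set_integrable lebesgue S f" and N: "negligible N" and eq: "\<And>x. x \<in> S - N \<Longrightarrow> g x = f x"
  shows "set_integrable lebesgue S g" "(LINT x:S|lebesgue. g x) = (LINT x:S|lebesgue. f x)"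
proof -
  show g: "set_integrable lebesgue S g" by (rule absolutely_integrable_spike[OF f N eq])
  show "(LINT x:S|lebesgue. g x) = (LINT x:S|lebesgue. f x)"
    unfolding set_lebesgue_integral_eq_integral(2)[OF f] set_lebesgue_integral_eq_integral(2)[OF g]
    by (rule integral_spike[OF N]) (metis eq)
qed

text \<open>Measurability is asked only of the cutoff of \<open>f\<close> to \<open>O'\<close>,
  since the rest of \<open>S\<close> is null. This suits gradients, of which nothing is known on
  element boundaries.\<close>

lemma set_integrable_bounded:
  fixes f :: "'a::euclidean_space \<Rightarrow> real"
  assumes "(\<lambda>x. indicator O' x * f x) \<in> borel_measurable lebesgue" "open O'" "O' \<subseteq> S" "bounded S"
    "negligible (S - O')" and b: "bounded (f ` O')"
  shows "set_integrable lebesgue S f"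
proof -
  obtain B where B: "\<And>x. x \<in> O' \<Longrightarrow> \<bar>f x\<bar> \<le> B" using b by (auto simp: bounded_iff)
  have bO: "bounded O'" using assms bounded_subset by blast
  have "integrable lebesgue (\<lambda>x. indicator O' x *\<^sub>R f x)"
  proof (rule integrableI_bounded_set[where A = O' and B = B])
    show "emeasure lebesgue O' < \<infinity>"
      using lmeasurable_open[OF bO \<open>open O'\<close>] unfolding fmeasurable_def by auto
  qed (use assms B in \<open>auto simp: indicator_def\<close>)
  hence "set_integrable lebesgue O' f" by (simp add: set_integrable_def)
  moreover have "negligible {x \<in> O' - S. f x \<noteq> 0}" using \<open>O' \<subseteq> S\<close> by (auto intro: empty_imp_negligible)
  moreover have "negligible {x \<in> S - O'. f x \<noteq> 0}" by (rule negligible_subset[OF assms(5)]) auto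
  ultimately show ?thesis by (rule absolutely_integrable_spike_set)
qed

text \<open>The nonnegative integrand vanishes almost everywhere, and a nonempty open set on which
  the continuous \<open>g\<close> differs from zero would not be null. All three definiteness
  arguments (H1 norm, inner product on \<open>Omega\<close>, edge integrals) rest on this.\<close>

lemma zero_integral_square_bound:
  fixes f g :: "'a::euclidean_space \<Rightarrow> real"
  assumes f: "set_integrable lebesgue S f" and nn: "\<And>x. x \<in> S \<Longrightarrow> 0 \<le> f x"
    and z: "(LINT x:S|lebesgue. f x) = 0"
    and T: "open T" "T \<subseteq> S" "continuous_on T g" and gf: "\<And>x. x \<in> T \<Longrightarrow> (g x)\<^sup>2 \<le> f x"
    and x: "x \<in> T"
  shows "g x = 0"
proof (rule ccontr)
  assume gx: "g x \<noteq> 0"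
  have "AE x in lebesgue. indicator S x *\<^sub>R f x = 0"
    using f z nn integral_nonneg_eq_0_iff_AE[of lebesgue "\<lambda>x. indicator S x *\<^sub>R f x"]
    by (auto simp: set_integrable_def set_lebesgue_integral_def indicator_def)
  then obtain N where N: "N \<in> null_sets lebesgue" "{x. indicator S x *\<^sub>R f x \<noteq> 0} \<subseteq> N"
    by (auto simp: eventually_ae_filter)
  have op: "open {y \<in> T. g y \<noteq> 0}"
  proof -
    have "openin (top_of_set T) (T \<inter> g -` (- {0}))"
      by (rule continuous_openin_preimage_gen[OF T(3)]) auto
    moreover have "T \<inter> g -` (- {0}) = {y \<in> T. g y \<noteq> 0}" by auto
    ultimately show ?thesis using T(1) openin_open_eq by metis
  qed
  have "{y \<in> T. g y \<noteq> 0} \<subseteq> N"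
  proof
    fix y assume "y \<in> {y \<in> T. g y \<noteq> 0}"
    hence y: "y \<in> T" "g y \<noteq> 0" by auto
    hence "0 < (g y)\<^sup>2" by simp
    hence "f y \<noteq> 0" using gf[OF y(1)] by linarith
    thus "y \<in> N" using N(2) y(1) T(2) by (auto simp: indicator_def)
  qed
  hence "negligible {y \<in> T. g y \<noteq> 0}"
    using N(1) negligible_iff_null_sets negligible_subset by metis
  thus False using open_not_negligible[OF op] x gx by auto
qed

text \<open>Borel rather than Lebesgue measurable, so that composition with the parametrization of
  an edge remains measurable. Boundedness makes the class closed under products and integrable over
  bounded open sets as well as over edges.\<close>

definition bounded_borel :: "('a::euclidean_space \<Rightarrow> real) set"
  where "bounded_borel = {f. f \<in> borel_measurable borel \<and> bounded (range f)}"

lemma bounded_real_iff: "bounded (f ` S) \<longleftrightarrow> (\<exists>B. \<forall>x\<in>S. \<bar>f x\<bar> \<le> B)" for f :: "'a \<Rightarrow> real"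
  by (auto simp: bounded_iff)

lemma bounded_image_mult:
  fixes f g :: "'a \<Rightarrow> real"
  assumes "bounded (f ` S)" "bounded (g ` S)"
  shows "bounded ((\<lambda>x. f x * g x) ` S)"
proof -
  obtain A B where "\<forall>x\<in>S. \<bar>f x\<bar> \<le> A" "\<forall>x\<in>S. \<bar>g x\<bar> \<le> B" using assms by (auto simp: bounded_real_iff)
  hence "\<bar>f x * g x\<bar> \<le> A * B" if "x \<in> S" for x
    using that by (auto simp: abs_mult intro!: mult_mono order_trans[OF abs_ge_zero])
  thus ?thesis unfolding bounded_real_iff by blast
qed

lemma bounded_image_add:
  fixes f g :: "'a \<Rightarrow> real"
  assumes "bounded (f ` S)" "bounded (g ` S)"
  shows "bounded ((\<lambda>x. f x + g x) ` S)"
  using bounded_plus_comp[OF assms] .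

lemma bounded_borel_add [intro]: "f \<in> bounded_borel \<Longrightarrow> g \<in> bounded_borel \<Longrightarrow> (\<lambda>x. f x + g x) \<in> bounded_borel"
  by (auto simp: bounded_borel_def intro: bounded_image_add)

lemma bounded_borel_mult [intro]: "f \<in> bounded_borel \<Longrightarrow> g \<in> bounded_borel \<Longrightarrow> (\<lambda>x. f x * g x) \<in> bounded_borel"
  by (auto simp: bounded_borel_def intro: bounded_image_mult)

lemma bounded_borel_const [intro]: "(\<lambda>x. c) \<in> bounded_borel"
  by (auto simp: bounded_borel_def)

lemma bounded_borel_indicator [intro]: "S \<in> sets borel \<Longrightarrow> indicator S \<in> bounded_borel"
  by (auto simp: bounded_borel_def bounded_real_iff indicator_def intro!: exI[of _ 1])

lemma subspace_bounded_borel: "subspace bounded_borel"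
  by (rule subspaceI)
    (auto simp: plus_fun_def zero_fun_def scaleR_fun_def intro: bounded_borel_add bounded_borel_mult)

lemma bounded_borel_continuous:
  assumes "compact K" "continuous_on K f"
  shows "(\<lambda>x. indicator K x * f x) \<in> bounded_borel"
proof -
  have "(\<lambda>x. indicator K x *\<^sub>R f x) \<in> borel_measurable borel"
    by (rule borel_measurable_continuous_on_indicator) (use assms borel_compact in auto)
  moreover have "bounded (f ` K)" using assms compact_continuous_image compact_imp_bounded by blast
  then obtain B where "\<forall>x\<in>K. \<bar>f x\<bar> \<le> B" by (auto simp: bounded_real_iff)
  hence "\<forall>x. \<bar>indicator K x * f x\<bar> \<le> max B 0" by (auto simp: indicator_def)
  ultimately show ?thesis by (auto simp: bounded_borel_def bounded_real_iff)
qed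

lemma bounded_borel_zero_ext:
  assumes "compact K" "continuous_on K f" "S \<subseteq> K" "S \<in> sets borel"
  shows "zero_ext S f \<in> bounded_borel"
proof -
  have "zero_ext S f = (\<lambda>x. indicator S x * (indicator K x * f x))"
    using assms(3) by (auto simp: zero_ext_def indicator_def fun_eq_iff)
  thus ?thesis using bounded_borel_continuous[OF assms(1,2)] bounded_borel_indicator[OF assms(4)] by auto
qed

lemma set_integrable_bounded_borel:
  fixes f :: "'a::euclidean_space \<Rightarrow> real"
  assumes "f \<in> bounded_borel" "open S" "bounded S"
  shows "set_integrable lebesgue S f"
proof (rule set_integrable_bounded[where O' = S])
  have "f \<in> borel_measurable lebesgue" using assms by (auto simp: bounded_borel_def intro!: measurable_completion)
  moreover have "S \<in> sets lebesgue" using assms by auto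
  ultimately show "(\<lambda>x. indicator S x * f x) \<in> borel_measurable lebesgue" by measurable
  show "bounded (f ` S)" using assms(1) bounded_subset[of "range f" "f ` S"] by (auto simp: bounded_borel_def)
qed (use assms in auto)

section \<open>Edge integrals\<close>

text \<open>The end points in \<open>edge_integral\<close> come from a choice operator. Whichever
  pair is chosen, it parametrizes the edge and is nondegenerate, and nothing more about it is needed
  later.\<close>

lemma edge_integral_param:
  assumes "1 simplex e"
  obtains a b where "a \<noteq> b" "e = closed_segment a b"
    "\<forall>f. edge_integral e f = dist a b * (LINT t:{0..1}|lebesgue. f (linepath a b t))"
proof -
  obtain a b where ab: "a \<noteq> b" "e = closed_segment a b" using one_simplex_cases[OF assms] .
  define q where "q = (SOME (a, b). e = closed_segment a b)"
  have "case q of (a, b) \<Rightarrow> e = closed_segment a b"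
    unfolding q_def by (rule someI[of _ "(a, b)"]) (use ab in auto)
  hence q: "e = closed_segment (fst q) (snd q)" by auto
  have "fst q \<noteq> snd q" using q ab by (metis closed_segment_idem ends_in_segment(1,2) singletonD)
  moreover have "edge_integral e f = dist (fst q) (snd q) * (LINT t:{0..1}|lebesgue. f (linepath (fst q) (snd q) t))" for f
    unfolding edge_integral_def q_def[symmetric] by (simp add: case_prod_beta)
  ultimately show thesis using q that by blast
qed

lemma edge_integral_cong:
  assumes "1 simplex e" "\<And>x. x \<in> e \<Longrightarrow> f x = g x"
  shows "edge_integral e f = edge_integral e g"
proof -
  obtain a b where ab: "a \<noteq> b" "e = closed_segment a b"
    "\<forall>f. edge_integral e f = dist a b * (LINT t:{0..1}|lebesgue. f (linepath a b t))"
    using edge_integral_param[OF assms(1)] by blast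
  have "indicator {0..1} t *\<^sub>R f (linepath a b t) = indicator {0..1} t *\<^sub>R g (linepath a b t)" for t
    using assms(2)[of "linepath a b t"] ab(2) linepath_in_path[of t a b] by (auto simp: indicator_def)
  hence "(\<lambda>t. indicator {0..1} t *\<^sub>R f (linepath a b t)) = (\<lambda>t. indicator {0..1} t *\<^sub>R g (linepath a b t))"
    by (rule ext)
  thus ?thesis unfolding ab(3)[rule_format] set_lebesgue_integral_def by (simp only:)
qed

lemma bounded_borel_linepath:
  assumes "f \<in> bounded_borel"
  shows "set_integrable lebesgue {0..1} (\<lambda>t. f (linepath a b t))"
proof -
  have "linepath a b \<in> borel_measurable borel"
    by (intro borel_measurable_continuous_onI) (auto simp: linepath_def intro!: continuous_intros)
  moreover have "range (\<lambda>t. f (linepath a b t)) \<subseteq> range f" by auto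
  ultimately have "(\<lambda>t. f (linepath a b t)) \<in> bounded_borel"
    using assms bounded_subset unfolding bounded_borel_def by auto
  hence int: "set_integrable lebesgue {0<..<1} (\<lambda>t. f (linepath a b t))"
    by (rule set_integrable_bounded_borel) auto
  show ?thesis
  proof (intro absolutely_integrable_spike_set[OF int])
    show "negligible {t \<in> {0..1} - {0<..<1}. f (linepath a b t) \<noteq> 0}"
      by (rule negligible_subset[of "{0, 1}"]) auto
  qed (auto intro: empty_imp_negligible)
qed

lemma edge_integral_linear:
  assumes e: "1 simplex e" and f: "f \<in> bounded_borel" and g: "g \<in> bounded_borel"
  shows "edge_integral e (\<lambda>x. f x + g x) = edge_integral e f + edge_integral e g"
    and "edge_integral e (\<lambda>x. c * f x) = c * edge_integral e f"
proof -
  obtain a b where ab: "a \<noteq> b" "e = closed_segment a b"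
    "\<forall>f. edge_integral e f = dist a b * (LINT t:{0..1}|lebesgue. f (linepath a b t))"
    using edge_integral_param[OF e] by blast
  show "edge_integral e (\<lambda>x. f x + g x) = edge_integral e f + edge_integral e g"
    unfolding ab(3)[rule_format] set_integral_add(2)[OF bounded_borel_linepath[OF f] bounded_borel_linepath[OF g]]
    by (simp add: distrib_left)
  show "edge_integral e (\<lambda>x. c * f x) = c * edge_integral e f"
    unfolding ab(3)[rule_format] by simp
qed

text \<open>Definiteness asks for continuity on the open edge only, because elements of
  \<open>MF\<close> are extended by zero from there and may jump at the end points.\<close>

lemma edge_integral_square:
  assumes e: "1 simplex e" and f: "f \<in> bounded_borel"
  shows "0 \<le> edge_integral e (\<lambda>x. f x * f x)"
    and "edge_integral e (\<lambda>x. f x * f x) = 0 \<Longrightarrow> continuous_on (rel_interior e) f \<Longrightarrow>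
      x \<in> rel_interior e \<Longrightarrow> f x = 0"
proof -
  obtain a b where ab: "a \<noteq> b" "e = closed_segment a b"
    "\<forall>f. edge_integral e f = dist a b * (LINT t:{0..1}|lebesgue. f (linepath a b t))"
    using edge_integral_param[OF e] by blast
  have "0 \<le> (LINT t:{0..1}|lebesgue. f (linepath a b t) * f (linepath a b t))"
    unfolding set_lebesgue_integral_def by (rule Bochner_Integration.integral_nonneg) auto
  thus "0 \<le> edge_integral e (\<lambda>x. f x * f x)" unfolding ab(3)[rule_format] by simp
  assume z: "edge_integral e (\<lambda>x. f x * f x) = 0" and c: "continuous_on (rel_interior e) f"
    and x: "x \<in> rel_interior e"
  have e': "rel_interior e = open_segment a b" unfolding ab(2) using ab(1) by (simp add: rel_interior_closed_segment)
  have lin: "linepath a b t \<in> rel_interior e" if "t \<in> {0<..<1}" for t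
    using that ab(1) unfolding e' by (auto simp: in_segment linepath_def)
  obtain t where t: "t \<in> {0<..<1}" "x = linepath a b t"
    using x unfolding e' by (auto simp: in_segment linepath_def)
  have "f (linepath a b t) = 0"
  proof (rule zero_integral_square_bound[where S = "{0..1}" and T = "{0<..<1}"
        and f = "\<lambda>t. f (linepath a b t) * f (linepath a b t)" and g = "\<lambda>t. f (linepath a b t)"])
    show "set_integrable lebesgue {0..1} (\<lambda>t. f (linepath a b t) * f (linepath a b t))"
      using bounded_borel_linepath[OF bounded_borel_mult[OF f f]] .
    show "(LINT t:{0..1}|lebesgue. f (linepath a b t) * f (linepath a b t)) = 0"
      using z ab by simp
    show "continuous_on {0<..<1} (\<lambda>t. f (linepath a b t))"
      by (rule continuous_on_compose2[OF c]) (use lin in \<open>auto simp: linepath_def intro!: continuous_intros\<close>)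
  qed (use t in \<open>auto simp: power2_eq_square\<close>)
  thus "f x = 0" using t by simp
qed

section \<open>Gradients of piecewise polynomials\<close>

definition smooth :: "(plane \<Rightarrow> real) \<Rightarrow> bool"
  where "smooth f \<longleftrightarrow> (\<exists>D. continuous_on UNIV D \<and> (\<forall>x. GDERIV f x :> D x))"

lemma GDERIV_continuous: "\<forall>x. GDERIV f x :> D x \<Longrightarrow> continuous_on UNIV f"
  unfolding gderiv_def by (meson continuous_at_imp_continuous_on has_derivative_continuous)

lemma smooth_const: "smooth (\<lambda>x. c)"
  unfolding smooth_def using GDERIV_const by (auto intro!: exI[of _ "\<lambda>x. 0"])

lemma smooth_add: "smooth f \<Longrightarrow> smooth g \<Longrightarrow> smooth (\<lambda>x. f x + g x)"
  unfolding smooth_def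
  by (elim exE conjE, rule_tac x = "\<lambda>x. D x + Da x" in exI) (auto intro: GDERIV_add continuous_on_add)

lemma smooth_mult: 
  assumes "smooth f" "smooth g"
  shows "smooth (\<lambda>x. f x * g x)"
proof -
  obtain D E where D: "continuous_on UNIV D" "\<forall>x. GDERIV f x :> D x"
    and E: "continuous_on UNIV E" "\<forall>x. GDERIV g x :> E x" using assms by (auto simp: smooth_def)
  have "continuous_on UNIV (\<lambda>x. f x *\<^sub>R E x + g x *\<^sub>R D x)"
    by (intro continuous_intros D(1) E(1) GDERIV_continuous[OF D(2)] GDERIV_continuous[OF E(2)])
  moreover have "\<forall>x. GDERIV (\<lambda>x. f x * g x) x :> f x *\<^sub>R E x + g x *\<^sub>R D x"
    using GDERIV_mult D(2) E(2) by blast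
  ultimately show ?thesis unfolding smooth_def by (intro exI[of _ "\<lambda>x. f x *\<^sub>R E x + g x *\<^sub>R D x"]) auto
qed

lemma smooth_coordinate: "smooth (\<lambda>x. x $ i)"
proof -
  have "GDERIV (\<lambda>x. x $ i) x :> axis i 1" for x :: plane
    unfolding gderiv_def
    by (rule has_derivative_eq_rhs[OF bounded_linear.has_derivative[OF bounded_linear_vec_nth has_derivative_ident]])
      (auto simp: inner_axis)
  thus ?thesis unfolding smooth_def by (intro exI[of _ "\<lambda>x. axis i 1"]) auto
qed

lemma smooth_power: "smooth f \<Longrightarrow> smooth (\<lambda>x. f x ^ n)"
  by (induction n) (auto intro: smooth_const smooth_mult)

lemma smooth_sum: "(\<And>i. i \<in> I \<Longrightarrow> smooth (f i)) \<Longrightarrow> smooth (\<lambda>x. \<Sum>i\<in>I. f i x)"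
  by (induction I rule: infinite_finite_induct) (auto intro: smooth_const smooth_add)

lemma polynomial_on_smooth:
  assumes "polynomial_on d K v"
  obtains p where "smooth p" "\<And>x. x \<in> K \<Longrightarrow> v x = p x"
proof -
  obtain c where c: "\<forall>x\<in>K. v x = (\<Sum>a\<le>d. \<Sum>b\<le>d - a. c a b * (x $ 1) ^ a * (x $ 2) ^ b)"
    using assms by (auto simp: polynomial_on_def)
  have "smooth (\<lambda>x. \<Sum>a\<le>d. \<Sum>b\<le>d - a. c a b * (x $ 1) ^ a * (x $ 2) ^ b)"
    by (intro smooth_sum smooth_mult smooth_const smooth_power smooth_coordinate)
  thus thesis using that c by blast
qed

lemma GDERIV_unique: "GDERIV f x :> D \<Longrightarrow> GDERIV f x :> D' \<Longrightarrow> D = D'"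
  unfolding gderiv_def by (metis has_derivative_unique inner_commute vector_eq_ldot)

lemma grad_eq: "GDERIV f x :> D \<Longrightarrow> grad f x = D"
  unfolding grad_def using GDERIV_unique by blast

lemma GDERIV_local:
  assumes "open S" "x \<in> S" "\<And>y. y \<in> S \<Longrightarrow> f y = g y" "GDERIV f x :> D"
  shows "GDERIV g x :> D"
  using assms unfolding gderiv_def by (metis has_derivative_transform_within_open)

text \<open>\<open>grad\<close> is a definite description, and functions that agree near
  \<open>x\<close> satisfy it with the same vectors. Hence the equality holds even where no gradient
  exists.\<close>

lemma grad_local:
  assumes "open S" "x \<in> S" "\<And>y. y \<in> S \<Longrightarrow> f y = g y"
  shows "grad f x = grad g x"
proof -
  have "GDERIV f x :> D \<longleftrightarrow> GDERIV g x :> D" for D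
    using GDERIV_local[OF assms(1,2)] assms(3) by metis
  thus ?thesis by (simp add: grad_def)
qed

section \<open>Finite element spaces and energy forms\<close>

lemma set_sum_memberI:
  assumes "finite I" "\<And>i. i \<in> I \<Longrightarrow> f i \<in> V i"
  shows "(\<Sum>i\<in>I. f i) \<in> (\<Sum>i\<in>I. V i)"
  using assms by (auto simp: set_sum_alt)

lemma set_sum_memberE:
  assumes "finite I" "x \<in> (\<Sum>i\<in>I. V i)"
  obtains f where "\<And>i. i \<in> I \<Longrightarrow> f i \<in> V i" "x = (\<Sum>i\<in>I. f i)"
  using assms by (auto simp: set_sum_alt)

lemma subspace_set_plus:
  assumes "subspace V" "subspace W"
  shows "subspace (V + W)"
proof -
  have "V + W = {x + y | x y. x \<in> V \<and> y \<in> W}" by (auto simp: set_plus_def)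
  thus ?thesis using subspace_sums[OF assms] by simp
qed

lemma subspace_set_sum:
  fixes V :: "'i \<Rightarrow> 'v::real_vector set"
  assumes "\<And>i. i \<in> I \<Longrightarrow> subspace (V i)"
  shows "subspace (\<Sum>i\<in>I. V i)"
  using assms
proof (induction I rule: infinite_finite_induct)
  case (insert x F)
  thus ?case by (simp add: subspace_set_plus)
qed (auto simp: set_zero)

lemma set_sum_subset_subspace:
  fixes V :: "'i \<Rightarrow> 'v::real_vector set"
  assumes "subspace S" "\<And>i. i \<in> I \<Longrightarrow> V i \<subseteq> S"
  shows "(\<Sum>i\<in>I. V i) \<subseteq> S"
  using assms(2)
proof (induction I rule: infinite_finite_induct)
  case (insert x F)
  hence "V x \<subseteq> S" "sum V F \<subseteq> S" by auto
  thus ?case using insert(1,2) assms(1) by (auto elim!: set_plus_elim simp: subspace_add subset_iff)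
qed (use assms(1) in \<open>auto simp: set_zero subspace_0\<close>)

lemma polynomial_on_add:
  assumes "polynomial_on d K f" "polynomial_on d K g"
  shows "polynomial_on d K (\<lambda>x. f x + g x)"
proof -
  obtain c c' where "\<forall>x\<in>K. f x = (\<Sum>a\<le>d. \<Sum>b\<le>d - a. c a b * (x $ 1) ^ a * (x $ 2) ^ b)"
    "\<forall>x\<in>K. g x = (\<Sum>a\<le>d. \<Sum>b\<le>d - a. c' a b * (x $ 1) ^ a * (x $ 2) ^ b)"
    using assms by (auto simp: polynomial_on_def)
  thus ?thesis unfolding polynomial_on_def
    by (intro exI[of _ "\<lambda>a b. c a b + c' a b"]) (simp add: sum.distrib distrib_right)
qed

lemma polynomial_on_scale:
  assumes "polynomial_on d K f"
  shows "polynomial_on d K (\<lambda>x. r * f x)"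
proof -
  obtain c where "\<forall>x\<in>K. f x = (\<Sum>a\<le>d. \<Sum>b\<le>d - a. c a b * (x $ 1) ^ a * (x $ 2) ^ b)"
    using assms by (auto simp: polynomial_on_def)
  thus ?thesis unfolding polynomial_on_def
    by (intro exI[of _ "\<lambda>a b. r * c a b"]) (simp add: sum_distrib_left mult.assoc)
qed

lemma polynomial_on_const: "polynomial_on d K (\<lambda>x. r)"
proof -
  have *: "(\<Sum>a\<le>d. \<Sum>b\<le>d - a. (if a = 0 \<and> b = 0 then r else 0) * (x $ 1) ^ a * (x $ 2) ^ b) = r" for x :: plane
  proof -
    have "(\<Sum>b\<le>d - a. (if a = 0 \<and> b = 0 then r else 0) * (x $ 1) ^ a * (x $ 2) ^ b) = (if a = 0 then r else 0)" for a
      by (cases "a = 0") (auto simp: if_distrib[of "\<lambda>z. z * _"] sum.delta cong: if_cong)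
    thus ?thesis by simp
  qed
  thus ?thesis unfolding polynomial_on_def
    by (intro exI[of _ "\<lambda>a b. if a = 0 \<and> b = 0 then r else 0"] ballI) (rule *[symmetric])
qed

lemma zero_ext_linear:
  "zero_ext S (\<lambda>x. f x + g x) = zero_ext S f + zero_ext S g"
  "zero_ext S (\<lambda>x. r * f x) = r *\<^sub>R zero_ext S f"
  by (auto simp: zero_ext_def fun_eq_iff)

context mortar_discretization
begin

text \<open>Elements of \<open>X i\<close> are differentiable here, that is, off a null set of the subdomain.\<close>
definition mesh_interior :: "nat \<Rightarrow> plane set"
  where "mesh_interior i = (\<Union>K\<in>mesh P i. interior K \<inter> Sub P i)"

lemma mesh_facts:
  assumes "i \<in> {1..N}"
  shows "finite (mesh P i)" "\<And>K. K \<in> mesh P i \<Longrightarrow> compact K \<and> convex K" "\<Union>(mesh P i) = closure (Sub P i)"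
proof -
  have m: "mesh_of (Sub P i) (Edges P i) (mesh P i)" using meshes assms by blast
  thus "finite (mesh P i)" "\<Union>(mesh P i) = closure (Sub P i)" by (auto simp: mesh_of_def triangulation_def)
  fix K assume "K \<in> mesh P i"
  hence "2 simplex K" using m by (auto simp: mesh_of_def)
  thus "compact K \<and> convex K" by (auto dest: compact_simplex convex_simplex)
qed

lemma open_mesh_interior: "i \<in> {1..N} \<Longrightarrow> open (mesh_interior i)"
  unfolding mesh_interior_def using open_Sub by auto

lemma mesh_interior_subset: "mesh_interior i \<subseteq> Sub P i"
  by (auto simp: mesh_interior_def)

text \<open>The elements cover the subdomain, so an excluded point lies on the frontier of one of
  finitely many convex sets.\<close>

lemma negligible_mesh_interior:
  assumes i: "i \<in> {1..N}"
  shows "negligible (Sub P i - mesh_interior i)"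
proof (rule negligible_subset)
  show "negligible (\<Union>K\<in>mesh P i. frontier K)"
    using mesh_facts[OF i] negligible_convex_frontier by (intro negligible_Union) auto
  show "Sub P i - mesh_interior i \<subseteq> (\<Union>K\<in>mesh P i. frontier K)"
  proof
    fix x assume x: "x \<in> Sub P i - mesh_interior i"
    then obtain K where K: "K \<in> mesh P i" "x \<in> K"
      using mesh_facts(3)[OF i] closure_subset[of "Sub P i"] by auto
    hence "x \<notin> interior K" using x by (auto simp: mesh_interior_def)
    moreover have "x \<in> closure K" using K closure_subset by blast
    ultimately show "x \<in> (\<Union>K\<in>mesh P i. frontier K)" using K by (auto simp: frontier_def)
  qed
qed

lemma X_cases:
  assumes "v \<in> X i"
  obtains f where "v = zero_ext (Sub P i) f" "f \<in> fe_functions i"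
    "continuous_on (closure (Sub P i)) f" "\<And>K. K \<in> mesh P i \<Longrightarrow> polynomial_on (fe_deg P) K f"
  using assms by (auto simp: X_def fe_functions_def)

lemma fe_functions_linear:
  "f \<in> fe_functions i \<Longrightarrow> g \<in> fe_functions i \<Longrightarrow> (\<lambda>x. f x + g x) \<in> fe_functions i"
  "f \<in> fe_functions i \<Longrightarrow> (\<lambda>x. r * f x) \<in> fe_functions i"
  by (auto simp: fe_functions_def intro: polynomial_on_add polynomial_on_scale continuous_intros)

lemma subspace_X: "subspace (X i)"
proof (rule subspaceI)
  show "0 \<in> X i"
    unfolding X_def fe_functions_def
    by (rule image_eqI[of _ _ "\<lambda>x. 0"]) (auto simp: zero_ext_def polynomial_on_const fun_eq_iff)
next
  fix u v assume "u \<in> X i" "v \<in> X i"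
  then obtain f g where "u = zero_ext (Sub P i) f" "f \<in> fe_functions i"
    "v = zero_ext (Sub P i) g" "g \<in> fe_functions i" by (auto simp: X_def)
  thus "u + v \<in> X i" unfolding X_def
    by (intro image_eqI[of _ _ "\<lambda>x. f x + g x"]) (simp_all add: zero_ext_linear fe_functions_linear)
next
  fix r u assume "u \<in> X i"
  then obtain f where "u = zero_ext (Sub P i) f" "f \<in> fe_functions i" by (auto simp: X_def)
  thus "r *\<^sub>R u \<in> X i" unfolding X_def
    by (intro image_eqI[of _ _ "\<lambda>x. r * f x"]) (simp_all add: zero_ext_linear fe_functions_linear)
qed

lemma X_outside: "v \<in> X i \<Longrightarrow> x \<notin> Sub P i \<Longrightarrow> v x = 0"
  by (auto simp: X_def zero_ext_def)

lemma X_continuous: "v \<in> X i \<Longrightarrow> continuous_on (Sub P i) v"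
proof -
  assume "v \<in> X i"
  then obtain f where f: "v = zero_ext (Sub P i) f" "continuous_on (closure (Sub P i)) f"
    by (metis X_cases)
  have "continuous_on (Sub P i) f" using f(2) closure_subset continuous_on_subset by blast
  thus ?thesis by (rule continuous_on_eq) (auto simp: f zero_ext_def)
qed

lemma compact_closure_Sub: "i \<in> {1..N} \<Longrightarrow> compact (closure (Sub P i))"
  using bounded_Sub by (simp add: compact_closure)

lemma X_bounded_borel: "i \<in> {1..N} \<Longrightarrow> v \<in> X i \<Longrightarrow> v \<in> bounded_borel"
  by (metis X_cases bounded_borel_zero_ext compact_closure_Sub closure_subset open_Sub borel_open)

text \<open>A function in \<open>X i\<close> is determined by its polynomial coefficients on
  finitely many elements. The choice \<open>\<kappa>\<close> assigns each point to a single element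
  containing it, so points shared by several elements are not counted twice. The truncated monomials
  need not belong to \<open>X i\<close>; containment in their span suffices.\<close>

lemma X_finite_dim:
  assumes i: "i \<in> {1..N}"
  obtains B where "finite B" "X i \<subseteq> span B"
proof -
  define \<kappa> where "\<kappa> x = (SOME K. K \<in> mesh P i \<and> x \<in> K)" for x
  have \<kappa>: "\<kappa> x \<in> mesh P i \<and> x \<in> \<kappa> x" if "x \<in> Sub P i" for x
    unfolding \<kappa>_def by (rule someI_ex) (use that mesh_facts(3)[OF i] closure_subset[of "Sub P i"] in auto)
  define g :: "plane set \<Rightarrow> nat \<Rightarrow> nat \<Rightarrow> plane \<Rightarrow> real" where
    "g K a b = (\<lambda>x. if x \<in> Sub P i \<and> \<kappa> x = K then (x $ 1) ^ a * (x $ 2) ^ b else 0)" for K a b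
  define B where "B = (\<lambda>(K, a, b). g K a b) ` (mesh P i \<times> {..fe_deg P} \<times> {..fe_deg P})"
  have "v \<in> span B" if v: "v \<in> X i" for v
  proof -
    obtain f where f: "v = zero_ext (Sub P i) f" "\<And>K. K \<in> mesh P i \<Longrightarrow> polynomial_on (fe_deg P) K f"
      by (metis X_cases v)
    have "\<forall>K. \<exists>c. K \<in> mesh P i \<longrightarrow>
      (\<forall>x\<in>K. f x = (\<Sum>a\<le>fe_deg P. \<Sum>b\<le>fe_deg P - a. c a b * (x $ 1) ^ a * (x $ 2) ^ b))"
      using f(2) unfolding polynomial_on_def by blast
    from choice[OF this] obtain c where c: "\<forall>K. K \<in> mesh P i \<longrightarrow>
      (\<forall>x\<in>K. f x = (\<Sum>a\<le>fe_deg P. \<Sum>b\<le>fe_deg P - a. c K a b * (x $ 1) ^ a * (x $ 2) ^ b))" ..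
    have "v = (\<Sum>K\<in>mesh P i. \<Sum>a\<le>fe_deg P. \<Sum>b\<le>fe_deg P - a. c K a b *\<^sub>R g K a b)"
    proof
      fix x
      show "v x = (\<Sum>K\<in>mesh P i. \<Sum>a\<le>fe_deg P. \<Sum>b\<le>fe_deg P - a. c K a b *\<^sub>R g K a b) x"
      proof (cases "x \<in> Sub P i")
        case True
        have "(\<Sum>K\<in>mesh P i. \<Sum>a\<le>fe_deg P. \<Sum>b\<le>fe_deg P - a. c K a b * g K a b x)
          = (\<Sum>K\<in>mesh P i. if K = \<kappa> x then f x else 0)"
          by (intro sum.cong refl) (use True \<kappa>[OF True] c in \<open>auto simp: g_def mult.assoc\<close>)
        also have "\<dots> = f x" using mesh_facts(1)[OF i] \<kappa>[OF True] by simp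
        finally show ?thesis using True by (simp add: sum_fun_apply f(1) zero_ext_def)
      qed (simp add: sum_fun_apply f(1) zero_ext_def g_def)
    qed
    also have "\<dots> \<in> span B"
    proof (intro span_sum span_scale span_base)
      fix K a b assume "K \<in> mesh P i" "a \<in> {..fe_deg P}" "b \<in> {..fe_deg P - a}"
      hence "(K, a, b) \<in> mesh P i \<times> {..fe_deg P} \<times> {..fe_deg P}" by auto
      thus "g K a b \<in> B" unfolding B_def by (rule rev_image_eqI) simp
    qed
    finally show ?thesis .
  qed
  moreover have "finite B" unfolding B_def using mesh_facts(1)[OF i] by auto
  ultimately show thesis using that by blast
qed

text \<open>Inside an element the function agrees with a polynomial that is smooth on the whole
  plane, and the gradient of the latter is bounded on the compact element.\<close>

lemma X_grad:
  assumes i: "i \<in> {1..N}" and v: "v \<in> X i"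
  shows "x \<in> mesh_interior i \<Longrightarrow> GDERIV v x :> grad v x"
    and "continuous_on (mesh_interior i) (grad v)" and "bounded (grad v ` mesh_interior i)"
proof -
  obtain f where f: "v = zero_ext (Sub P i) f" "\<And>K. K \<in> mesh P i \<Longrightarrow> polynomial_on (fe_deg P) K f"
    by (metis X_cases v)
  have "\<forall>K. \<exists>D. K \<in> mesh P i \<longrightarrow> continuous_on UNIV D \<and> (\<forall>x\<in>interior K \<inter> Sub P i. GDERIV v x :> D x)"
  proof (intro allI)
    fix K
    show "\<exists>D. K \<in> mesh P i \<longrightarrow> continuous_on UNIV D \<and> (\<forall>x\<in>interior K \<inter> Sub P i. GDERIV v x :> D x)"
    proof (cases "K \<in> mesh P i")
      case True
      obtain p where p: "smooth p" "\<And>x. x \<in> K \<Longrightarrow> f x = p x"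
        using polynomial_on_smooth[OF f(2)[OF True]] by blast
      obtain D where D: "continuous_on UNIV D" "\<forall>x. GDERIV p x :> D x" using p(1) by (auto simp: smooth_def)
      have "GDERIV v x :> D x" if "x \<in> interior K \<inter> Sub P i" for x
        by (rule GDERIV_local[where S = "interior K \<inter> Sub P i" and f = p])
          (use that D open_Sub[OF i] p(2) interior_subset[of K] in \<open>auto simp: f(1) zero_ext_def\<close>)
      thus ?thesis using D(1) by blast
    qed auto
  qed
  then obtain D where D: "\<And>K. K \<in> mesh P i \<Longrightarrow> continuous_on UNIV (D K)"
    "\<And>K x. K \<in> mesh P i \<Longrightarrow> x \<in> interior K \<inter> Sub P i \<Longrightarrow> GDERIV v x :> D K x" by metis
  have gr: "grad v x = D K x" if "K \<in> mesh P i" "x \<in> interior K \<inter> Sub P i" for K x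
    using grad_eq[OF D(2)[OF that]] .
  show "GDERIV v x :> grad v x" if x: "x \<in> mesh_interior i"
    using x D(2) gr by (auto simp: mesh_interior_def)
  show "continuous_on (mesh_interior i) (grad v)"
    unfolding mesh_interior_def
  proof (rule continuous_on_open_UN)
    fix K assume K: "K \<in> mesh P i"
    show "continuous_on (interior K \<inter> Sub P i) (grad v)"
      by (rule continuous_on_eq[of _ "D K"])
        (use continuous_on_subset[OF D(1)[OF K]] gr[OF K] in auto)
  qed (use open_Sub[OF i] in auto)
  have "bounded (\<Union>K\<in>mesh P i. D K ` K)"
  proof (intro bounded_Union ballI)
    show "finite ((\<lambda>K. D K ` K) ` mesh P i)" using mesh_facts(1)[OF i] by simp
    fix S assume "S \<in> (\<lambda>K. D K ` K) ` mesh P i"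
    then obtain K where K: "K \<in> mesh P i" "S = D K ` K" by auto
    have "continuous_on K (D K)" using D(1)[OF K(1)] continuous_on_subset by blast
    thus "bounded S"
      using K mesh_facts(2)[OF i K(1)] compact_continuous_image compact_imp_bounded by blast
  qed
  moreover have "grad v ` mesh_interior i \<subseteq> (\<Union>K\<in>mesh P i. D K ` K)"
    using gr interior_subset unfolding mesh_interior_def by fastforce
  ultimately show "bounded (grad v ` mesh_interior i)" by (rule bounded_subset)
qed

text \<open>General bounded coefficients cover at once the energy form and, with both coefficients
  equal to 1, the H1 norm.\<close>

lemma set_integrable_energy:
  assumes i: "i \<in> {1..N}" and u: "u \<in> X i" and v: "v \<in> X i"
    and r: "r \<in> borel_measurable (lebesgue_on (Omega P))" "bounded (r ` Omega P)"
    and e: "e \<in> borel_measurable (lebesgue_on (Omega P))" "bounded (e ` Omega P)"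
  shows "set_integrable lebesgue (Sub P i) (\<lambda>x. r x * (grad u x \<bullet> grad v x) + e x * u x * v x)"
proof (rule set_integrable_bounded[where O' = "mesh_interior i"])
  let ?O = "mesh_interior i"
  have sub: "?O \<subseteq> Omega P" using mesh_interior_subset Sub_subset_Omega[OF i] by blast
  have op: "open ?O" by (rule open_mesh_interior[OF i])
  have opO: "open (Omega P)" using Omega by (auto simp: polygonal_domain_def)
  have 1: "(\<lambda>x. indicator (Omega P) x * h x) \<in> borel_measurable lebesgue"
    if "h \<in> borel_measurable (lebesgue_on (Omega P))" for h :: "plane \<Rightarrow> real"
    using that borel_measurable_restrict_space_iff[of "Omega P" lebesgue h] opO by simp
  have 2: "(\<lambda>x. indicator ?O x *\<^sub>R grad w x) \<in> borel_measurable lebesgue" if "w \<in> X i" for w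
    by (rule measurable_completion)
      (use borel_measurable_continuous_on_indicator[OF _ X_grad(2)[OF i that]] op in auto)
  have 3: "w \<in> borel_measurable lebesgue" if "w \<in> X i" for w
    using X_bounded_borel[OF i that] by (auto simp: bounded_borel_def intro!: measurable_completion)
  \<comment> \<open>Cut off to \<open>Omega P\<close> or to the mesh interior, every factor is
    measurable on the whole plane, while the product is unchanged on the mesh interior.\<close>
  define r' e' where "r' x = indicator (Omega P) x * r x" and "e' x = indicator (Omega P) x * e x" for x
  define gu gv where "gu x = indicator ?O x *\<^sub>R grad u x" and "gv x = indicator ?O x *\<^sub>R grad v x" for x
  have ms: "r' \<in> borel_measurable lebesgue" "e' \<in> borel_measurable lebesgue"
    "gu \<in> borel_measurable lebesgue" "gv \<in> borel_measurable lebesgue" "?O \<in> sets lebesgue"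
    using 1[OF r(1)] 1[OF e(1)] 2[OF u] 2[OF v] op
    by (simp_all add: r'_def[abs_def] e'_def[abs_def] gu_def[abs_def] gv_def[abs_def])
  have "(\<lambda>x. r' x * (gu x \<bullet> gv x) + indicator ?O x * (e' x * u x * v x)) \<in> borel_measurable lebesgue"
    by (rule borel_measurable_add[OF borel_measurable_times[OF ms(1) borel_measurable_inner[OF ms(3,4)]]
          borel_measurable_times[OF borel_measurable_indicator[OF ms(5)]
            borel_measurable_times[OF borel_measurable_times[OF ms(2) 3[OF u]] 3[OF v]]]])
  also have "(\<lambda>x. r' x * (gu x \<bullet> gv x) + indicator ?O x * (e' x * u x * v x)) =
    (\<lambda>x. indicator ?O x * (r x * (grad u x \<bullet> grad v x) + e x * u x * v x))"
    using sub by (auto simp: indicator_def fun_eq_iff r'_def e'_def gu_def gv_def)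
  finally show "(\<lambda>x. indicator ?O x * (r x * (grad u x \<bullet> grad v x) + e x * u x * v x)) \<in> borel_measurable lebesgue" .
  have bX: "bounded (w ` ?O)" if "w \<in> X i" for w
    using X_bounded_borel[OF i that] bounded_subset[of "range w" "w ` ?O"] by (auto simp: bounded_borel_def)
  have bO: "bounded (h ` ?O)" if "bounded (h ` Omega P)" for h :: "plane \<Rightarrow> real"
    using that sub by (meson bounded_subset image_mono)
  have "bounded ((\<lambda>x. grad u x \<bullet> grad v x) ` ?O)"
  proof -
    obtain A B where "\<forall>x\<in>?O. norm (grad u x) \<le> A" "\<forall>x\<in>?O. norm (grad v x) \<le> B"
      using X_grad(3)[OF i u] X_grad(3)[OF i v] by (auto simp: bounded_iff)
    hence "\<bar>grad u x \<bullet> grad v x\<bar> \<le> A * B" if "x \<in> ?O" for x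
      using that by (intro order_trans[OF Cauchy_Schwarz_ineq2] mult_mono) (auto intro: order_trans[OF norm_ge_zero])
    thus ?thesis unfolding bounded_real_iff by blast
  qed
  from bounded_image_add[OF bounded_image_mult[OF bO[OF r(2)] this]
    bounded_image_mult[OF bounded_image_mult[OF bO[OF e(2)] bX[OF u]] bX[OF v]]]
  show "bounded ((\<lambda>x. r x * (grad u x \<bullet> grad v x) + e x * u x * v x) ` ?O)" .
qed (use open_mesh_interior[OF i] mesh_interior_subset bounded_Sub[OF i] negligible_mesh_interior[OF i] in auto)

lemma a_form_integrable:
  "i \<in> {1..N} \<Longrightarrow> u \<in> X i \<Longrightarrow> v \<in> X i \<Longrightarrow>
    set_integrable lebesgue (Sub P i) (\<lambda>x. rho P x * (grad u x \<bullet> grad v x) + eps P x * u x * v x)"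
  using set_integrable_energy rho_measurable rho_bounded eps_measurable eps_bounded by blast

lemma a_form_sym: "a_form i u v = a_form i v u"
  by (simp add: a_form_def inner_commute mult.commute mult.left_commute)

lemma a_form_add:
  assumes i: "i \<in> {1..N}" and u: "u \<in> X i" "u' \<in> X i" "v \<in> X i"
  shows "a_form i (u + u') v = a_form i u v + a_form i u' v"
proof -
  note int = set_integral_add[OF a_form_integrable[OF i u(1,3)] a_form_integrable[OF i u(2,3)]]
  show ?thesis unfolding a_form_def int(2)[symmetric]
  proof (rule set_integral_spike(2)[OF int(1) negligible_mesh_interior[OF i]])
    fix x assume "x \<in> Sub P i - (Sub P i - mesh_interior i)"
    hence x: "x \<in> mesh_interior i" by auto
    have "grad (u + u') x = grad u x + grad u' x"
      unfolding plus_fun_def using X_grad(1)[OF i _ x] u by (intro grad_eq GDERIV_add) auto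
    thus "rho P x * (grad (u + u') x \<bullet> grad v x) + eps P x * (u + u') x * v x =
      rho P x * (grad u x \<bullet> grad v x) + eps P x * u x * v x +
      (rho P x * (grad u' x \<bullet> grad v x) + eps P x * u' x * v x)"
      by (simp add: inner_add_left algebra_simps)
  qed
qed

lemma a_form_scale:
  assumes i: "i \<in> {1..N}" and u: "u \<in> X i" "v \<in> X i"
  shows "a_form i (c *\<^sub>R u) v = c * a_form i u v"
proof -
  have int: "set_integrable lebesgue (Sub P i) (\<lambda>x. c * (rho P x * (grad u x \<bullet> grad v x) + eps P x * u x * v x))"
    using a_form_integrable[OF i u] by simp
  show ?thesis unfolding a_form_def set_integral_mult_right[symmetric]
  proof (rule set_integral_spike(2)[OF int negligible_mesh_interior[OF i]])
    fix x assume "x \<in> Sub P i - (Sub P i - mesh_interior i)"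
    hence x: "x \<in> mesh_interior i" by auto
    have "grad (c *\<^sub>R u) x = c *\<^sub>R grad u x"
      unfolding scaleR_fun_def
      using GDERIV_mult[OF GDERIV_const[of c] X_grad(1)[OF i u(1) x]] by (intro grad_eq) simp
    thus "rho P x * (grad (c *\<^sub>R u) x \<bullet> grad v x) + eps P x * (c *\<^sub>R u) x * v x =
      c * (rho P x * (grad u x \<bullet> grad v x) + eps P x * u x * v x)"
      by (simp add: algebra_simps)
  qed
qed

text \<open>Used to replace a sum of functions from all subdomains by its \<open>i\<close>-th
  summand.\<close>

lemma a_form_local:
  assumes i: "i \<in> {1..N}" and "\<And>x. x \<in> Sub P i \<Longrightarrow> u x = u' x" "\<And>x. x \<in> Sub P i \<Longrightarrow> v x = v' x"
  shows "a_form i u v = a_form i u' v'"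
proof -
  have "indicator (Sub P i) x *\<^sub>R (rho P x * (grad u x \<bullet> grad v x) + eps P x * u x * v x) =
    indicator (Sub P i) x *\<^sub>R (rho P x * (grad u' x \<bullet> grad v' x) + eps P x * u' x * v' x)" for x
    using assms(2,3) grad_local[OF open_Sub[OF i], of x u u'] grad_local[OF open_Sub[OF i], of x v v']
    by (auto simp: indicator_def)
  thus ?thesis unfolding a_form_def set_lebesgue_integral_def by (simp only:)
qed

text \<open>Coercivity leaves only the H1 norm to be bounded away from zero; its zero order term
  already detects a nonzero function continuous on the open subdomain.\<close>

lemma a_form_pos:
  assumes i: "i \<in> {1..N}" and v: "v \<in> X i" "v \<noteq> 0"
  shows "0 < a_form i v v"
proof -
  have H: "set_integrable lebesgue (Sub P i) (\<lambda>x. (norm (grad v x))\<^sup>2 + (v x)\<^sup>2)"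
  proof -
    have "bounded ((\<lambda>x. 1 :: real) ` Omega P)" by (auto simp: bounded_real_iff)
    moreover have "(norm (grad v x))\<^sup>2 + (v x)\<^sup>2 = 1 * (grad v x \<bullet> grad v x) + 1 * v x * v x" for x
      by (simp add: power2_norm_eq_inner power2_eq_square[of "v x"])
    ultimately show ?thesis using set_integrable_energy[OF i v(1) v(1), of "\<lambda>x. 1" "\<lambda>x. 1"]
      by (simp only: borel_measurable_const simp_thms)
  qed
  have nn: "0 \<le> H1_norm_sq i v"
    unfolding H1_norm_sq_def set_lebesgue_integral_def
    by (rule Bochner_Integration.integral_nonneg) auto
  have "H1_norm_sq i v \<noteq> 0"
  proof
    assume z: "H1_norm_sq i v = 0"
    have "v x = 0" if "x \<in> Sub P i" for x
      by (rule zero_integral_square_bound[where f = "\<lambda>x. (norm (grad v x))\<^sup>2 + (v x)\<^sup>2"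
            and g = v and S = "Sub P i" and T = "Sub P i"])
        (use z that H open_Sub[OF i] X_continuous[OF v(1)] in \<open>auto simp: H1_norm_sq_def\<close>)
    hence "v = 0" using X_outside[OF v(1)] by (auto simp: fun_eq_iff)
    thus False using v by simp
  qed
  hence "0 < H1_norm_sq i v" using nn by simp
  moreover obtain \<alpha> where "\<alpha> > 0" "\<alpha> * H1_norm_sq i v \<le> a_form i v v" using coercive i v by blast
  ultimately show ?thesis using mult_pos_pos order_less_le_trans by blast
qed

end

section \<open>Traces and multipliers\<close>

context mortar_discretization
begin

text \<open>A frontier point is not in the open subdomain but is a limit point of it, so the limit
  is taken where the extension equals the continuous \<open>f\<close>.\<close>

lemma trace_zero_ext:
  assumes i: "i \<in> {1..N}" and f: "continuous_on (closure (Sub P i)) f" and x: "x \<in> frontier (Sub P i)"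
  shows "trace i (zero_ext (Sub P i) f) x = f x"
  unfolding trace_def
proof (rule tendsto_Lim)
  have xc: "x \<in> closure (Sub P i)" "x \<notin> Sub P i"
    using x open_Sub[OF i] by (auto simp: frontier_def interior_open)
  hence "x islimpt Sub P i" by (simp add: islimpt_in_closure)
  thus "at x within Sub P i \<noteq> bot" by (simp add: trivial_limit_within)
  have "(f \<longlongrightarrow> f x) (at x within closure (Sub P i))" using f xc(1) by (auto simp: continuous_on_def)
  hence "(f \<longlongrightarrow> f x) (at x within Sub P i)" by (rule tendsto_within_subset) (rule closure_subset)
  thus "(zero_ext (Sub P i) f \<longlongrightarrow> f x) (at x within Sub P i)"
  proof (rule Lim_transform_eventually)
    have "\<forall>y. y \<noteq> x \<longrightarrow> y \<in> Sub P i \<longrightarrow> f y = zero_ext (Sub P i) f y" by (simp add: zero_ext_def)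
    thus "\<forall>\<^sub>F y in at x within Sub P i. f y = zero_ext (Sub P i) f y"
      unfolding eventually_at_filter by (intro always_eventually)
  qed
qed

lemma trace_linear:
  assumes i: "i \<in> {1..N}" and u: "u \<in> X i" and v: "v \<in> X i" and x: "x \<in> frontier (Sub P i)"
  shows "trace i (u + v) x = trace i u x + trace i v x" "trace i (c *\<^sub>R u) x = c * trace i u x"
proof -
  obtain f g where f: "u = zero_ext (Sub P i) f" "continuous_on (closure (Sub P i)) f"
    and g: "v = zero_ext (Sub P i) g" "continuous_on (closure (Sub P i)) g"
    by (metis X_cases u v)
  have 1: "continuous_on (closure (Sub P i)) (\<lambda>x. f x + g x)" and
    2: "continuous_on (closure (Sub P i)) (\<lambda>x. c * f x)"
    by (intro continuous_intros f(2) g(2))+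
  show "trace i (u + v) x = trace i u x + trace i v x" "trace i (c *\<^sub>R u) x = c * trace i u x"
    using trace_zero_ext[OF i 1 x] trace_zero_ext[OF i 2 x] trace_zero_ext[OF i f(2) x] trace_zero_ext[OF i g(2) x]
    by (simp_all add: zero_ext_linear f g)
qed

text \<open>\<open>trace\<close> is a \<open>Lim\<close>, about which nothing is known away from the
  closure of the subdomain. Cutting it off to the frontier gives a bounded Borel function on the
  plane and changes no edge integral in \<open>b_form\<close>.\<close>

definition boundary_trace :: "nat \<Rightarrow> (plane \<Rightarrow> real) \<Rightarrow> plane \<Rightarrow> real"
  where "boundary_trace i v x = indicator (frontier (Sub P i)) x * trace i v x"

lemma boundary_trace_bounded_borel:
  assumes i: "i \<in> {1..N}" and v: "v \<in> X i"
  shows "boundary_trace i v \<in> bounded_borel"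
proof -
  obtain f where f: "v = zero_ext (Sub P i) f" "continuous_on (closure (Sub P i)) f"
    by (metis X_cases v)
  have "compact (frontier (Sub P i))" using bounded_Sub[OF i] by (simp add: compact_frontier_bounded)
  moreover have "continuous_on (frontier (Sub P i)) f"
    by (rule continuous_on_subset[OF f(2)]) (auto simp: frontier_def)
  ultimately have "(\<lambda>x. indicator (frontier (Sub P i)) x * f x) \<in> bounded_borel"
    by (rule bounded_borel_continuous)
  also have "(\<lambda>x. indicator (frontier (Sub P i)) x * f x) = boundary_trace i v"
    using trace_zero_ext[OF i f(2)] by (auto simp: boundary_trace_def indicator_def fun_eq_iff f(1))
  finally show ?thesis .
qed

lemma trace_local:
  assumes "\<And>x. x \<in> Sub P i \<Longrightarrow> u x = v x"
  shows "trace i u x = trace i v x"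
  unfolding trace_def by (rule Lim_cong) (auto simp: assms eventually_at_filter)

lemma common_simplex: "is_interface i r \<Longrightarrow> 1 simplex common i r"
  using subdomains by (auto simp: is_interface_def polygonal_domain_def)

lemma b_form_boundary_trace:
  "b_form i v p = (\<Sum>r | is_interface i r.
    edge_integral (common i r) (\<lambda>x. ((if i < r then 1 else - 1) * boundary_trace i v x) * p x))"
  unfolding b_form_def
  by (intro sum.cong refl edge_integral_cong)
    (auto simp: boundary_trace_def common_def intro: common_simplex[unfolded common_def])

lemma b_form_linear:
  assumes i: "i \<in> {1..N}" and u: "u \<in> X i" and v: "v \<in> X i"
    and p: "p \<in> bounded_borel" and q: "q \<in> bounded_borel"
  shows "b_form i (u + v) p = b_form i u p + b_form i v p" "b_form i (c *\<^sub>R u) p = c * b_form i u p"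
    "b_form i u (p + q) = b_form i u p + b_form i u q" "b_form i u (c *\<^sub>R p) = c * b_form i u p"
proof -
  have bb: "(\<lambda>x. (s * boundary_trace i w x) * m x) \<in> bounded_borel"
    if "w \<in> X i" "m \<in> bounded_borel" for w m s
    by (rule bounded_borel_mult[OF bounded_borel_mult[OF bounded_borel_const
          boundary_trace_bounded_borel[OF i that(1)]] that(2)])
  have 1: "boundary_trace i (u + v) x = boundary_trace i u x + boundary_trace i v x"
    "boundary_trace i (c *\<^sub>R u) x = c * boundary_trace i u x" for x
    using trace_linear[OF i u v, of x] by (auto simp: boundary_trace_def indicator_def)
  have e1: "edge_integral (common i r) (\<lambda>x. (s * boundary_trace i (u + v) x) * p x) =
     edge_integral (common i r) (\<lambda>x. (s * boundary_trace i u x) * p x) +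
     edge_integral (common i r) (\<lambda>x. (s * boundary_trace i v x) * p x)" if "is_interface i r" for r s
    using edge_integral_linear(1)[OF common_simplex[OF that] bb[OF u p, of s] bb[OF v p, of s]]
    by (simp add: 1 algebra_simps)
  have e2: "edge_integral (common i r) (\<lambda>x. (s * boundary_trace i (c *\<^sub>R u) x) * p x) =
     c * edge_integral (common i r) (\<lambda>x. (s * boundary_trace i u x) * p x)" if "is_interface i r" for r s
    using edge_integral_linear(2)[OF common_simplex[OF that] bb[OF u p, of s] bb[OF u p, of s], of c]
    by (simp add: 1 ac_simps)
  have e3: "edge_integral (common i r) (\<lambda>x. (s * boundary_trace i u x) * (p + q) x) =
     edge_integral (common i r) (\<lambda>x. (s * boundary_trace i u x) * p x) +
     edge_integral (common i r) (\<lambda>x. (s * boundary_trace i u x) * q x)" if "is_interface i r" for r s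
    using edge_integral_linear(1)[OF common_simplex[OF that] bb[OF u p, of s] bb[OF u q, of s]]
    by (simp add: algebra_simps)
  have e4: "edge_integral (common i r) (\<lambda>x. (s * boundary_trace i u x) * (c *\<^sub>R p) x) =
     c * edge_integral (common i r) (\<lambda>x. (s * boundary_trace i u x) * p x)" if "is_interface i r" for r s
    using edge_integral_linear(2)[OF common_simplex[OF that] bb[OF u p, of s] bb[OF u p, of s], of c]
    by (simp add: ac_simps)
  show "b_form i (u + v) p = b_form i u p + b_form i v p" "b_form i (c *\<^sub>R u) p = c * b_form i u p"
    "b_form i u (p + q) = b_form i u p + b_form i u q" "b_form i u (c *\<^sub>R p) = c * b_form i u p"
    unfolding b_form_boundary_trace sum.distrib[symmetric] sum_distrib_left
    by (intro sum.cong refl e1 e2 e3 e4; simp)+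
qed

lemma b_form_local:
  assumes "\<And>x. x \<in> Sub P i \<Longrightarrow> u x = v x"
  shows "b_form i u p = b_form i v p"
  unfolding b_form_def using trace_local[of i u v] assms by simp

lemma edge_integral_zero: "1 simplex e \<Longrightarrow> (\<And>x. x \<in> e \<Longrightarrow> f x = 0) \<Longrightarrow> edge_integral e f = 0"
  using edge_integral_cong[of e f "\<lambda>x. 0 * 0"] edge_integral_linear(2)[of e "\<lambda>x. 0" "\<lambda>x. 0" 0]
  by (simp add: bounded_borel_const)

lemma b_form_zero_right: "b_form i v 0 = 0"
  unfolding b_form_def by (auto intro!: sum.neutral edge_integral_zero common_simplex)

lemma MF_cases:
  assumes "p \<in> MF k"
  obtains m where "p = zero_ext (F k) m" "continuous_on (F_closed k) m"
  using assms by (auto simp: MF_def multipliers_def)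

lemma MF_outside: "p \<in> MF k \<Longrightarrow> x \<notin> F k \<Longrightarrow> p x = 0"
  by (auto simp: MF_def zero_ext_def)

lemma MF_continuous: "p \<in> MF k \<Longrightarrow> continuous_on (F k) p"
proof -
  assume "p \<in> MF k"
  then obtain m where m: "p = zero_ext (F k) m" "continuous_on (F_closed k) m" by (metis MF_cases)
  have "continuous_on (F k) m" using m(2) F_subset_F_closed continuous_on_subset by blast
  thus ?thesis by (rule continuous_on_eq) (auto simp: m zero_ext_def)
qed

lemma MF_bounded_borel:
  assumes k: "k \<in> {1..M}" and p: "p \<in> MF k"
  shows "p \<in> bounded_borel"
proof -
  obtain m where m: "p = zero_ext (F k) m" "continuous_on (F_closed k) m" using p by (metis MF_cases)
  obtain a b where ab: "a \<noteq> b" "F_closed k = closed_segment a b" "F k = open_segment a b"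
    using F_closed_segment[OF k] by metis
  have "F k = closed_segment a b - {a, b}" using ab by (simp add: open_segment_def)
  hence "F k \<in> sets borel" by simp
  thus ?thesis unfolding m(1)
    by (intro bounded_borel_zero_ext[where K = "F_closed k"] F_subset_F_closed m(2)) (auto simp: ab)
qed

text \<open>\<open>MF k\<close> is the span of the given basis, so the piecewise polynomials need
  not be inspected.\<close>

lemma subspace_MF: "k \<in> {1..M} \<Longrightarrow> subspace (MF k)"
  using mbasis unfolding is_basis_def by (metis subspace_span)

text \<open>Constants are multipliers. A nonzero multiplier is what makes \<open>W_hat\<close>
  nontrivial and its spectrum nonempty.\<close>

lemma MF_nonzero: "k \<in> {1..M} \<Longrightarrow> \<exists>p\<in>MF k. p \<noteq> 0"
proof -
  assume k: "k \<in> {1..M}"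
  have "zero_ext (F k) (\<lambda>x. 1) \<in> MF k"
    unfolding MF_def multipliers_def by (auto simp: polynomial_on_const)
  moreover have "zero_ext (F k) (\<lambda>x. 1 :: real) \<noteq> 0"
    using F_nonempty[OF k] by (auto simp: zero_ext_def fun_eq_iff)
  ultimately show ?thesis by blast
qed

lemma sum_MF_apply:
  assumes k: "k \<in> {1..M}" "k \<in> I" "I \<subseteq> {1..M}" and p: "\<And>m. m \<in> I \<Longrightarrow> p m \<in> MF m" and x: "x \<in> F k"
  shows "(\<Sum>m\<in>I. p m) x = p k x"
proof -
  have fin: "finite I" using k(3) finite_subset by blast
  have "p m x = 0" if "m \<in> I" "m \<noteq> k" for m
    using MF_outside[OF p[OF that(1)]] F_disjoint[OF k(1) _ x] F_subset_F_closed[of m] k(3) that by blast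
  hence "(\<Sum>m\<in>I. p m x) = (\<Sum>m\<in>I. if m = k then p k x else 0)" by (intro sum.cong) auto
  thus ?thesis using fin k(2) by (simp add: sum_fun_apply)
qed

lemma MF_sum_eq_zero:
  assumes I: "I \<subseteq> {1..M}" and p: "\<And>m. m \<in> I \<Longrightarrow> p m \<in> MF m" and z: "(\<Sum>m\<in>I. p m) = 0" and k: "k \<in> I"
  shows "p k = 0"
proof
  fix x
  show "p k x = 0 x"
    using sum_MF_apply[of k I p x] MF_outside[OF p[OF k], of x] I p z k by (cases "x \<in> F k") auto
qed

text \<open>\<open>b_form i\<close> integrates over parts of the frontier of \<open>Sub P i\<close>,
  and a point of \<open>F k\<close> there would make \<open>i\<close> a side of
  \<open>k\<close>.\<close>

lemma b_form_not_side:
  assumes i: "i \<in> {1..N}" and k: "k \<in> {1..M}" "k \<notin> ifaces_of i" and p: "p \<in> MF k"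
  shows "b_form i v p = 0"
  unfolding b_form_def
proof (intro sum.neutral ballI edge_integral_zero)
  fix r x assume r: "r \<in> {r. is_interface i r}" and x: "x \<in> common i r"
  have "x \<notin> F k"
    using F_frontier_imp_side[OF k(1) _ i, of x] mem_ifaces_of[OF k(1) i] k(2) x by (auto simp: common_def)
  thus "(if i < r then 1 else - 1) * trace i v x * p x = 0" using MF_outside[OF p] by simp
qed (simp add: common_simplex)

section \<open>The skeleton multiplier space and the ambient inner product space\<close>

definition Lambda :: "(plane \<Rightarrow> real) set"
  where "Lambda = (\<Sum>k\<in>{1..M}. MF k)"

lemma subspace_Lambda: "subspace Lambda"
  unfolding Lambda_def by (rule subspace_set_sum) (rule subspace_MF)

lemma Lambda_bounded_borel: "p \<in> Lambda \<Longrightarrow> p \<in> bounded_borel"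
  using set_sum_subset_subspace[OF subspace_bounded_borel, of "{1..M}" MF] MF_bounded_borel
  unfolding Lambda_def by blast

lemma MF_subset_Lambda: "k \<in> {1..M} \<Longrightarrow> p \<in> MF k \<Longrightarrow> p \<in> Lambda"
proof -
  assume k: "k \<in> {1..M}" and p: "p \<in> MF k"
  have "(\<Sum>m\<in>{1..M}. if m = k then p else 0) \<in> Lambda"
    unfolding Lambda_def by (rule set_sum_memberI) (use p subspace_MF subspace_0 in auto)
  thus ?thesis using k by simp
qed

lemma sum_X_apply:
  assumes i: "i \<in> {1..N}" and u: "\<And>j. j \<in> {1..N} \<Longrightarrow> u j \<in> X j" and x: "x \<in> Sub P i"
  shows "(\<Sum>j\<in>{1..N}. u j) x = u i x"
proof -
  have "u j x = 0" if "j \<in> {1..N}" "j \<noteq> i" for j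
    using X_outside[OF u[OF that(1)]] subdomains_disjoint i that x by blast
  hence "(\<Sum>j\<in>{1..N}. u j x) = (\<Sum>j\<in>{1..N}. if j = i then u i x else 0)" by (intro sum.cong) auto
  thus ?thesis using i by (simp add: sum_fun_apply)
qed

text \<open>A subspace large enough for \<open>W_hat\<close> and \<open>W_tilde\<close> on which
  \<open>ip\<close> is an inner product; on arbitrary pairs of functions \<open>ip\<close> is not
  definite, as null sets go unnoticed.\<close>

definition ambient :: "pairfun set"
  where "ambient = (\<Sum>i\<in>{1..N}. X i) \<times> Lambda"

lemma subspace_ambient: "subspace ambient"
  unfolding ambient_def
  by (intro subspace_Times subspace_set_sum subspace_X subspace_Lambda)

lemma sum_X_bounded_borel: "u \<in> (\<Sum>i\<in>{1..N}. X i) \<Longrightarrow> u \<in> bounded_borel"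
  using set_sum_subset_subspace[OF subspace_bounded_borel, of "{1..N}" X] X_bounded_borel by blast

lemma ip_sym: "ip u v = ip v u"
  by (simp add: ip_def case_prod_beta mult.commute)

lemma Omega_facts: "open (Omega P)" "bounded (Omega P)"
  using Omega by (auto simp: polygonal_domain_def)

lemma F_closed_simplex: "k \<in> {1..M} \<Longrightarrow> 1 simplex F_closed k"
  unfolding F_closed_def using common_simplex iface_sides by blast

lemma ip_linear:
  assumes u: "u \<in> ambient" and v: "v \<in> ambient" and w: "w \<in> ambient"
  shows "ip (u + v) w = ip u w + ip v w" "ip (c *\<^sub>R u) w = c * ip u w"
proof -
  have bb: "fst z \<in> bounded_borel" "snd z \<in> bounded_borel" if "z \<in> ambient" for z
    using that sum_X_bounded_borel Lambda_bounded_borel by (auto simp: ambient_def)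
  have int: "set_integrable lebesgue (Omega P) (\<lambda>x. fst z x * fst w x)" if "z \<in> ambient" for z
    using bb[OF that] bb[OF w] Omega_facts by (intro set_integrable_bounded_borel bounded_borel_mult)
  have bp: "(\<lambda>x. snd z x * snd w x) \<in> bounded_borel" if "z \<in> ambient" for z
    using bb[OF that] bb[OF w] by auto
  have "(\<Sum>k=1..M. edge_integral (F_closed k) (\<lambda>x. (snd u + snd v) x * snd w x)) =
    (\<Sum>k=1..M. edge_integral (F_closed k) (\<lambda>x. snd u x * snd w x)) +
    (\<Sum>k=1..M. edge_integral (F_closed k) (\<lambda>x. snd v x * snd w x))"
    unfolding sum.distrib[symmetric]
    using edge_integral_linear(1)[OF F_closed_simplex bp[OF u] bp[OF v]]
    by (intro sum.cong refl) (simp add: algebra_simps)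
  thus "ip (u + v) w = ip u w + ip v w"
    using set_integral_add(2)[OF int[OF u] int[OF v]]
    by (simp add: ip_def case_prod_beta algebra_simps)
  have "(\<Sum>k=1..M. edge_integral (F_closed k) (\<lambda>x. (c *\<^sub>R snd u) x * snd w x)) =
    c * (\<Sum>k=1..M. edge_integral (F_closed k) (\<lambda>x. snd u x * snd w x))"
    unfolding sum_distrib_left
    using edge_integral_linear(2)[OF F_closed_simplex bp[OF u] bp[OF u], of _ c]
    by (intro sum.cong refl) (simp add: algebra_simps)
  moreover have "(LINT x:Omega P|lebesgue. c * (fst u x * fst w x)) = c * (LINT x:Omega P|lebesgue. fst u x * fst w x)"
    by simp
  ultimately show "ip (c *\<^sub>R u) w = c * ip u w"
    by (simp add: ip_def case_prod_beta algebra_simps)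
qed

text \<open>Each component is continuous on its open subdomain or open interface and identically
  zero elsewhere, so a vanishing integral forces the function itself, and not merely its class, to
  be zero.\<close>

lemma ip_pos:
  assumes w: "w \<in> ambient" and nz: "w \<noteq> 0"
  shows "0 < ip w w"
proof -
  obtain u p where up: "w = (u, p)" "u \<in> (\<Sum>i\<in>{1..N}. X i)" "p \<in> Lambda" using w by (auto simp: ambient_def)
  obtain ui where ui: "\<And>i. i \<in> {1..N} \<Longrightarrow> ui i \<in> X i" "u = (\<Sum>i\<in>{1..N}. ui i)"
    using up(2) by (metis finite_atLeastAtMost set_sum_memberE)
  obtain pk where pk: "\<And>k. k \<in> {1..M} \<Longrightarrow> pk k \<in> MF k" "p = (\<Sum>k\<in>{1..M}. pk k)"
    using up(3) unfolding Lambda_def by (metis finite_atLeastAtMost set_sum_memberE)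
  have ub: "u \<in> bounded_borel" and pb: "p \<in> bounded_borel"
    using up sum_X_bounded_borel Lambda_bounded_borel by auto
  let ?I = "LINT x:Omega P|lebesgue. u x * u x"
  let ?e = "\<lambda>k. edge_integral (F_closed k) (\<lambda>x. p x * p x)"
  have ip: "ip w w = ?I + (\<Sum>k=1..M. ?e k)" by (simp add: ip_def up(1))
  have I: "0 \<le> ?I" unfolding set_lebesgue_integral_def by (rule Bochner_Integration.integral_nonneg) auto
  have e: "0 \<le> ?e k" if "k \<in> {1..M}" for k
    using edge_integral_square(1)[OF F_closed_simplex[OF that] pb] .
  have E: "0 \<le> (\<Sum>k=1..M. ?e k)" by (rule sum_nonneg) (rule e)
  have "ip w w \<noteq> 0"
  proof
    assume "ip w w = 0"
    hence I0: "?I = 0" and E0: "(\<Sum>k=1..M. ?e k) = 0" using ip I E by linarith+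
    have e0: "?e k = 0" if "k \<in> {1..M}" for k
      using E0 sum_nonneg_eq_0_iff[of "{1..M}" ?e] e that by auto
    have "ui i = 0" if i: "i \<in> {1..N}" for i
    proof
      fix x
      have "u x = 0" if "x \<in> Sub P i"
      proof (rule zero_integral_square_bound[where f = "\<lambda>x. u x * u x" and g = u and S = "Omega P" and T = "Sub P i"])
        show "set_integrable lebesgue (Omega P) (\<lambda>x. u x * u x)"
          using ub Omega_facts by (intro set_integrable_bounded_borel bounded_borel_mult)
        have "continuous_on (Sub P i) (ui i)" by (rule X_continuous[OF ui(1)[OF i]])
        thus "continuous_on (Sub P i) u"
          unfolding ui(2) by (rule continuous_on_eq) (rule sum_X_apply[OF i ui(1), symmetric])
      qed (use I0 Sub_subset_Omega[OF i] open_Sub[OF i] that in \<open>auto simp: power2_eq_square\<close>)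
      thus "ui i x = 0 x"
        using X_outside[OF ui(1)[OF i]] sum_X_apply[OF i ui(1)] ui(2) by (cases "x \<in> Sub P i") auto
    qed
    hence "u = 0" using ui(2) by simp
    have "pk k = 0" if k: "k \<in> {1..M}" for k
    proof
      fix x
      have pp: "p y = pk k y" if "y \<in> F k" for y
        unfolding pk(2) by (rule sum_MF_apply) (use k that pk(1) in auto)
      have "continuous_on (F k) (pk k)" by (rule MF_continuous[OF pk(1)[OF k]])
      hence c: "continuous_on (rel_interior (F_closed k)) p"
        unfolding F_def[symmetric] by (rule continuous_on_eq) (simp add: pp)
      have "p x = 0" if "x \<in> F k"
        using edge_integral_square(2)[OF F_closed_simplex[OF k] pb e0[OF k] c] that by (simp add: F_def)
      thus "pk k x = 0 x"
        using MF_outside[OF pk(1)[OF k]] pp by (cases "x \<in> F k") auto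
    qed
    hence "p = 0" using pk(2) by simp
    thus False using \<open>u = 0\<close> nz up(1) by (simp add: zero_prod_def)
  qed
  thus ?thesis using ip I E by linarith
qed

end

section \<open>Linear maps and symmetric positive definite forms on subspaces\<close>

text \<open>Linearity relative to a subspace: the maps of the method are built from definite
  descriptions, which are controlled only on the intended domain.\<close>

definition lin_on :: "'v::real_vector set \<Rightarrow> ('v \<Rightarrow> 'w::real_vector) \<Rightarrow> bool"
  where "lin_on V f \<longleftrightarrow> (\<forall>x\<in>V. \<forall>y\<in>V. f (x + y) = f x + f y) \<and> (\<forall>c. \<forall>x\<in>V. f (c *\<^sub>R x) = c *\<^sub>R f x)"

lemma lin_onI:
  assumes "\<And>x y. x \<in> V \<Longrightarrow> y \<in> V \<Longrightarrow> f (x + y) = f x + f y" "\<And>c x. x \<in> V \<Longrightarrow> f (c *\<^sub>R x) = c *\<^sub>R f x"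
  shows "lin_on V f"
  using assms by (auto simp: lin_on_def)

lemma lin_on_add: "lin_on V f \<Longrightarrow> x \<in> V \<Longrightarrow> y \<in> V \<Longrightarrow> f (x + y) = f x + f y"
  and lin_on_scale: "lin_on V f \<Longrightarrow> x \<in> V \<Longrightarrow> f (c *\<^sub>R x) = c *\<^sub>R f x"
  by (auto simp: lin_on_def)

lemma lin_on_zero: "lin_on V f \<Longrightarrow> subspace V \<Longrightarrow> f 0 = 0"
  using lin_on_scale[of V f 0 0] subspace_0 by auto

lemma lin_on_sum:
  assumes "lin_on V f" "subspace V" "\<And>i. i \<in> I \<Longrightarrow> x i \<in> V"
  shows "f (\<Sum>i\<in>I. x i) = (\<Sum>i\<in>I. f (x i))"
  using assms(3)
proof (induction I rule: infinite_finite_induct)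
  case (insert i I)
  thus ?case using lin_on_add[OF assms(1), of "x i" "\<Sum>i\<in>I. x i"] subspace_sum[OF assms(2), of I x] by simp
qed (use lin_on_zero assms in auto)

lemma lin_on_diff: "lin_on V f \<Longrightarrow> subspace V \<Longrightarrow> x \<in> V \<Longrightarrow> y \<in> V \<Longrightarrow> f (x - y) = f x - f y"
  using lin_on_add[of V f x "(-1) *\<^sub>R y"] lin_on_scale[of V f y "-1"] subspace_scale[of V y "-1"] by simp

lemma lin_on_subset: "lin_on V f \<Longrightarrow> U \<subseteq> V \<Longrightarrow> lin_on U f"
  unfolding lin_on_def by blast

definition spd_on :: "'v::real_vector set \<Rightarrow> ('v \<Rightarrow> 'v \<Rightarrow> real) \<Rightarrow> bool"
  where "spd_on V a \<longleftrightarrow> (\<forall>x\<in>V. \<forall>y\<in>V. a x y = a y x) \<and>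
    (\<forall>y\<in>V. lin_on V (\<lambda>x. a x y)) \<and> (\<forall>x\<in>V. x \<noteq> 0 \<longrightarrow> 0 < a x x)"

lemma spd_onI:
  assumes "\<And>x y. x \<in> V \<Longrightarrow> y \<in> V \<Longrightarrow> a x y = a y x"
    "\<And>x y z. x \<in> V \<Longrightarrow> y \<in> V \<Longrightarrow> z \<in> V \<Longrightarrow> a (x + y) z = a x z + a y z"
    "\<And>c x y. x \<in> V \<Longrightarrow> y \<in> V \<Longrightarrow> a (c *\<^sub>R x) y = c * a x y"
    "\<And>x. x \<in> V \<Longrightarrow> x \<noteq> 0 \<Longrightarrow> 0 < a x x"
  shows "spd_on V a"
  using assms by (auto simp: spd_on_def lin_on_def)

lemma spd_on_sym: "spd_on V a \<Longrightarrow> x \<in> V \<Longrightarrow> y \<in> V \<Longrightarrow> a x y = a y x"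
  and spd_on_lin: "spd_on V a \<Longrightarrow> y \<in> V \<Longrightarrow> lin_on V (\<lambda>x. a x y)"
  and spd_on_pos: "spd_on V a \<Longrightarrow> x \<in> V \<Longrightarrow> x \<noteq> 0 \<Longrightarrow> 0 < a x x"
  by (auto simp: spd_on_def)

lemma spd_on_subset: "spd_on V a \<Longrightarrow> U \<subseteq> V \<Longrightarrow> spd_on U a"
  unfolding spd_on_def lin_on_def by (auto 0 3 simp: subset_iff)

lemma spd_on_lin_right:
  assumes "spd_on V a" "subspace V" "y \<in> V"
  shows "lin_on V (a y)"
proof (rule lin_onI)
  fix u v assume "u \<in> V" "v \<in> V"
  thus "a y (u + v) = a y u + a y v"
    using assms lin_on_add[OF spd_on_lin[OF assms(1,3)], of u v] spd_on_sym[OF assms(1)]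
      subspace_add[OF assms(2), of u v] by metis
next
  fix c u assume "u \<in> V"
  thus "a y (c *\<^sub>R u) = c *\<^sub>R a y u"
    using assms lin_on_scale[OF spd_on_lin[OF assms(1,3)], of u c] spd_on_sym[OF assms(1)]
      subspace_scale[OF assms(2), of u c] by metis
qed

lemma spd_on_nonneg: "spd_on V a \<Longrightarrow> subspace V \<Longrightarrow> x \<in> V \<Longrightarrow> 0 \<le> a x x"
  using spd_on_pos[of V a x] lin_on_zero[OF spd_on_lin[of V a x]] by (cases "x = 0") (auto simp: less_imp_le)

lemma spd_on_unique:
  assumes "spd_on V a" "subspace V" "x \<in> V" "y \<in> V" "\<And>v. v \<in> V \<Longrightarrow> a x v = a y v"
  shows "x = y"
proof (rule ccontr)
  assume "x \<noteq> y"
  have d: "x - y \<in> V" using assms subspace_diff by blast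
  have "a (x - y) (x - y) = 0"
    using lin_on_diff[OF spd_on_lin[OF assms(1) d] assms(2-4)] assms(5)[OF d] by simp
  thus False using spd_on_pos[OF assms(1) d] \<open>x \<noteq> y\<close> by simp
qed

text \<open>Induction on the spanning set with a Gram-Schmidt step: the new vector \<open>b\<close>
  is replaced by its remainder \<open>e\<close>, orthogonal to the old span, and the solution
  \<open>x0\<close> is corrected along \<open>e\<close> alone. The induction hypothesis is used
  twice, for \<open>f\<close> and for the projection of \<open>b\<close>.\<close>

lemma riesz:
  assumes "finite B" "spd_on (span B) a" "lin_on (span B) f"
  shows "\<exists>x\<in>span B. \<forall>v\<in>span B. a x v = (f v :: real)"
  using assms
proof (induction B arbitrary: f rule: finite_induct)
  case empty
  thus ?case using lin_on_zero[OF empty(2)] lin_on_zero[OF spd_on_lin[OF empty(1), of 0]] by auto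
next
  case (insert b B)
  let ?V = "span B" and ?W = "span (insert b B)"
  have sub: "?V \<subseteq> ?W" by (rule span_mono) auto
  have a: "spd_on ?V a" and f: "lin_on ?V f"
    using insert.prems sub spd_on_subset lin_on_subset by blast+
  have b: "b \<in> ?W" by (rule span_base) auto
  obtain x0 where x0: "x0 \<in> ?V" "\<And>v. v \<in> ?V \<Longrightarrow> a x0 v = f v" using insert.IH[OF a f] by blast
  have rW: "lin_on ?W (a b)" using spd_on_lin_right[OF insert.prems(1) subspace_span b] .
  obtain p where p: "p \<in> ?V" "\<And>v. v \<in> ?V \<Longrightarrow> a p v = a b v"
    using insert.IH[OF a lin_on_subset[OF rW sub]] by blast
  define e where "e = b - p"
  have e: "e \<in> ?W" unfolding e_def using b p(1) sub by (intro span_diff) auto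
  have eV: "a e v = 0" if "v \<in> ?V" for v
    using lin_on_diff[OF spd_on_lin[OF insert.prems(1), of v] subspace_span b, of p] p that sub
    by (auto simp: e_def)
  have decomp: "\<exists>k. \<exists>u\<in>?V. v = u + k *\<^sub>R e" if v: "v \<in> ?W" for v
  proof -
    obtain k where k: "v - k *\<^sub>R b \<in> ?V" using v span_breakdown_eq by blast
    have "v = (v - k *\<^sub>R b + k *\<^sub>R p) + k *\<^sub>R e" by (simp add: e_def algebra_simps)
    moreover have "v - k *\<^sub>R b + k *\<^sub>R p \<in> ?V" using k p(1) by (intro span_add span_scale)
    ultimately show ?thesis by blast
  qed
  \<comment> \<open>As \<open>B\<close> may be dependent, \<open>e\<close> can be zero; then
    \<open>f e\<close> is zero too and the value 0 of \<open>t\<close> still satisfies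
    \<open>te\<close>.\<close>
  define t where "t = (if e = 0 then 0 else (f e) / a e e)"
  have te: "t * a e e = f e"
    using spd_on_pos[OF insert.prems(1) e] lin_on_zero[OF insert.prems(2) subspace_span]
      lin_on_zero[OF spd_on_lin[OF insert.prems(1) e] subspace_span] by (auto simp: t_def)
  define x where "x = x0 + t *\<^sub>R e"
  have xW: "x \<in> ?W" unfolding x_def using x0(1) sub e by (intro span_add span_scale) auto
  have "a x v = f v" if v: "v \<in> ?W" for v
  proof -
    obtain k u where u: "u \<in> ?V" "v = u + k *\<^sub>R e" using decomp[OF v] by blast
    have uW: "u \<in> ?W" and x0W: "x0 \<in> ?W" using u x0 sub by auto
    have kW: "k *\<^sub>R e \<in> ?W" and tW: "t *\<^sub>R e \<in> ?W" using e by (auto intro: span_scale)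
    have x0e: "a x0 e = 0" using eV[OF x0(1)] spd_on_sym[OF insert.prems(1) e x0W] by simp
    have "a x v = a x u + k * a x e"
      using lin_on_add[OF spd_on_lin_right[OF insert.prems(1) subspace_span xW] uW kW]
        lin_on_scale[OF spd_on_lin_right[OF insert.prems(1) subspace_span xW] e] u(2) by simp
    moreover have "a x u = a x0 u + t * a e u"
      unfolding x_def using lin_on_add[OF spd_on_lin[OF insert.prems(1) uW] x0W tW]
        lin_on_scale[OF spd_on_lin[OF insert.prems(1) uW] e] by simp
    moreover have "a x e = a x0 e + t * a e e"
      unfolding x_def using lin_on_add[OF spd_on_lin[OF insert.prems(1) e] x0W tW]
        lin_on_scale[OF spd_on_lin[OF insert.prems(1) e] e] by simp
    moreover have "f v = f u + k * f e"
      using lin_on_add[OF insert.prems(2) uW kW] lin_on_scale[OF insert.prems(2) e] u(2) by simp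
    ultimately show ?thesis using x0(2)[OF u(1)] eV[OF u(1)] te x0e by simp
  qed
  thus ?case using xW by blast
qed

section \<open>Coordinates\<close>

lemma lin_comb_add:
  "c \<in> carrier_vec n \<Longrightarrow> d \<in> carrier_vec n \<Longrightarrow> lin_comb n b (c + d) = lin_comb n b c + lin_comb n b d"
  by (simp add: lin_comb_def sum.distrib scaleR_add_left)

lemma lin_comb_smult: "c \<in> carrier_vec n \<Longrightarrow> lin_comb n b (r \<cdot>\<^sub>v c) = r *\<^sub>R lin_comb n b c"
  by (simp add: lin_comb_def scaleR_sum_right)

lemma lin_comb_zero [simp]: "lin_comb n b (0\<^sub>v n) = 0"
  by (simp add: lin_comb_def)

lemma lin_comb_vec: "lin_comb n b (Matrix.vec n c) = (\<Sum>l<n. c l *\<^sub>R b l)"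
  by (simp add: lin_comb_def)

lemma span_image_sums:
  fixes b :: "'i \<Rightarrow> 'v::real_vector"
  assumes A: "finite A" and "x \<in> span (b ` A)"
  obtains c where "x = (\<Sum>l\<in>A. c l *\<^sub>R b l)"
proof -
  define S where "S = range (\<lambda>c. \<Sum>l\<in>A. c l *\<^sub>R b l)"
  have "subspace S"
  proof (rule subspaceI)
    show "0 \<in> S" unfolding S_def by (rule range_eqI[of _ _ "\<lambda>l. 0"]) simp
  next
    fix x y assume "x \<in> S" "y \<in> S"
    then obtain c d where "x = (\<Sum>l\<in>A. c l *\<^sub>R b l)" "y = (\<Sum>l\<in>A. d l *\<^sub>R b l)" by (auto simp: S_def)
    thus "x + y \<in> S" unfolding S_def
      by (intro range_eqI[of _ _ "\<lambda>l. c l + d l"]) (simp add: sum.distrib scaleR_add_left)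
  next
    fix r x assume "x \<in> S"
    then obtain c where "x = (\<Sum>l\<in>A. c l *\<^sub>R b l)" by (auto simp: S_def)
    thus "r *\<^sub>R x \<in> S" unfolding S_def
      by (intro range_eqI[of _ _ "\<lambda>l. r * c l"]) (simp add: scaleR_sum_right)
  qed
  moreover have "b ` A \<subseteq> S"
  proof
    fix y assume "y \<in> b ` A"
    then obtain m where m: "m \<in> A" "y = b m" by auto
    have "(\<Sum>l\<in>A. (if l = m then 1 else 0) *\<^sub>R b l) = (\<Sum>l\<in>A. if l = m then b m else 0)"
      by (intro sum.cong) auto
    thus "y \<in> S" unfolding S_def using m A by (intro range_eqI[of _ _ "\<lambda>l. if l = m then 1 else 0"]) simp
  qed
  ultimately have "span (b ` A) \<subseteq> S" by (rule span_minimal[rotated])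
  thus thesis using assms(2) that by (auto simp: S_def)
qed

lemma lin_comb_in_span: "lin_comb n b c \<in> span (b ` {..<n})"
  unfolding lin_comb_def by (intro span_sum span_scale span_base) auto

lemma span_lin_comb: "span (b ` {..<n}) = lin_comb n b ` carrier_vec n"
proof
  show "span (b ` {..<n}) \<subseteq> lin_comb n b ` carrier_vec n"
  proof
    fix x assume "x \<in> span (b ` {..<n})"
    then obtain c where "x = (\<Sum>l<n. c l *\<^sub>R b l)" by (rule span_image_sums[rotated]) auto
    thus "x \<in> lin_comb n b ` carrier_vec n"
      by (intro image_eqI[of _ _ "Matrix.vec n c"]) (auto simp: lin_comb_vec)
  qed
qed (use lin_comb_in_span in auto)

text \<open>Linear independence of an indexed family, phrased as uniqueness of coefficient vectors:
  the form needed to evaluate \<open>coords\<close>, and one that passes directly to images under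
  injective linear maps.\<close>

definition frame :: "nat \<Rightarrow> (nat \<Rightarrow> 'v::real_vector) \<Rightarrow> bool"
  where "frame n b \<longleftrightarrow> inj_on (lin_comb n b) (carrier_vec n)"

lemma frameI:
  assumes "\<And>c. c \<in> carrier_vec n \<Longrightarrow> lin_comb n b c = 0 \<Longrightarrow> c = 0\<^sub>v n"
  shows "frame n b"
  unfolding frame_def
proof (rule inj_onI)
  fix c d :: "real Matrix.vec" assume c: "c \<in> carrier_vec n" and d: "d \<in> carrier_vec n" and eq: "lin_comb n b c = lin_comb n b d"
  have "lin_comb n b (c + (-1) \<cdot>\<^sub>v d) = 0"
    using c d eq by (simp add: lin_comb_add lin_comb_smult)
  hence z: "c + (-1) \<cdot>\<^sub>v d = 0\<^sub>v n" using assms c d by simp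
  show "c = d"
  proof
    show "dim_vec c = dim_vec d" using c d by simp
    fix i assume i: "i < dim_vec d"
    have "vec_index (c + (-1) \<cdot>\<^sub>v d) i = 0" using i d z by simp
    thus "vec_index c i = vec_index d i" using i c d by simp
  qed
qed

lemma is_basis_frame:
  assumes "is_basis n b V"
  shows "frame n b"
proof (rule frameI)
  fix c :: "real Matrix.vec" assume c: "c \<in> carrier_vec n" and z: "lin_comb n b c = 0"
  have inj: "inj_on b {..<n}" and ind: "independent (b ` {..<n})" using assms by (auto simp: is_basis_def)
  define u where "u v = vec_index c (the_inv_into {..<n} b v)" for v
  have "(\<Sum>v\<in>b ` {..<n}. u v *\<^sub>R v) = (\<Sum>l<n. vec_index c l *\<^sub>R b l)"
    unfolding sum.reindex[OF inj] by (intro sum.cong) (auto simp: u_def the_inv_into_f_f[OF inj])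
  hence *: "(\<Sum>v\<in>b ` {..<n}. u v *\<^sub>R v) = 0" using z by (simp add: lin_comb_def)
  have "vec_index c l = 0" if "l < n" for l
  proof -
    have "u (b l) = 0" using independentD[OF ind _ order_refl *] that by auto
    thus ?thesis using that by (simp add: u_def the_inv_into_f_f[OF inj])
  qed
  thus "c = 0\<^sub>v n" using c by (intro eq_vecI) auto
qed

lemma coords_lin_comb:
  assumes "frame n b" "c \<in> carrier_vec n"
  shows "coords n b (lin_comb n b c) = c"
  unfolding coords_def
  by (rule the_equality) (use assms in \<open>auto simp: frame_def inj_on_def\<close>)

lemma coords_carrier: "frame n b \<Longrightarrow> w \<in> span (b ` {..<n}) \<Longrightarrow> coords n b w \<in> carrier_vec n"
  and lin_comb_coords: "frame n b \<Longrightarrow> w \<in> span (b ` {..<n}) \<Longrightarrow> lin_comb n b (coords n b w) = w"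
  unfolding span_lin_comb by (auto simp: coords_lin_comb)

lemma lin_on_coords:
  assumes b: "frame n b" and x: "x \<in> span (b ` {..<n})" and y: "y \<in> span (b ` {..<n})"
  shows "coords n b (x + y) = coords n b x + coords n b y" "coords n b (r *\<^sub>R x) = r \<cdot>\<^sub>v coords n b x"
proof -
  obtain c d where c: "c \<in> carrier_vec n" "x = lin_comb n b c" and d: "d \<in> carrier_vec n" "y = lin_comb n b d"
    using x y unfolding span_lin_comb by auto
  have "x + y = lin_comb n b (c + d)" "r *\<^sub>R x = lin_comb n b (r \<cdot>\<^sub>v c)"
    using c d by (simp_all add: lin_comb_add lin_comb_smult)
  moreover have "c + d \<in> carrier_vec n" "r \<cdot>\<^sub>v c \<in> carrier_vec n" using c d by auto
  ultimately show "coords n b (x + y) = coords n b x + coords n b y" "coords n b (r *\<^sub>R x) = r \<cdot>\<^sub>v coords n b x"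
    using coords_lin_comb[OF b] c d by metis+
qed

lemma mat_op_in_span: "mat_op n b A w \<in> span (b ` {..<n})"
  unfolding mat_op_def by (rule lin_comb_in_span)

lemma lin_on_mat_op:
  assumes b: "frame n b" and A: "A \<in> carrier_mat n n"
  shows "lin_on (span (b ` {..<n})) (mat_op n b A)"
proof (rule lin_onI)
  fix x y assume xy: "x \<in> span (b ` {..<n})" "y \<in> span (b ` {..<n})"
  note c = coords_carrier[OF b xy(1)] coords_carrier[OF b xy(2)]
  show "mat_op n b A (x + y) = mat_op n b A x + mat_op n b A y"
    unfolding mat_op_def lin_on_coords(1)[OF b xy] mult_add_distrib_mat_vec[OF A c]
    using A c by (intro lin_comb_add) auto
next
  fix r x assume x: "x \<in> span (b ` {..<n})"
  note c = coords_carrier[OF b x]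
  show "mat_op n b A (r *\<^sub>R x) = r *\<^sub>R mat_op n b A x"
    unfolding mat_op_def lin_on_coords(2)[OF b x x] mult_mat_vec[OF A c]
    using A c by (intro lin_comb_smult) auto
qed

lemma mat_op_add:
  assumes b: "frame n b" and A: "A \<in> carrier_mat n n" and B: "B \<in> carrier_mat n n" and w: "w \<in> span (b ` {..<n})"
  shows "mat_op n b (A + B) w = mat_op n b A w + mat_op n b B w"
  unfolding mat_op_def add_mult_distrib_mat_vec[OF A B coords_carrier[OF b w]]
  using A B coords_carrier[OF b w] by (intro lin_comb_add) auto

lemma mat_op_one: "frame n b \<Longrightarrow> w \<in> span (b ` {..<n}) \<Longrightarrow> mat_op n b (1\<^sub>m n) w = w"
  unfolding mat_op_def using coords_carrier lin_comb_coords by fastforce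

lemma lin_on_lin_comb:
  assumes "lin_on (span (b ` {..<n})) f"
  shows "f (lin_comb n b c) = lin_comb n (\<lambda>l. f (b l)) c"
proof -
  have "f (\<Sum>l<n. vec_index c l *\<^sub>R b l) = (\<Sum>l<n. f (vec_index c l *\<^sub>R b l))"
    by (rule lin_on_sum[OF assms]) (auto intro: span_scale span_base)
  also have "\<dots> = (\<Sum>l<n. vec_index c l *\<^sub>R f (b l))"
    by (intro sum.cong refl lin_on_scale[OF assms]) (auto intro: span_base)
  finally show ?thesis by (simp add: lin_comb_def)
qed

section \<open>Transport of coordinates along injective linear maps\<close>

context
  fixes n :: nat and b :: "nat \<Rightarrow> 'v::real_vector" and f :: "'v \<Rightarrow> 'w::real_vector"
  assumes b: "frame n b" and f: "lin_on (span (b ` {..<n})) f" and inj: "inj_on f (span (b ` {..<n}))"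
begin

lemma frame_image: "frame n (\<lambda>l. f (b l))"
  unfolding frame_def
proof (rule inj_onI)
  fix c d assume cd: "c \<in> carrier_vec n" "d \<in> carrier_vec n" "lin_comb n (\<lambda>l. f (b l)) c = lin_comb n (\<lambda>l. f (b l)) d"
  hence "lin_comb n b c = lin_comb n b d"
    using inj_onD[OF inj] lin_comb_in_span by (metis lin_on_lin_comb[OF f])
  thus "c = d" using b cd by (auto simp: frame_def inj_on_def)
qed

text \<open>Linearity carries the expansion of \<open>p\<close> over to \<open>f p\<close>, and
  injectivity makes it the only one. On this rests the reduction of matrix operators and basis
  changes on pairs to multipliers.\<close>

lemma coords_image: "p \<in> span (b ` {..<n}) \<Longrightarrow> coords n (\<lambda>l. f (b l)) (f p) = coords n b p"
  using coords_lin_comb[OF frame_image coords_carrier[OF b]] lin_on_lin_comb[OF f] lin_comb_coords[OF b] by metis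

lemma mat_op_image: "p \<in> span (b ` {..<n}) \<Longrightarrow> mat_op n (\<lambda>l. f (b l)) A (f p) = f (mat_op n b A p)"
  by (simp add: mat_op_def coords_image lin_on_lin_comb[OF f])

lemma basis_change_image:
  assumes "lin_on (span (b ` {..<n})) g" "p \<in> span (b ` {..<n})"
  shows "basis_change n (\<lambda>l. f (b l)) (\<lambda>l. g (b l)) (f p) = g p"
  unfolding basis_change_def coords_image[OF assms(2)] lin_on_lin_comb[OF assms(1), symmetric]
  by (simp add: lin_comb_coords[OF b assms(2)])

end

lemma lin_comb_mat_op:
  assumes b: "frame n b" and A: "A \<in> carrier_mat n n" and c: "c \<in> carrier_vec n"
  shows "lin_comb n (\<lambda>l. mat_op n b A (b l)) c = lin_comb n b (A *\<^sub>v c)"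
  using lin_on_lin_comb[OF lin_on_mat_op[OF b A], of c, symmetric] coords_lin_comb[OF b c]
  by (simp add: mat_op_def)

text \<open>By \<open>lin_comb_mat_op\<close>, a combination of the transformed family with
  coefficients \<open>c\<close> is one of the old family with coefficients
  \<open>A *\<^sub>v c\<close>, and \<open>A\<close> is a bijection of the coefficient
  space.\<close>

lemma transformed_frame:
  assumes b: "frame n b" and A: "A \<in> carrier_mat n n" and inv: "invertible_mat A"
  shows "frame n (\<lambda>l. mat_op n b A (b l))"
    and "span ((\<lambda>l. mat_op n b A (b l)) ` {..<n}) = span (b ` {..<n})"
proof -
  obtain B where B: "A * B = 1\<^sub>m (dim_row A)" "B * A = 1\<^sub>m (dim_row B)"
    using inv by (auto simp: invertible_mat_def inverts_mat_def)
  \<comment> \<open>The shape of the inverse is not part of \<open>invertible_mat\<close>; it is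
    recovered by comparing the dimensions in the two product equations.\<close>
  have Bc: "B \<in> carrier_mat n n"
  proof -
    have "dim_col (A * B) = n" "dim_col (B * A) = dim_row B" using B A by simp_all
    thus ?thesis using A by (intro carrier_matI) auto
  qed
  have inv1: "B *\<^sub>v (A *\<^sub>v c) = c" and inv2: "A *\<^sub>v (B *\<^sub>v c) = c" if "c \<in> carrier_vec n" for c
    using that A Bc B by (simp_all flip: assoc_mult_mat_vec[of _ n n _ n])
  show "frame n (\<lambda>l. mat_op n b A (b l))"
    unfolding frame_def
  proof (rule inj_onI)
    fix c d assume c: "c \<in> carrier_vec n" and d: "d \<in> carrier_vec n"
      and "lin_comb n (\<lambda>l. mat_op n b A (b l)) c = lin_comb n (\<lambda>l. mat_op n b A (b l)) d"
    hence "A *\<^sub>v c = A *\<^sub>v d"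
      using b A lin_comb_mat_op[OF b A] mult_mat_vec_carrier by (auto simp: frame_def inj_on_def)
    thus "c = d" using inv1[OF c] inv1[OF d] by metis
  qed
  show "span ((\<lambda>l. mat_op n b A (b l)) ` {..<n}) = span (b ` {..<n})"
    unfolding span_lin_comb
  proof (intro equalityI subsetI)
    fix x assume "x \<in> lin_comb n b ` carrier_vec n"
    then obtain c where c: "c \<in> carrier_vec n" "x = lin_comb n b c" by auto
    thus "x \<in> lin_comb n (\<lambda>l. mat_op n b A (b l)) ` carrier_vec n"
      using inv2[OF c(1)] lin_comb_mat_op[OF b A, of "B *\<^sub>v c"] Bc
      by (intro image_eqI[of _ _ "B *\<^sub>v c"]) auto
  qed (use lin_comb_mat_op[OF b A] A in auto)
qed

lemma frame_span_Int:
  assumes b: "frame n b" and AB: "A \<subseteq> {..<n}" "B \<subseteq> {..<n}" "A \<inter> B = {}"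
    and x: "x \<in> span (b ` A)" and y: "y \<in> span (b ` B)" and z: "x + y = 0"
  shows "x = 0" "y = 0"
proof -
  have fin: "finite A" "finite B" using AB finite_subset by blast+
  obtain c where c: "x = (\<Sum>l\<in>A. c l *\<^sub>R b l)" using span_image_sums[OF fin(1) x] .
  obtain d where d: "y = (\<Sum>l\<in>B. d l *\<^sub>R b l)" using span_image_sums[OF fin(2) y] .
  define e where "e l = (if l \<in> A then c l else if l \<in> B then d l else 0)" for l
  have "(\<Sum>l<n. e l *\<^sub>R b l) = (\<Sum>l\<in>A \<union> B. e l *\<^sub>R b l)"
    by (rule sum.mono_neutral_right) (use AB in \<open>auto simp: e_def\<close>)
  also have "\<dots> = (\<Sum>l\<in>A. e l *\<^sub>R b l) + (\<Sum>l\<in>B. e l *\<^sub>R b l)"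
    by (rule sum.union_disjoint) (use fin AB in auto)
  also have "(\<Sum>l\<in>A. e l *\<^sub>R b l) = x" unfolding c by (intro sum.cong) (auto simp: e_def)
  also have "(\<Sum>l\<in>B. e l *\<^sub>R b l) = y" unfolding d using AB(3) by (intro sum.cong) (auto simp: e_def)
  finally have "lin_comb n b (Matrix.vec n e) = lin_comb n b (0\<^sub>v n)" using z by (simp add: lin_comb_vec)
  hence "Matrix.vec n e = 0\<^sub>v n" using b by (auto simp: frame_def inj_on_def)
  hence "e l = 0" if "l < n" for l using that by (metis index_vec index_zero_vec(1))
  hence "c l = 0" if "l \<in> A" for l using that AB(1) by (force simp: e_def)
  thus "x = 0" unfolding c by simp
  thus "y = 0" using z by simp
qed

text \<open>\<open>direct\<close> says that zero decomposes only trivially; together with the value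
  0 outside \<open>I\<close> this gives the definite description a unique solution. The projections
  of the method are evaluated by exhibiting a decomposition.\<close>

lemma dsum_proj_eq:
  fixes V :: "'i \<Rightarrow> 'v::real_vector set"
  assumes fin: "finite I" and sub: "\<And>j. j \<in> I \<Longrightarrow> subspace (V j)"
    and direct: "\<And>d j. (\<And>j. j \<in> I \<Longrightarrow> d j \<in> V j) \<Longrightarrow> (\<Sum>j\<in>I. d j) = 0 \<Longrightarrow> j \<in> I \<Longrightarrow> d j = 0"
    and d: "\<And>j. j \<in> I \<Longrightarrow> d j \<in> V j" and i: "i \<in> I"
  shows "dsum_proj I V i (\<Sum>j\<in>I. d j) = d i"
proof -
  have "(THE e. (\<forall>j\<in>I. e j \<in> V j) \<and> (\<forall>j. j \<notin> I \<longrightarrow> e j = 0) \<and> (\<Sum>j\<in>I. d j) = (\<Sum>j\<in>I. e j))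
    = (\<lambda>j. if j \<in> I then d j else 0)"
  proof (rule the_equality)
    show "(\<forall>j\<in>I. (if j \<in> I then d j else 0) \<in> V j) \<and> (\<forall>j. j \<notin> I \<longrightarrow> (if j \<in> I then d j else 0) = 0) \<and>
      (\<Sum>j\<in>I. d j) = (\<Sum>j\<in>I. if j \<in> I then d j else 0)"
      using d by auto
  next
    fix e assume e: "(\<forall>j\<in>I. e j \<in> V j) \<and> (\<forall>j. j \<notin> I \<longrightarrow> e j = 0) \<and> (\<Sum>j\<in>I. d j) = (\<Sum>j\<in>I. e j)"
    have "e j - d j = 0" if "j \<in> I" for j
    proof (rule direct[of "\<lambda>j. e j - d j"])
      show "e j - d j \<in> V j" if "j \<in> I" for j
        using subspace_diff[OF sub[OF that]] e d that by blast
    qed (use e that in \<open>auto simp: sum_subtractf\<close>)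
    thus "e = (\<lambda>j. if j \<in> I then d j else 0)" using e by auto
  qed
  thus ?thesis using i by (simp add: dsum_proj_def)
qed

section \<open>The spectrum of an averaging operator\<close>

lemma finite_dim_frame:
  fixes V :: "'v::real_vector set"
  assumes "subspace V" "finite B" "V \<subseteq> span B"
  obtains n b where "frame n b" "span (b ` {..<n}) = V"
proof -
  obtain C where C: "C \<subseteq> V" "independent C" "V \<subseteq> span C"
    using basis_exists[of V] by metis
  have "finite C" using C assms by (meson independent_span_bound subset_trans)
  then obtain b where b: "bij_betw b {0..<card C} C" using ex_bij_betw_nat_finite by blast
  hence im: "b ` {..<card C} = C" by (auto simp: bij_betw_def atLeast0LessThan)
  have sp: "span C = V" using C assms(1) span_minimal by blast
  have "is_basis (card C) b V"
    using b C sp im by (auto simp: is_basis_def bij_betw_def atLeast0LessThan)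
  hence "frame (card C) b" by (rule is_basis_frame)
  thus thesis using that im sp by metis
qed

text \<open>A complex eigenvector of the matrix of \<open>G\<close> has as real and imaginary parts vectors of \<open>V\<close>, and
  self-adjointness forces the eigenvalue to be real.\<close>
lemma selfadjoint_eigenvalues:
  fixes V :: "'v::real_vector set"
  assumes V: "subspace V" "finite B" "V \<subseteq> span B" and nz: "w0 \<in> V" "w0 \<noteq> 0"
    and G: "lin_on V G" "\<And>x. x \<in> V \<Longrightarrow> G x \<in> V"
    and s: "spd_on V s" and sa: "\<And>x y. x \<in> V \<Longrightarrow> y \<in> V \<Longrightarrow> s (G x) y = s x (G y)"
  shows "finite (eigenvalues_on V G)" "eigenvalues_on V G \<noteq> {}"
proof -
  obtain n b where b: "frame n b" and sp: "span (b ` {..<n}) = V" using finite_dim_frame[OF V] .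
  have np: "n > 0"
  proof (rule ccontr)
    assume "\<not> 0 < n"
    hence "V = {0}" using sp by simp
    thus False using nz by auto
  qed
  define A where "A = Matrix.mat n n (\<lambda>(i, j). vec_index (coords n b (G (b j))) i)"
  have A: "A \<in> carrier_mat n n" by (simp add: A_def)
  have bV: "b l \<in> V" if "l < n" for l using that sp by (auto intro: span_base)
  have cV: "lin_comb n b c \<in> V" for c using lin_comb_in_span sp by blast
  have GA: "G (lin_comb n b c) = lin_comb n b (A *\<^sub>v c)" if c: "c \<in> carrier_vec n" for c
  proof -
    have "G (lin_comb n b c) = (\<Sum>l<n. vec_index c l *\<^sub>R G (b l))"
      using lin_on_lin_comb[of b n G c] G(1) sp by (simp add: lin_comb_def)
    also have "\<dots> = (\<Sum>l<n. vec_index c l *\<^sub>R (\<Sum>i<n. vec_index (coords n b (G (b l))) i *\<^sub>R b i))"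
      by (intro sum.cong refl arg_cong2[of _ _ _ _ scaleR])
        (use lin_comb_coords[OF b] G(2) bV sp in \<open>auto simp: lin_comb_def\<close>)
    also have "\<dots> = (\<Sum>l<n. \<Sum>i<n. (A $$ (i, l) * vec_index c l) *\<^sub>R b i)"
      by (simp add: scaleR_sum_right A_def mult.commute)
    also have "\<dots> = (\<Sum>i<n. \<Sum>l<n. (A $$ (i, l) * vec_index c l) *\<^sub>R b i)" by (rule sum.swap)
    also have "\<dots> = (\<Sum>i<n. vec_index (A *\<^sub>v c) i *\<^sub>R b i)"
      using A c by (intro sum.cong refl) (simp add: scalar_prod_def atLeast0LessThan flip: scaleR_sum_left)
    finally show ?thesis by (simp add: lin_comb_def)
  qed
  \<comment> \<open>In coordinates an eigenvector of \<open>G\<close> is one of \<open>A\<close>, so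
    the eigenvalues are among the finitely many roots of a nonzero polynomial.\<close>
  have "eigenvalues_on V G \<subseteq> {x. poly (char_poly A) x = 0}"
  proof
    fix x assume "x \<in> eigenvalues_on V G"
    then obtain w where w: "w \<in> V" "w \<noteq> 0" "G w = x *\<^sub>R w" by (auto simp: eigenvalues_on_def)
    obtain c where c: "c \<in> carrier_vec n" "w = lin_comb n b c" using w(1) unfolding sp[symmetric] span_lin_comb by auto
    have "lin_comb n b (A *\<^sub>v c) = lin_comb n b (x \<cdot>\<^sub>v c)"
      using GA[OF c(1)] w(3) c by (simp add: lin_comb_smult)
    hence "A *\<^sub>v c = x \<cdot>\<^sub>v c" using b A c by (auto simp: frame_def inj_on_def)
    moreover have "c \<noteq> 0\<^sub>v n" using w(2) c(2) by auto
    ultimately have "eigenvalue A x" using A c(1) by (auto simp: eigenvalue_def eigenvector_def)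
    thus "x \<in> {x. poly (char_poly A) x = 0}" using eigenvalue_root_char_poly[OF A] by simp
  qed
  moreover have "char_poly A \<noteq> 0" using degree_monic_char_poly[OF A] np by auto
  ultimately show "finite (eigenvalues_on V G)" using poly_roots_finite finite_subset by blast
  define AC where "AC = map_mat complex_of_real A"
  have AC: "AC \<in> carrier_mat n n" using A by (simp add: AC_def)
  have "degree (char_poly AC) \<noteq> 0" using degree_monic_char_poly[OF AC] np by simp
  hence "\<not> constant (poly (char_poly AC))" by (simp add: constant_degree)
  then obtain z where "poly (char_poly AC) z = 0" using fundamental_theorem_of_algebra by blast
  hence "eigenvalue AC z" using eigenvalue_root_char_poly[OF AC] by simp
  then obtain v where v: "v \<in> carrier_vec n" "v \<noteq> 0\<^sub>v n" "AC *\<^sub>v v = z \<cdot>\<^sub>v v"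
    using AC by (auto simp: eigenvalue_def eigenvector_def)
  define x y where "x = map_vec Re v" and "y = map_vec Im v"
  have x: "x \<in> carrier_vec n" and y: "y \<in> carrier_vec n" using v by (auto simp: x_def y_def)
  have comp: "(\<Sum>l<n. complex_of_real (A $$ (i, l)) * vec_index v l) = z * vec_index v i" if "i < n" for i
  proof -
    have "vec_index (AC *\<^sub>v v) i = vec_index (z \<cdot>\<^sub>v v) i" using v(3) by simp
    thus ?thesis using that A v(1) by (simp add: AC_def scalar_prod_def atLeast0LessThan)
  qed
  have "A *\<^sub>v x = Re z \<cdot>\<^sub>v x + (- Im z) \<cdot>\<^sub>v y"
  proof (rule eq_vecI)
    fix i assume "i < dim_vec (Re z \<cdot>\<^sub>v x + (- Im z) \<cdot>\<^sub>v y)"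
    hence i: "i < n" using x y by simp
    have "(\<Sum>l<n. A $$ (i, l) * Re (vec_index v l)) = Re (z * vec_index v i)"
      unfolding comp[OF i, symmetric] by (simp add: Re_sum)
    thus "vec_index (A *\<^sub>v x) i = vec_index (Re z \<cdot>\<^sub>v x + (- Im z) \<cdot>\<^sub>v y) i"
      using i A v(1) by (simp add: x_def y_def scalar_prod_def atLeast0LessThan)
  qed (use A x y in auto)
  hence GX: "G (lin_comb n b x) = Re z *\<^sub>R lin_comb n b x + (- Im z) *\<^sub>R lin_comb n b y"
    using GA[OF x] x y by (simp add: lin_comb_add lin_comb_smult)
  have "A *\<^sub>v y = Im z \<cdot>\<^sub>v x + Re z \<cdot>\<^sub>v y"
  proof (rule eq_vecI)
    fix i assume "i < dim_vec (Im z \<cdot>\<^sub>v x + Re z \<cdot>\<^sub>v y)"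
    hence i: "i < n" using x y by simp
    have "(\<Sum>l<n. A $$ (i, l) * Im (vec_index v l)) = Im (z * vec_index v i)"
      unfolding comp[OF i, symmetric] by (simp add: Im_sum)
    thus "vec_index (A *\<^sub>v y) i = vec_index (Im z \<cdot>\<^sub>v x + Re z \<cdot>\<^sub>v y) i"
      using i A v(1) by (simp add: x_def y_def scalar_prod_def atLeast0LessThan)
  qed (use A x y in auto)
  hence GY: "G (lin_comb n b y) = Im z *\<^sub>R lin_comb n b x + Re z *\<^sub>R lin_comb n b y"
    using GA[OF y] x y by (simp add: lin_comb_add lin_comb_smult)
  define X Y where "X = lin_comb n b x" and "Y = lin_comb n b y"
  have XY: "X \<in> V" "Y \<in> V" using cV by (auto simp: X_def Y_def)
  have "x \<noteq> 0\<^sub>v n \<or> y \<noteq> 0\<^sub>v n"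
  proof (rule ccontr)
    assume "\<not> ?thesis"
    hence "Re (vec_index v i) = 0 \<and> Im (vec_index v i) = 0" if "i < n" for i
      using that v(1) unfolding x_def y_def by (metis carrier_vecD index_map_vec(1) index_zero_vec(1))
    hence "v = 0\<^sub>v n" using v(1) by (intro eq_vecI) (auto simp: complex_eq_iff)
    thus False using v(2) by simp
  qed
  hence nzXY: "X \<noteq> 0 \<or> Y \<noteq> 0"
    using b x y unfolding X_def Y_def frame_def by (metis inj_onD lin_comb_zero zero_carrier_vec)
  have scV: "r *\<^sub>R X \<in> V" "r *\<^sub>R Y \<in> V" for r using XY V(1) subspace_scale by blast+
  have sGX: "s (G X) Y = Re z * s X Y - Im z * s Y Y"
    using GX lin_on_add[OF spd_on_lin[OF s XY(2)] scV(1)[of "Re z"] scV(2)[of "- Im z"]]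
      lin_on_scale[OF spd_on_lin[OF s XY(2)], of X "Re z"] lin_on_scale[OF spd_on_lin[OF s XY(2)], of Y "- Im z"]
      XY unfolding X_def[symmetric] Y_def[symmetric] by simp
  have sGY: "s X (G Y) = Im z * s X X + Re z * s X Y"
    using GY lin_on_add[OF spd_on_lin_right[OF s V(1) XY(1)] scV(1)[of "Im z"] scV(2)[of "Re z"]]
      lin_on_scale[OF spd_on_lin_right[OF s V(1) XY(1)], of X "Im z"]
      lin_on_scale[OF spd_on_lin_right[OF s V(1) XY(1)], of Y "Re z"]
      XY unfolding X_def[symmetric] Y_def[symmetric] by simp
  \<comment> \<open>The terms with \<open>Re z\<close> agree on both sides of the symmetry relation
    and cancel.\<close>
  have "Im z * (s X X + s Y Y) = 0"
    using sa[OF XY] sGX sGY by (simp add: algebra_simps)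
  moreover have "s X X + s Y Y > 0"
    using nzXY spd_on_pos[OF s] spd_on_nonneg[OF s V(1)] XY by (meson add_nonneg_pos add_pos_nonneg)
  ultimately have im: "Im z = 0" by simp
  have "G X = Re z *\<^sub>R X" "G Y = Re z *\<^sub>R Y"
    using GX GY im unfolding X_def[symmetric] Y_def[symmetric] by simp_all
  hence "Re z \<in> eigenvalues_on V G" using nzXY XY by (auto simp: eigenvalues_on_def)
  thus "eigenvalues_on V G \<noteq> {}" by blast
qed

text \<open>For an eigenpair \<open>G w = c w\<close> and \<open>y = Y w\<close> one has \<open>a y (J w) = a (J w) (J w)\<close> and
  \<open>a y y = c * a (J w) (J w)\<close>.  Hence \<open>0 \<le> a (y - J w) (y - J w)\<close> gives \<open>1 \<le> c\<close>, and the bound on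
  \<open>J \<circ> E\<close> at \<open>y\<close>, where \<open>J (E y) = c J w\<close>, gives \<open>c\<^sup>2 \<le> K * c\<close>.\<close>
lemma averaging_spectrum:
  fixes V :: "'v::real_vector set" and U :: "'u::real_vector set"
  assumes V: "subspace V" "finite B" "V \<subseteq> span B" and nz: "w0 \<in> V" "w0 \<noteq> 0"
    and U: "subspace U" and a: "spd_on U a"
    and J: "lin_on V J" "\<And>w. w \<in> V \<Longrightarrow> J w \<in> U"
    and E: "lin_on U E" "\<And>u. u \<in> U \<Longrightarrow> E u \<in> V" "\<And>w. w \<in> V \<Longrightarrow> E (J w) = w"
    and Y: "\<And>w. w \<in> V \<Longrightarrow> Y w \<in> U" "\<And>w u. w \<in> V \<Longrightarrow> u \<in> U \<Longrightarrow> a (Y w) u = a (J w) (J (E u))"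
    and K: "\<And>u. u \<in> U \<Longrightarrow> a (J (E u)) (J (E u)) \<le> K * a u u"
    and G: "\<And>w. w \<in> V \<Longrightarrow> G w = E (Y w)"
  shows "Max (eigenvalues_on V G) / Min (eigenvalues_on V G) \<le> K"
proof -
  \<comment> \<open>The inner product in which \<open>G\<close> is self-adjoint. For
    \<open>J = I_Gamma\<close> and \<open>a = A_tilde\<close> it is the one induced by
    \<open>S_hat\<close>.\<close>
  define s where "s x y = a (J x) (J y)" for x y
  have J0: "w = 0" if "w \<in> V" "J w = 0" for w
    using E(3)[OF that(1)] that(2) lin_on_zero[OF E(1) U] by simp
  have s: "spd_on V s"
  proof (rule spd_onI)
    fix x y assume "x \<in> V" "y \<in> V"
    thus "s x y = s y x" unfolding s_def using spd_on_sym[OF a] J(2) by blast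
  next
    fix x y z assume "x \<in> V" "y \<in> V" "z \<in> V"
    thus "s (x + y) z = s x z + s y z" unfolding s_def
      using lin_on_add[OF J(1)] lin_on_add[OF spd_on_lin[OF a]] J(2) by simp
  next
    fix c x y assume "x \<in> V" "y \<in> V"
    thus "s (c *\<^sub>R x) y = c * s x y" unfolding s_def
      using lin_on_scale[OF J(1)] lin_on_scale[OF spd_on_lin[OF a]] J(2) by simp
  next
    fix x assume "x \<in> V" "x \<noteq> 0"
    thus "0 < s x x" unfolding s_def using spd_on_pos[OF a] J(2) J0 by blast
  qed
  have JE: "J (E u) \<in> U" if "u \<in> U" for u using J(2) E(2) that by blast
  \<comment> \<open>\<open>Y\<close> is known only through its energy products with
    \<open>U\<close>, and by definiteness these determine it.\<close>
  have Ylin: "lin_on V Y"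
  proof (rule lin_onI)
    fix x y assume xy: "x \<in> V" "y \<in> V"
    show "Y (x + y) = Y x + Y y"
    proof (rule spd_on_unique[OF a U])
      show "Y (x + y) \<in> U" "Y x + Y y \<in> U" using xy Y(1) V(1) U subspace_add by metis+
      fix v assume v: "v \<in> U"
      show "a (Y (x + y)) v = a (Y x + Y y) v"
        using Y(2)[OF _ v] xy subspace_add[OF V(1) xy] lin_on_add[OF J(1) xy]
          lin_on_add[OF spd_on_lin[OF a JE[OF v]]] lin_on_add[OF spd_on_lin[OF a v]] J(2) Y(1) by simp
    qed
  next
    fix c x assume x: "x \<in> V"
    show "Y (c *\<^sub>R x) = c *\<^sub>R Y x"
    proof (rule spd_on_unique[OF a U])
      show "Y (c *\<^sub>R x) \<in> U" "c *\<^sub>R Y x \<in> U" using x Y(1) V(1) U subspace_scale by metis+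
      fix v assume v: "v \<in> U"
      show "a (Y (c *\<^sub>R x)) v = a (c *\<^sub>R Y x) v"
        using Y(2)[OF _ v] x subspace_scale[OF V(1) x] lin_on_scale[OF J(1) x]
          lin_on_scale[OF spd_on_lin[OF a JE[OF v]]] lin_on_scale[OF spd_on_lin[OF a v]] J(2) Y(1) by simp
    qed
  qed
  have GV: "G x \<in> V" if "x \<in> V" for x using G[OF that] E(2) Y(1) that by simp
  have Glin: "lin_on V G"
  proof (rule lin_onI)
    fix x y assume xy: "x \<in> V" "y \<in> V"
    thus "G (x + y) = G x + G y"
      using G subspace_add[OF V(1) xy] lin_on_add[OF Ylin xy] lin_on_add[OF E(1)] Y(1) by simp
  next
    fix c x assume x: "x \<in> V"
    thus "G (c *\<^sub>R x) = c *\<^sub>R G x"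
      using G subspace_scale[OF V(1) x] lin_on_scale[OF Ylin x] lin_on_scale[OF E(1)] Y(1) by simp
  qed
  have sa: "s (G x) y = s x (G y)" if "x \<in> V" "y \<in> V" for x y
  proof -
    have "s (G x) y = a (J y) (J (E (Y x)))"
      unfolding s_def using G that spd_on_sym[OF a] J(2) JE Y(1) by simp
    also have "\<dots> = a (Y y) (Y x)" using Y that by simp
    also have "\<dots> = a (Y x) (Y y)" using spd_on_sym[OF a] Y(1) that by simp
    also have "\<dots> = s x (G y)" unfolding s_def using G Y that by simp
    finally show ?thesis .
  qed
  note ev = selfadjoint_eigenvalues[OF V nz Glin GV s sa]
  have bnd: "1 \<le> c \<and> c \<le> K" if c: "c \<in> eigenvalues_on V G" for c
  proof -
    obtain w where w: "w \<in> V" "w \<noteq> 0" "G w = c *\<^sub>R w" using c by (auto simp: eigenvalues_on_def)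
    let ?y = "Y w" and ?u = "J w"
    have yU: "?y \<in> U" and uU: "?u \<in> U" using w Y(1) J(2) by auto
    have EY: "E ?y = c *\<^sub>R w" using G w by simp
    have pos: "0 < a ?u ?u" using spd_on_pos[OF a uU] J0 w by blast
    have yu: "a ?y ?u = a ?u ?u" using Y(2)[OF w(1) uU] E(3)[OF w(1)] by simp
    have JEy: "J (E ?y) = c *\<^sub>R ?u" using EY lin_on_scale[OF J(1) w(1)] by simp
    have yy: "a ?y ?y = c * a ?u ?u"
      using Y(2)[OF w(1) yU] JEy lin_on_scale[OF spd_on_lin_right[OF a U uU] uU] by simp
    have d: "?y - ?u \<in> U" using yU uU U subspace_diff by blast
    have "0 \<le> a (?y - ?u) (?y - ?u)" using spd_on_nonneg[OF a U d] .
    also have "\<dots> = a ?y (?y - ?u) - a ?u (?y - ?u)"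
      using lin_on_diff[OF spd_on_lin[OF a d] U yU uU] .
    also have "\<dots> = (a ?y ?y - a ?y ?u) - (a ?u ?y - a ?u ?u)"
      using lin_on_diff[OF spd_on_lin_right[OF a U yU] U yU uU]
        lin_on_diff[OF spd_on_lin_right[OF a U uU] U yU uU] by simp
    also have "\<dots> = (c - 1) * a ?u ?u"
      using yy yu spd_on_sym[OF a yU uU] by (simp add: algebra_simps)
    finally have c1: "1 \<le> c" using pos by (simp add: zero_le_mult_iff)
    have "c * (c * a ?u ?u) \<le> K * (c * a ?u ?u)"
      using K[OF yU] yy JEy lin_on_scale[OF spd_on_lin_right[OF a U uU] uU]
        lin_on_scale[OF spd_on_lin[OF a, of "c *\<^sub>R ?u"] uU] subspace_scale[OF U uU] by simp
    moreover have "0 < c * a ?u ?u" using c1 pos by simp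
    ultimately have "c \<le> K" by (rule mult_right_le_imp_le)
    thus ?thesis using c1 by simp
  qed
  have "Max (eigenvalues_on V G) \<in> eigenvalues_on V G" "Min (eigenvalues_on V G) \<in> eigenvalues_on V G"
    using ev by auto
  hence "1 \<le> Max (eigenvalues_on V G)" "Max (eigenvalues_on V G) \<le> K" "1 \<le> Min (eigenvalues_on V G)"
    using bnd by blast+
  thus ?thesis by (smt (verit) divide_le_eq_1 frac_le div_by_1)
qed

section \<open>Finite-dimensional subspaces\<close>

lemma lin_comb_cong: "(\<And>l. l < n \<Longrightarrow> b l = b' l) \<Longrightarrow> lin_comb n b = lin_comb n b'"
  by (auto simp: lin_comb_def fun_eq_iff)

lemma mat_op_cong: "(\<And>l. l < n \<Longrightarrow> b l = b' l) \<Longrightarrow> mat_op n b = mat_op n b'"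
  using lin_comb_cong[of n b b'] by (auto simp: mat_op_def coords_def fun_eq_iff)

lemma basis_change_cong:
  "(\<And>l. l < n \<Longrightarrow> b l = b' l) \<Longrightarrow> (\<And>l. l < n \<Longrightarrow> d l = d' l) \<Longrightarrow> basis_change n b d = basis_change n b' d'"
  using lin_comb_cong[of n b b'] lin_comb_cong[of n d d'] by (auto simp: basis_change_def coords_def fun_eq_iff)

lemma span_image_lin_on:
  assumes f: "lin_on V f" and V: "subspace V" and A: "finite A" "b ` A \<subseteq> V"
  shows "span ((\<lambda>l. f (b l)) ` A) = f ` span (b ` A)"
proof -
  have fs: "f (\<Sum>l\<in>A. c l *\<^sub>R b l) = (\<Sum>l\<in>A. c l *\<^sub>R f (b l))" for c
  proof -
    have "f (\<Sum>l\<in>A. c l *\<^sub>R b l) = (\<Sum>l\<in>A. f (c l *\<^sub>R b l))"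
      by (rule lin_on_sum[OF f V]) (use A subspace_scale[OF V] in auto)
    also have "\<dots> = (\<Sum>l\<in>A. c l *\<^sub>R f (b l))"
      by (intro sum.cong refl lin_on_scale[OF f]) (use A in auto)
    finally show ?thesis .
  qed
  show ?thesis
  proof (intro equalityI subsetI)
    fix x assume "x \<in> span ((\<lambda>l. f (b l)) ` A)"
    then obtain c where "x = (\<Sum>l\<in>A. c l *\<^sub>R f (b l))" by (rule span_image_sums[OF A(1)])
    hence "x = f (\<Sum>l\<in>A. c l *\<^sub>R b l)" using fs by simp
    moreover have "(\<Sum>l\<in>A. c l *\<^sub>R b l) \<in> span (b ` A)" by (intro span_sum span_scale span_base) auto
    ultimately show "x \<in> f ` span (b ` A)" by blast
  next
    fix x assume "x \<in> f ` span (b ` A)"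
    then obtain y where y: "y \<in> span (b ` A)" "x = f y" by auto
    obtain c where "y = (\<Sum>l\<in>A. c l *\<^sub>R b l)" by (rule span_image_sums[OF A(1) y(1)])
    hence "x = (\<Sum>l\<in>A. c l *\<^sub>R f (b l))" using fs y(2) by simp
    also have "\<dots> \<in> span ((\<lambda>l. f (b l)) ` A)" by (intro span_sum span_scale span_base) auto
    finally show "x \<in> span ((\<lambda>l. f (b l)) ` A)" .
  qed
qed

definition fin_dim :: "'v::real_vector set \<Rightarrow> bool"
  where "fin_dim V \<longleftrightarrow> (\<exists>B. finite B \<and> V \<subseteq> span B)"

lemma fin_dim_span: "finite B \<Longrightarrow> fin_dim (span B)"
  by (auto simp: fin_dim_def)

lemma fin_dim_set_plus:
  assumes "fin_dim V" "fin_dim U"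
  shows "fin_dim (V + U)"
proof -
  obtain B C where B: "finite B" "V \<subseteq> span B" and C: "finite C" "U \<subseteq> span C"
    using assms by (auto simp: fin_dim_def)
  have "V + U \<subseteq> span (B \<union> C)"
  proof
    fix x assume "x \<in> V + U"
    then obtain v u where "x = v + u" "v \<in> V" "u \<in> U" by (rule set_plus_elim)
    thus "x \<in> span (B \<union> C)" using B(2) C(2) span_mono[of B "B \<union> C"] span_mono[of C "B \<union> C"]
      by (auto intro!: span_add)
  qed
  thus ?thesis using B C unfolding fin_dim_def by blast
qed

lemma fin_dim_set_sum:
  fixes V :: "'i \<Rightarrow> 'v::real_vector set"
  assumes "\<And>i. i \<in> I \<Longrightarrow> fin_dim (V i)"
  shows "fin_dim (\<Sum>i\<in>I. V i)"
  using assms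
proof (induction I rule: infinite_finite_induct)
  case (insert x F)
  thus ?case by (simp add: fin_dim_set_plus)
qed (auto simp: set_zero fin_dim_def)

lemma riesz_subspace:
  assumes "fin_dim V" "subspace V" "spd_on V a" "lin_on V f"
  shows "\<exists>x\<in>V. \<forall>v\<in>V. a x v = (f v :: real)"
proof -
  obtain B where "finite B" "V \<subseteq> span B" using assms(1) by (auto simp: fin_dim_def)
  then obtain n b where "span (b ` {..<n :: nat}) = V" using finite_dim_frame[OF assms(2)] by metis
  thus ?thesis using riesz[of "b ` {..<n}" a f] assms by auto
qed

lemma spd_on_combination:
  assumes a: "spd_on V a" "subspace V" and x: "x \<in> V" "y \<in> V"
  shows "a (x - y) (x - y) = a x x + a y y - 2 * a x y" "a (x + y) (x + y) = a x x + a y y + 2 * a x y"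
proof -
  have d: "x - y \<in> V" "x + y \<in> V" using assms subspace_diff subspace_add by blast+
  have "a (x - y) (x - y) = a x (x - y) - a y (x - y)"
    using lin_on_diff[OF spd_on_lin[OF a(1) d(1)] a(2) x] .
  thus "a (x - y) (x - y) = a x x + a y y - 2 * a x y"
    using lin_on_diff[OF spd_on_lin_right[OF a x(1)] a(2) x] lin_on_diff[OF spd_on_lin_right[OF a x(2)] a(2) x]
      spd_on_sym[OF a(1) x] by simp
  have "a (x + y) (x + y) = a x (x + y) + a y (x + y)"
    using lin_on_add[OF spd_on_lin[OF a(1) d(2)] x] .
  thus "a (x + y) (x + y) = a x x + a y y + 2 * a x y"
    using lin_on_add[OF spd_on_lin_right[OF a x(1)] x] lin_on_add[OF spd_on_lin_right[OF a x(2)] x]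
      spd_on_sym[OF a(1) x] by simp
qed

lemma spd_on_diff_bound:
  assumes a: "spd_on V a" "subspace V" and x: "x \<in> V" "y \<in> V"
  shows "a (x - y) (x - y) \<le> 2 * a x x + 2 * a y y"
proof -
  have "0 \<le> a (x + y) (x + y)" using spd_on_nonneg[OF a] subspace_add[OF a(2) x] by blast
  thus ?thesis using spd_on_combination[OF a x] by linarith
qed

text \<open>The discrete Cauchy-Schwarz inequality: each mixed product is at most the mean of the
  two energies, and each energy is met \<open>card A\<close> times.\<close>

lemma spd_on_sum_bound:
  assumes a: "spd_on V a" "subspace V" and x: "\<And>k. k \<in> A \<Longrightarrow> x k \<in> V"
  shows "a (\<Sum>k\<in>A. x k) (\<Sum>k\<in>A. x k) \<le> real (card A) * (\<Sum>k\<in>A. a (x k) (x k))"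
proof -
  have sV: "(\<Sum>k\<in>A. x k) \<in> V" by (rule subspace_sum[OF a(2) x])
  have "a (\<Sum>k\<in>A. x k) (\<Sum>k\<in>A. x k) = (\<Sum>j\<in>A. a (x j) (\<Sum>k\<in>A. x k))"
    by (rule lin_on_sum[OF spd_on_lin[OF a(1) sV] a(2) x])
  also have "\<dots> = (\<Sum>j\<in>A. \<Sum>k\<in>A. a (x j) (x k))"
    by (intro sum.cong refl lin_on_sum[OF spd_on_lin_right[OF a x] a(2) x])
  also have "\<dots> \<le> (\<Sum>j\<in>A. \<Sum>k\<in>A. a (x j) (x j) / 2 + a (x k) (x k) / 2)"
  proof (intro sum_mono)
    fix j k assume jk: "j \<in> A" "k \<in> A"
    have "0 \<le> a (x j - x k) (x j - x k)"
      using spd_on_nonneg[OF a] subspace_diff[OF a(2) x[OF jk(1)] x[OF jk(2)]] by blast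
    thus "a (x j) (x k) \<le> a (x j) (x j) / 2 + a (x k) (x k) / 2"
      using spd_on_combination(1)[OF a x[OF jk(1)] x[OF jk(2)]] by linarith
  qed
  also have "\<dots> = real (card A) * (\<Sum>k\<in>A. a (x k) (x k))"
    by (simp add: sum.distrib sum_divide_distrib[symmetric] sum_distrib_left[symmetric])
  finally show ?thesis .
qed

declare One_nat_def [simp del]

context mortar_discretization
begin

lemma fin_dim_X: "i \<in> {1..N} \<Longrightarrow> fin_dim (X i)"
  using X_finite_dim fin_dim_def by metis

lemma spd_a_form: "i \<in> {1..N} \<Longrightarrow> spd_on (X i) (a_form i)"
  by (intro spd_onI a_form_sym a_form_add a_form_scale a_form_pos)

lemma lin_on_b_form_left: "i \<in> {1..N} \<Longrightarrow> p \<in> Lambda \<Longrightarrow> lin_on (X i) (\<lambda>v. b_form i v p)"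
proof (rule lin_onI)
  assume i: "i \<in> {1..N}" and p: "p \<in> Lambda"
  note bb = Lambda_bounded_borel[OF p] Lambda_bounded_borel[OF p]
  show "b_form i (u + v) p = b_form i u p + b_form i v p" if "u \<in> X i" "v \<in> X i" for u v
    using b_form_linear(1)[OF i that bb] .
  show "b_form i (c *\<^sub>R u) p = c *\<^sub>R b_form i u p" if "u \<in> X i" for c u
    using b_form_linear(2)[OF i that that bb] by simp
qed

lemma lin_on_b_form_right: "i \<in> {1..N} \<Longrightarrow> u \<in> X i \<Longrightarrow> lin_on Lambda (b_form i u)"
proof (rule lin_onI)
  assume i: "i \<in> {1..N}" and u: "u \<in> X i"
  show "b_form i u (p + q) = b_form i u p + b_form i u q" if "p \<in> Lambda" "q \<in> Lambda" for p q
    using b_form_linear(3)[OF i u u] Lambda_bounded_borel that by blast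
  show "b_form i u (c *\<^sub>R p) = c *\<^sub>R b_form i u p" if "p \<in> Lambda" for c p
    using b_form_linear(4)[OF i u u] Lambda_bounded_borel[OF that] by simp
qed

section \<open>Discrete harmonic extension\<close>

text \<open>The subdomain unknown eliminated: the solution of the local Neumann problem with the
  multiplier as flux. The minus sign is what orthogonality of the pair \<open>(u, p)\<close> to
  \<open>V_I_loc i\<close> under \<open>A_loc i\<close> demands.\<close>

definition ext :: "nat \<Rightarrow> (plane \<Rightarrow> real) \<Rightarrow> plane \<Rightarrow> real"
  where "ext i p = (THE u. u \<in> X i \<and> (\<forall>v\<in>X i. a_form i u v = - b_form i v p))"

lemma ext_unique:
  assumes i: "i \<in> {1..N}" and p: "p \<in> Lambda" and u: "u \<in> X i" "\<And>v. v \<in> X i \<Longrightarrow> a_form i u v = - b_form i v p"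
  shows "ext i p = u"
  unfolding ext_def
  by (rule the_equality) (use u spd_on_unique[OF spd_a_form[OF i] subspace_X] in auto)

lemma ext_harmonic:
  assumes i: "i \<in> {1..N}" and p: "p \<in> Lambda"
  shows "ext i p \<in> X i" "v \<in> X i \<Longrightarrow> a_form i (ext i p) v = - b_form i v p"
proof -
  have "lin_on (X i) (\<lambda>v. - b_form i v p)"
    using lin_on_b_form_left[OF i p] by (auto simp: lin_on_def)
  then obtain u where u: "u \<in> X i" "\<forall>v\<in>X i. a_form i u v = - b_form i v p"
    using riesz_subspace[OF fin_dim_X[OF i] subspace_X spd_a_form[OF i]] by blast
  hence "ext i p = u" using ext_unique[OF i p] by blast
  thus "ext i p \<in> X i" "v \<in> X i \<Longrightarrow> a_form i (ext i p) v = - b_form i v p" using u by auto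
qed

lemma lin_on_ext: "i \<in> {1..N} \<Longrightarrow> lin_on Lambda (ext i)"
proof (rule lin_onI)
  fix p q assume i: "i \<in> {1..N}" and pq: "p \<in> Lambda" "q \<in> Lambda"
  show "ext i (p + q) = ext i p + ext i q"
  proof (rule ext_unique[OF i])
    show "p + q \<in> Lambda" using subspace_add[OF subspace_Lambda pq] .
    show "ext i p + ext i q \<in> X i" using subspace_add[OF subspace_X] ext_harmonic(1)[OF i] pq by blast
    show "a_form i (ext i p + ext i q) v = - b_form i v (p + q)" if "v \<in> X i" for v
      using a_form_add[OF i ext_harmonic(1)[OF i pq(1)] ext_harmonic(1)[OF i pq(2)] that] ext_harmonic(2)[OF i _ that] pq
        lin_on_add[OF lin_on_b_form_right[OF i that] pq] by simp
  qed
next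
  fix c p assume i: "i \<in> {1..N}" and p: "p \<in> Lambda"
  show "ext i (c *\<^sub>R p) = c *\<^sub>R ext i p"
  proof (rule ext_unique[OF i])
    show "c *\<^sub>R p \<in> Lambda" using subspace_scale[OF subspace_Lambda p] .
    show "c *\<^sub>R ext i p \<in> X i" using subspace_scale[OF subspace_X] ext_harmonic(1)[OF i p] by blast
    show "a_form i (c *\<^sub>R ext i p) v = - b_form i v (c *\<^sub>R p)" if "v \<in> X i" for v
      using a_form_scale[OF i ext_harmonic(1)[OF i p] that] ext_harmonic(2)[OF i p that]
        lin_on_scale[OF lin_on_b_form_right[OF i that] p] by simp
  qed
qed

text \<open>The data of the local problem vanish. Thus \<open>glob p\<close> for \<open>p\<close> in
  \<open>MF k\<close> lives on the two subdomains adjacent to \<open>k\<close> only.\<close>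

lemma ext_not_side:
  assumes i: "i \<in> {1..N}" and k: "k \<in> {1..M}" "k \<notin> ifaces_of i" and p: "p \<in> MF k"
  shows "ext i p = 0"
proof (rule ext_unique[OF i MF_subset_Lambda[OF k(1) p]])
  show "0 \<in> X i" using subspace_0[OF subspace_X] .
  show "a_form i 0 v = - b_form i v p" if "v \<in> X i" for v
    using lin_on_zero[OF spd_on_lin[OF spd_a_form[OF i] that] subspace_X] b_form_not_side[OF i k p] by simp
qed

text \<open>Every space of pairs in the method is an image under \<open>loc i\<close>, \<open>glob\<close> or \<open>bar k i\<close> of a space of
  multipliers, and the energy of a discrete harmonic pair is the Schur complement form of its multiplier.\<close>
definition loc :: "nat \<Rightarrow> (plane \<Rightarrow> real) \<Rightarrow> pairfun"
  where "loc i p = (ext i p, p)"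

definition glob :: "(plane \<Rightarrow> real) \<Rightarrow> pairfun"
  where "glob p = (\<Sum>i\<in>{1..N}. ext i p, p)"

definition schur :: "nat \<Rightarrow> (plane \<Rightarrow> real) \<Rightarrow> (plane \<Rightarrow> real) \<Rightarrow> real"
  where "schur i p q = a_form i (ext i p) (ext i q)"

lemma snd_loc [simp]: "snd (loc i p) = p" and snd_glob [simp]: "snd (glob p) = p"
  by (simp_all add: loc_def glob_def)

lemma lin_on_loc: "i \<in> {1..N} \<Longrightarrow> lin_on Lambda (loc i)"
  using lin_on_ext by (auto simp: lin_on_def loc_def)

lemma lin_on_glob: "lin_on Lambda glob"
  using lin_on_add[OF lin_on_ext] lin_on_scale[OF lin_on_ext]
  by (intro lin_onI) (simp_all add: glob_def sum.distrib scaleR_sum_right)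

lemma inj_loc: "inj_on (loc i) V" and inj_glob: "inj_on glob V"
  by (metis inj_onI snd_loc) (metis inj_onI snd_glob)

text \<open>The harmonic equation for \<open>p\<close> tested with \<open>v\<close> cancels two of
  the three terms; the equation for \<open>q\<close> tested with \<open>ext i p\<close> turns the
  third into an energy product. So \<open>v\<close> is arbitrary, and the leading minus sign of
  \<open>A_loc\<close> is what makes the Schur complement positive.\<close>

lemma A_loc_loc:
  assumes i: "i \<in> {1..N}" and p: "p \<in> Lambda" and q: "q \<in> Lambda" and v: "v \<in> X i"
  shows "A_loc i (loc i p) (v, q) = schur i p q"
  using ext_harmonic[OF i p] ext_harmonic[OF i q] v a_form_sym[of i "ext i q" "ext i p"]
  by (simp add: A_loc_def loc_def schur_def)

lemma A_loc_loc_loc: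
  "i \<in> {1..N} \<Longrightarrow> p \<in> Lambda \<Longrightarrow> q \<in> Lambda \<Longrightarrow> A_loc i (loc i p) (loc i q) = schur i p q"
  using A_loc_loc[of i p q "ext i q"] ext_harmonic(1)[of i q] by (simp add: loc_def)

definition Lambda_loc :: "nat \<Rightarrow> (plane \<Rightarrow> real) set"
  where "Lambda_loc i = (\<Sum>k\<in>ifaces_of i. MF k)"

lemma mem_MF_sub: "k \<in> ifaces_of i \<Longrightarrow> k \<in> {1..M}"
  using ifaces_of_subset by blast

lemma sum_MF_Lambda:
  assumes "I \<subseteq> {1..M}" "\<And>k. k \<in> I \<Longrightarrow> p k \<in> MF k"
  shows "(\<Sum>k\<in>I. p k) \<in> Lambda"
  by (rule subspace_sum[OF subspace_Lambda]) (use assms MF_subset_Lambda in blast)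

lemma set_sum_MF_subset_Lambda: "I \<subseteq> {1..M} \<Longrightarrow> (\<Sum>k\<in>I. MF k) \<subseteq> Lambda"
  by (rule set_sum_subset_subspace[OF subspace_Lambda]) (use MF_subset_Lambda in blast)

text \<open>If the extension vanishes, so does the coupling of \<open>p\<close> with every function
  of \<open>X i\<close>, and the injectivity assumption on multipliers applies.\<close>

lemma ext_eq_zero:
  assumes i: "i \<in> {1..N}" and p: "p \<in> Lambda_loc i" and z: "ext i p = 0"
  shows "p = 0"
proof -
  have pL: "p \<in> Lambda" using p set_sum_MF_subset_Lambda[OF ifaces_of_subset] unfolding Lambda_loc_def by blast
  have "b_form i v p = 0" if "v \<in> X i" for v
    using ext_harmonic(2)[OF i pL that] z lin_on_zero[OF spd_on_lin[OF spd_a_form[OF i] that] subspace_X] by simp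
  thus ?thesis using multiplier_injective i p unfolding Lambda_loc_def by blast
qed

lemma lin_on_schur_left:
  assumes i: "i \<in> {1..N}" and q: "q \<in> Lambda"
  shows "lin_on Lambda (\<lambda>p. schur i p q)"
  using lin_on_add[OF lin_on_ext[OF i]] lin_on_scale[OF lin_on_ext[OF i]] ext_harmonic(1)[OF i]
    lin_on_add[OF spd_on_lin[OF spd_a_form[OF i] ext_harmonic(1)[OF i q]]]
    lin_on_scale[OF spd_on_lin[OF spd_a_form[OF i] ext_harmonic(1)[OF i q]]]
  by (intro lin_onI) (simp_all add: schur_def)

lemma schur_sym: "schur i p q = schur i q p"
  by (simp add: schur_def a_form_sym)

lemma schur_nonneg: "i \<in> {1..N} \<Longrightarrow> p \<in> Lambda \<Longrightarrow> 0 \<le> schur i p p"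
  unfolding schur_def using spd_on_nonneg[OF spd_a_form subspace_X] ext_harmonic(1) by blast

lemma subspace_set_sum_MF: "I \<subseteq> {1..M} \<Longrightarrow> subspace (\<Sum>k\<in>I. MF k)"
  by (rule subspace_set_sum) (use subspace_MF in blast)

text \<open>Definiteness is confined to multipliers on the interfaces of subdomain \<open>i\<close>:
  all others extend by zero, so on \<open>Lambda\<close> only \<open>schur_nonneg\<close> is
  available.\<close>

lemma spd_schur:
  assumes i: "i \<in> {1..N}"
  shows "spd_on (Lambda_loc i) (schur i)"
proof (rule spd_onI)
  have L: "p \<in> Lambda" if "p \<in> Lambda_loc i" for p
    using that set_sum_MF_subset_Lambda[OF ifaces_of_subset] unfolding Lambda_loc_def by blast
  show "schur i (p + q) r = schur i p r + schur i q r"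
    if "p \<in> Lambda_loc i" "q \<in> Lambda_loc i" "r \<in> Lambda_loc i" for p q r
    using lin_on_add[OF lin_on_schur_left[OF i]] L that by simp
  show "schur i (c *\<^sub>R p) q = c * schur i p q" if "p \<in> Lambda_loc i" "q \<in> Lambda_loc i" for c p q
    using lin_on_scale[OF lin_on_schur_left[OF i]] L that by simp
  show "0 < schur i p p" if "p \<in> Lambda_loc i" "p \<noteq> 0" for p
    unfolding schur_def
    using spd_on_pos[OF spd_a_form[OF i] ext_harmonic(1)[OF i L[OF that(1)]]] ext_eq_zero[OF i that(1)] that(2) by blast
qed (rule schur_sym)

section \<open>The basis functions as harmonic extensions\<close>

lemma frame_mbasis: "k \<in> {1..M} \<Longrightarrow> frame (ndof k) (mbasis P k)"
  using mbasis is_basis_frame by blast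

lemma span_mbasis: "k \<in> {1..M} \<Longrightarrow> span (mbasis P k ` {..<ndof k}) = MF k"
  using mbasis by (auto simp: is_basis_def)

lemma mbasis_MF: "k \<in> {1..M} \<Longrightarrow> l < ndof k \<Longrightarrow> mbasis P k l \<in> MF k"
  using span_mbasis span_base by (metis imageI lessThan_iff)

lemma fin_dim_MF: "k \<in> {1..M} \<Longrightarrow> fin_dim (MF k)"
  using span_mbasis fin_dim_span by (metis finite_imageI finite_lessThan)

lemma mem_V_I_loc_plus: "w \<in> V_I_loc i + V \<longleftrightarrow> (\<exists>u\<in>X i. \<exists>z\<in>V. w = (u + fst z, snd z))"
proof
  assume "w \<in> V_I_loc i + V"
  then obtain x z where "w = x + z" "x \<in> V_I_loc i" "z \<in> V" by (rule set_plus_elim)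
  thus "\<exists>u\<in>X i. \<exists>z\<in>V. w = (u + fst z, snd z)"
    by (intro bexI[of _ "fst x"] bexI[of _ z]) (auto simp: V_I_loc_def plus_prod_def)
next
  assume "\<exists>u\<in>X i. \<exists>z\<in>V. w = (u + fst z, snd z)"
  then obtain u z where u: "u \<in> X i" "z \<in> V" "w = (u, 0) + z" by (auto simp: plus_prod_def)
  thus "w \<in> V_I_loc i + V" by (auto simp: V_I_loc_def intro!: set_plus_intro)
qed

lemma A_loc_harmonic_iff:
  assumes i: "i \<in> {1..N}" and p: "p \<in> Lambda" and u: "u \<in> X i"
  shows "(\<forall>v\<in>V_I_loc i. A_loc i (u, p) v = 0) \<longleftrightarrow> u = ext i p"
proof -
  have "A_loc i (u, p) (v, 0) = - (a_form i u v + b_form i v p)" for v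
    by (simp add: A_loc_def b_form_zero_right)
  hence "(\<forall>v\<in>V_I_loc i. A_loc i (u, p) v = 0) \<longleftrightarrow> (\<forall>v\<in>X i. a_form i u v = - b_form i v p)"
    by (auto simp: V_I_loc_def)
  thus ?thesis using ext_unique[OF i p u] ext_harmonic(2)[OF i p] by metis
qed

text \<open>Orthogonality to \<open>V_I_loc i\<close> is the harmonic equation for the first
  component, and the second component is prescribed; so the description has exactly this
  solution.\<close>

lemma phi_loc_eq:
  assumes k: "k \<in> {1..M}" and i: "i \<in> {1..N}" and l: "l < ndof k"
  shows "phi_loc k i l = loc i (mbasis P k l)"
proof -
  let ?p = "mbasis P k l"
  have p: "?p \<in> MF k" "?p \<in> Lambda" using mbasis_MF[OF k l] MF_subset_Lambda[OF k] by auto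
  show ?thesis
    unfolding phi_loc_def
  proof (rule the_equality)
    have "loc i ?p \<in> V_I_loc i + V_F k"
      unfolding mem_V_I_loc_plus using ext_harmonic(1)[OF i p(2)] p(1)
      by (intro bexI[of _ "ext i ?p"] bexI[of _ "(0, ?p)"]) (auto simp: V_F_def loc_def)
    thus "loc i ?p \<in> V_I_loc i + V_F k \<and> snd (loc i ?p) = ?p \<and> (\<forall>v\<in>V_I_loc i. A_loc i (loc i ?p) v = 0)"
      using A_loc_harmonic_iff[OF i p(2) ext_harmonic(1)[OF i p(2)]] by (simp add: loc_def)
  next
    fix w assume w: "w \<in> V_I_loc i + V_F k \<and> snd w = ?p \<and> (\<forall>v\<in>V_I_loc i. A_loc i w v = 0)"
    then obtain u where u: "u \<in> X i" "w = (u, ?p)" by (auto simp: mem_V_I_loc_plus V_F_def)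
    thus "w = loc i ?p" using w A_loc_harmonic_iff[OF i p(2) u(1)] by (simp add: loc_def)
  qed
qed

lemma V_I_memberI:
  assumes "\<And>i. i \<in> {1..N} \<Longrightarrow> v i \<in> X i"
  shows "(\<Sum>i\<in>{1..N}. v i, 0) \<in> V_I"
proof -
  have "(\<Sum>i\<in>{1..N}. v i, 0) = (\<Sum>i\<in>{1..N}. (v i, 0))" by (simp add: prod_eq_iff fst_sum snd_sum)
  also have "\<dots> \<in> V_I"
    unfolding V_I_def by (rule set_sum_memberI) (use assms in \<open>auto simp: V_I_loc_def\<close>)
  finally show ?thesis .
qed

lemma V_I_memberE:
  assumes "w \<in> V_I"
  obtains v where "\<And>i. i \<in> {1..N} \<Longrightarrow> v i \<in> X i" "w = (\<Sum>i\<in>{1..N}. v i, 0)"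
proof -
  obtain f where f: "\<And>i. i \<in> {1..N} \<Longrightarrow> f i \<in> V_I_loc i" "w = (\<Sum>i\<in>{1..N}. f i)"
    using assms unfolding V_I_def by (rule set_sum_memberE[rotated]) auto
  have X: "fst (f i) \<in> X i" and z: "snd (f i) = 0" if "i \<in> {1..N}" for i
    using f(1)[OF that] by (auto simp: V_I_loc_def)
  have "w = (\<Sum>i\<in>{1..N}. fst (f i), 0)" using f(2) z by (simp add: prod_eq_iff fst_sum snd_sum)
  thus thesis using that[of "\<lambda>i. fst (f i)"] X by blast
qed

text \<open>The forms of subdomain \<open>i\<close> see functions only through their values on
  \<open>Sub P i\<close>, so components from different subdomains do not interact.\<close>

lemma A_form_split:
  assumes u: "\<And>i. i \<in> {1..N} \<Longrightarrow> u i \<in> X i" and v: "\<And>i. i \<in> {1..N} \<Longrightarrow> v i \<in> X i"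
  shows "A_form (\<Sum>i\<in>{1..N}. u i, p) (\<Sum>i\<in>{1..N}. v i, 0) = (\<Sum>i\<in>{1..N}. - (a_form i (u i) (v i) + b_form i (v i) p))"
  unfolding A_form_def
proof (intro sum.cong refl)
  fix i assume i: "i \<in> {1..N}"
  have "a_form i (\<Sum>i\<in>{1..N}. u i) (\<Sum>i\<in>{1..N}. v i) = a_form i (u i) (v i)"
    by (rule a_form_local[OF i]) (use sum_X_apply[OF i u] sum_X_apply[OF i v] in blast)+
  moreover have "b_form i (\<Sum>i\<in>{1..N}. v i) p = b_form i (v i) p"
    by (rule b_form_local) (use sum_X_apply[OF i v] in blast)
  ultimately show "A_loc i (\<Sum>i\<in>{1..N}. u i, p) (\<Sum>i\<in>{1..N}. v i, 0) = - (a_form i (u i) (v i) + b_form i (v i) p)"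
    by (simp add: A_loc_def b_form_zero_right)
qed

lemma phi_eq:
  assumes k: "k \<in> {1..M}" and l: "l < ndof k"
  shows "phi k l = glob (mbasis P k l)"
proof -
  let ?p = "mbasis P k l"
  have p: "?p \<in> MF k" "?p \<in> Lambda" using mbasis_MF[OF k l] MF_subset_Lambda[OF k] by auto
  note e = ext_harmonic[OF _ p(2)]
  show ?thesis
    unfolding phi_def
  proof (rule the_equality)
    have "glob ?p = (\<Sum>i\<in>{1..N}. ext i ?p, 0) + (0, ?p)" by (simp add: glob_def)
    also have "\<dots> \<in> V_I + V_F k"
      by (rule set_plus_intro[OF V_I_memberI]) (use e(1) p(1) in \<open>auto simp: V_F_def\<close>)
    finally have "glob ?p \<in> V_I + V_F k" .
    moreover have "A_form (glob ?p) w = 0" if "w \<in> V_I" for w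
    proof -
      obtain v where v: "\<And>i. i \<in> {1..N} \<Longrightarrow> v i \<in> X i" "w = (\<Sum>i\<in>{1..N}. v i, 0)"
        using \<open>w \<in> V_I\<close> by (rule V_I_memberE) blast
      have "A_form (glob ?p) w = (\<Sum>i\<in>{1..N}. - (a_form i (ext i ?p) (v i) + b_form i (v i) ?p))"
        unfolding v(2) glob_def by (rule A_form_split[OF e(1) v(1)])
      also have "\<dots> = 0" by (rule sum.neutral) (use e(2) v(1) in auto)
      finally show ?thesis .
    qed
    ultimately show "glob ?p \<in> V_I + V_F k \<and> snd (glob ?p) = ?p \<and> (\<forall>v\<in>V_I. A_form (glob ?p) v = 0)" by simp
  next
    fix w assume w: "w \<in> V_I + V_F k \<and> snd w = ?p \<and> (\<forall>v\<in>V_I. A_form w v = 0)"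
    then obtain x y where xy: "w = x + y" "x \<in> V_I" "y \<in> V_F k" by (elim conjE set_plus_elim)
    obtain u where u: "\<And>i. i \<in> {1..N} \<Longrightarrow> u i \<in> X i" "x = (\<Sum>i\<in>{1..N}. u i, 0)"
      using xy(2) by (rule V_I_memberE) blast
    have wu: "w = (\<Sum>i\<in>{1..N}. u i, ?p)" using xy u w by (auto simp: V_F_def)
    have "u i = ext i ?p" if i: "i \<in> {1..N}" for i
    proof (rule ext_unique[OF i p(2) u(1)[OF i], symmetric])
      fix v assume v: "v \<in> X i"
      \<comment> \<open>Testing with a function supported on the single subdomain \<open>i\<close>
        isolates its equation from the global one.\<close>
      define V where "V j = (if j = i then v else 0)" for j
      have V: "V j \<in> X j" for j using v subspace_0[OF subspace_X] by (simp add: V_def)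
      have "0 = A_form w (\<Sum>j\<in>{1..N}. V j, 0)" using w V_I_memberI[of V] V by simp
      also have "\<dots> = (\<Sum>j\<in>{1..N}. - (a_form j (u j) (V j) + b_form j (V j) ?p))"
        unfolding wu by (rule A_form_split[OF u(1) V])
      also have "\<dots> = (\<Sum>j\<in>{1..N}. if j = i then - (a_form i (u i) v + b_form i v ?p) else 0)"
        using lin_on_zero[OF spd_on_lin_right[OF spd_a_form subspace_X u(1)] subspace_X]
          lin_on_zero[OF lin_on_b_form_left[OF _ p(2)] subspace_X]
        by (intro sum.cong) (auto simp: V_def)
      finally show "a_form i (u i) v = - b_form i v ?p" using i by simp
    qed
    thus "w = glob ?p" unfolding wu glob_def by simp
  qed
qed

text \<open>The extension of a multiplier from interface \<open>k\<close> to all interfaces of subdomain \<open>i\<close> with minimal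
  Schur complement energy; it turns \<open>phi_loc\<close> into \<open>phi_bar\<close>.\<close>
definition min_ext :: "nat \<Rightarrow> nat \<Rightarrow> (plane \<Rightarrow> real) \<Rightarrow> plane \<Rightarrow> real"
  where "min_ext k i p = (THE q. q \<in> (\<Sum>m\<in>ifaces_of i - {k}. MF m) \<and>
    (\<forall>v\<in>(\<Sum>m\<in>ifaces_of i - {k}. MF m). schur i (p + q) v = 0))"

context
  fixes i k
  assumes i: "i \<in> {1..N}" and k: "k \<in> ifaces_of i"
begin

private abbreviation "rest \<equiv> (\<Sum>m\<in>ifaces_of i - {k}. MF m)"

lemma rest_facts: "subspace rest" "rest \<subseteq> Lambda" "fin_dim rest" "spd_on rest (schur i)" "rest \<subseteq> Lambda_loc i"
    "Lambda_loc i = MF k + rest"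
proof -
  have I: "ifaces_of i - {k} \<subseteq> {1..M}" using ifaces_of_subset by blast
  show "subspace rest" "rest \<subseteq> Lambda" using subspace_set_sum_MF[OF I] set_sum_MF_subset_Lambda[OF I] .
  show "fin_dim rest" by (rule fin_dim_set_sum) (use I fin_dim_MF in blast)
  show L: "Lambda_loc i = MF k + rest" unfolding Lambda_loc_def by (rule sum.remove[OF finite_ifaces_of k])
  have "0 \<in> MF k" using subspace_0[OF subspace_MF] k ifaces_of_subset by blast
  thus "rest \<subseteq> Lambda_loc i" unfolding L by (rule set_zero_plus2[of _ rest, THEN subset_trans]) simp_all
  thus "spd_on rest (schur i)" using spd_on_subset[OF spd_schur[OF i]] by blast
qed

lemma k_MF: "k \<in> {1..M}" "p \<in> MF k \<Longrightarrow> p \<in> Lambda"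
  using k ifaces_of_subset MF_subset_Lambda by blast+

lemma schur_add: "p \<in> Lambda \<Longrightarrow> q \<in> Lambda \<Longrightarrow> r \<in> Lambda \<Longrightarrow> schur i (p + q) r = schur i p r + schur i q r"
  using lin_on_add[OF lin_on_schur_left[OF i]] by simp

lemma min_ext_unique:
  assumes p: "p \<in> Lambda" and q: "q \<in> rest" "\<And>v. v \<in> rest \<Longrightarrow> schur i (p + q) v = 0"
  shows "min_ext k i p = q"
  unfolding min_ext_def
proof (rule the_equality)
  fix r assume r: "r \<in> rest \<and> (\<forall>v\<in>rest. schur i (p + r) v = 0)"
  show "r = q"
  proof (rule spd_on_unique[OF rest_facts(4,1)])
    fix v assume v: "v \<in> rest"
    have L: "v \<in> Lambda" "r \<in> Lambda" "q \<in> Lambda" using v r q(1) rest_facts(2) by blast+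
    have "schur i (p + r) v = 0" "schur i (p + q) v = 0" using r q(2)[OF v] v by blast+
    thus "schur i r v = schur i q v" using schur_add[OF p L(2,1)] schur_add[OF p L(3,1)] by simp
  qed (use r q in auto)
qed (use q in auto)

lemma min_ext:
  assumes p: "p \<in> Lambda"
  shows "min_ext k i p \<in> rest" "v \<in> rest \<Longrightarrow> schur i (p + min_ext k i p) v = 0"
proof -
  have "lin_on rest (\<lambda>v. - schur i v p)"
    using lin_on_subset[OF lin_on_schur_left[OF i p] rest_facts(2)] by (auto simp: lin_on_def)
  then obtain q where q: "q \<in> rest" "\<forall>v\<in>rest. schur i q v = - schur i v p"
    using riesz_subspace[OF rest_facts(3,1,4)] by blast
  have q': "schur i (p + q) v = 0" if "v \<in> rest" for v
    using schur_add[of p q v] p q that rest_facts(2) schur_sym[of i v p] by (simp add: subset_iff)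
  have "min_ext k i p = q" by (rule min_ext_unique[OF p q(1) q'])
  thus "min_ext k i p \<in> rest" "v \<in> rest \<Longrightarrow> schur i (p + min_ext k i p) v = 0" using q(1) q' by auto
qed

text \<open>The orthogonality condition determines the correction uniquely, so corrections add and
  scale with their multipliers.\<close>

lemma lin_on_min_ext: "lin_on (MF k) (\<lambda>p. loc i (p + min_ext k i p))"
proof -
  have "lin_on (MF k) (\<lambda>p. p + min_ext k i p)"
  proof (rule lin_onI)
    fix p q assume pq: "p \<in> MF k" "q \<in> MF k"
    note L = k_MF(2)[OF pq(1)] k_MF(2)[OF pq(2)]
    note mL = subsetD[OF rest_facts(2) min_ext(1)]
    have "min_ext k i (p + q) = min_ext k i p + min_ext k i q"
    proof (rule min_ext_unique)
      show "p + q \<in> Lambda" using L subspace_add[OF subspace_Lambda] by blast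
      show "min_ext k i p + min_ext k i q \<in> rest" using min_ext(1) L subspace_add[OF rest_facts(1)] by blast
      fix v assume v: "v \<in> rest"
      have m: "p + min_ext k i p \<in> Lambda" "q + min_ext k i q \<in> Lambda" "v \<in> Lambda"
        using L mL subspace_add[OF subspace_Lambda] rest_facts(2) v by blast+
      have "p + q + (min_ext k i p + min_ext k i q) = (p + min_ext k i p) + (q + min_ext k i q)" by simp
      thus "schur i (p + q + (min_ext k i p + min_ext k i q)) v = 0"
        using schur_add[OF m] min_ext(2)[OF L(1) v] min_ext(2)[OF L(2) v] by (simp only: add_0_left)
    qed
    thus "p + q + min_ext k i (p + q) = p + min_ext k i p + (q + min_ext k i q)" by simp
  next
    fix c p assume p: "p \<in> MF k"
    note L = k_MF(2)[OF p]
    have "min_ext k i (c *\<^sub>R p) = c *\<^sub>R min_ext k i p"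
    proof (rule min_ext_unique)
      show "c *\<^sub>R p \<in> Lambda" using L subspace_scale[OF subspace_Lambda] by blast
      show "c *\<^sub>R min_ext k i p \<in> rest" using min_ext(1)[OF L] subspace_scale[OF rest_facts(1)] by blast
      fix v assume v: "v \<in> rest"
      have m: "p + min_ext k i p \<in> Lambda"
        using L min_ext(1)[OF L] rest_facts(2) subspace_add[OF subspace_Lambda] by blast
      have vL: "v \<in> Lambda" using v rest_facts(2) by blast
      show "schur i (c *\<^sub>R p + c *\<^sub>R min_ext k i p) v = 0"
        using lin_on_scale[OF lin_on_schur_left[OF i vL] m, of c] min_ext(2)[OF L v]
        by (simp add: scaleR_add_right)
    qed
    thus "c *\<^sub>R p + min_ext k i (c *\<^sub>R p) = c *\<^sub>R (p + min_ext k i p)" by (simp add: scaleR_add_right)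
  qed
  moreover have "p + min_ext k i p \<in> Lambda" if "p \<in> MF k" for p
    using k_MF(2)[OF that] min_ext(1) rest_facts(2) subspace_add[OF subspace_Lambda] by blast
  ultimately show ?thesis
    using lin_on_loc[OF i] lin_on_add[OF \<open>lin_on (MF k) (\<lambda>p. p + min_ext k i p)\<close>]
      lin_on_scale[OF \<open>lin_on (MF k) (\<lambda>p. p + min_ext k i p)\<close>]
    by (intro lin_onI) (simp_all only: lin_on_add[OF lin_on_loc[OF i]] lin_on_scale[OF lin_on_loc[OF i]])
qed

text \<open>The correction is carried by the other interfaces, which are disjoint from
  \<open>F k\<close>; so \<open>p\<close> can be recovered from its extension, whence
  injectivity.\<close>

lemma min_ext_component: "p \<in> MF k \<Longrightarrow> x \<in> F k \<Longrightarrow> (p + min_ext k i p) x = p x"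
proof -
  assume p: "p \<in> MF k" and x: "x \<in> F k"
  obtain q where q: "\<And>m. m \<in> ifaces_of i - {k} \<Longrightarrow> q m \<in> MF m" "min_ext k i p = (\<Sum>m\<in>ifaces_of i - {k}. q m)"
    using set_sum_memberE[OF _ min_ext(1)[OF k_MF(2)[OF p]]] finite_ifaces_of by (metis finite_Diff)
  have "q m x = 0" if "m \<in> ifaces_of i - {k}" for m
    using MF_outside[OF q(1)[OF that]] F_disjoint[OF k_MF(1) _ x] F_subset_F_closed[of m] ifaces_of_subset that by blast
  thus ?thesis unfolding q(2) by (simp add: sum_fun_apply)
qed

lemma inj_min_ext: "inj_on (\<lambda>p. loc i (p + min_ext k i p)) (MF k)"
proof (rule inj_onI)
  fix p q assume pq: "p \<in> MF k" "q \<in> MF k" "loc i (p + min_ext k i p) = loc i (q + min_ext k i q)"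
  hence "p + min_ext k i p = q + min_ext k i q" by (metis snd_loc)
  hence "p x = q x" for x
    using min_ext_component[OF pq(1)] min_ext_component[OF pq(2)] MF_outside[OF pq(1)] MF_outside[OF pq(2)]
    by (cases "x \<in> F k") metis+
  thus "p = q" by (rule ext)
qed

text \<open>Pythagoras: the competitor \<open>p + r\<close> differs from the minimal extension by an
  element \<open>z\<close> of \<open>rest\<close>, to which the minimal extension is orthogonal, so
  the energies add.\<close>

lemma schur_min_ext_le:
  assumes p: "p \<in> MF k" and r: "r \<in> rest"
  shows "schur i (p + min_ext k i p) (p + min_ext k i p) \<le> schur i (p + r) (p + r)"
proof -
  let ?m = "p + min_ext k i p"
  have L: "p \<in> Lambda" "?m \<in> Lambda" "min_ext k i p \<in> rest"
    using k_MF(2)[OF p] min_ext(1) rest_facts(2) subspace_add[OF subspace_Lambda] by blast+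
  define z where "z = r - min_ext k i p"
  have z: "z \<in> rest" unfolding z_def using r L(3) subspace_diff[OF rest_facts(1)] by blast
  have zL: "z \<in> Lambda" using z rest_facts(2) by blast
  have mz: "?m + z \<in> Lambda" using L(2) zL subspace_add[OF subspace_Lambda] by blast
  have "p + r = ?m + z" by (simp add: z_def)
  hence "schur i (p + r) (p + r) = schur i ?m (?m + z) + schur i z (?m + z)"
    using schur_add[OF L(2) zL mz] by (simp only:)
  also have "\<dots> = schur i (?m + z) ?m + schur i (?m + z) z" by (simp only: schur_sym)
  also have "\<dots> = schur i ?m ?m + schur i z ?m + (schur i ?m z + schur i z z)"
    using schur_add[OF L(2) zL L(2)] schur_add[OF L(2) zL zL] by simp
  also have "\<dots> = schur i ?m ?m + schur i z z"
    using min_ext(2)[OF L(1) z] schur_sym[of i z ?m] by simp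
  finally show ?thesis using schur_nonneg[OF i zL] by linarith
qed

text \<open>Testing with \<open>V_I_loc i\<close> makes the first component the harmonic extension
  of the second; testing with multipliers on the other interfaces is then the condition that
  determines \<open>min_ext\<close>.\<close>

lemma phi_bar_eq:
  assumes l: "l < ndof k"
  shows "phi_bar k i l = loc i (mbasis P k l + min_ext k i (mbasis P k l))"
proof -
  let ?p = "mbasis P k l"
  let ?w = "loc i (?p + min_ext k i ?p)"
  have p: "?p \<in> MF k" using mbasis_MF[OF k_MF(1) l] .
  have L: "?p \<in> Lambda" "min_ext k i ?p \<in> rest" "?p + min_ext k i ?p \<in> Lambda"
    using k_MF(2)[OF p] min_ext(1) rest_facts(2) subspace_add[OF subspace_Lambda] by blast+
  have sumV: "(\<Sum>m\<in>I. V_F m) = {(0, q) | q. q \<in> (\<Sum>m\<in>I. MF m)}" if fI: "finite I" for I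
  proof (intro equalityI subsetI)
    fix x assume "x \<in> (\<Sum>m\<in>I. V_F m)"
    then obtain f where f: "\<And>m. m \<in> I \<Longrightarrow> f m \<in> V_F m" "x = (\<Sum>m\<in>I. f m)" using set_sum_memberE[OF fI] by metis
    have "snd (f m) \<in> MF m" "fst (f m) = 0" if "m \<in> I" for m using f(1)[OF that] by (auto simp: V_F_def)
    hence "x = (0, \<Sum>m\<in>I. snd (f m))" "(\<Sum>m\<in>I. snd (f m)) \<in> (\<Sum>m\<in>I. MF m)"
      using f(2) set_sum_memberI[OF fI, of "\<lambda>m. snd (f m)" MF] by (auto simp: prod_eq_iff fst_sum snd_sum)
    thus "x \<in> {(0, q) | q. q \<in> (\<Sum>m\<in>I. MF m)}" by blast
  next
    fix x assume "x \<in> {(0 :: plane \<Rightarrow> real, q) | q. q \<in> (\<Sum>m\<in>I. MF m)}"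
    then obtain q where q: "x = (0, q)" "q \<in> (\<Sum>m\<in>I. MF m)" by auto
    obtain f where f: "\<And>m. m \<in> I \<Longrightarrow> f m \<in> MF m" "q = (\<Sum>m\<in>I. f m)" using set_sum_memberE[OF fI q(2)] by metis
    have "x = (\<Sum>m\<in>I. (0, f m))" using q(1) f(2) by (simp add: prod_eq_iff fst_sum snd_sum)
    also have "\<dots> \<in> (\<Sum>m\<in>I. V_F m)" by (rule set_sum_memberI[OF fI]) (use f(1) in \<open>auto simp: V_F_def\<close>)
    finally show "x \<in> (\<Sum>m\<in>I. V_F m)" .
  qed
  note sv = sumV[OF finite_ifaces_of] sumV[OF finite_Diff[OF finite_ifaces_of]]
  show ?thesis
    unfolding phi_bar_def
  proof (rule the_equality)
    have mL: "?p + min_ext k i ?p \<in> Lambda_loc i" unfolding rest_facts(6) using p L(2) by (rule set_plus_intro)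
    have "?w \<in> V_loc i"
      unfolding V_loc_def mem_V_I_loc_plus sv using mL[unfolded Lambda_loc_def] ext_harmonic(1)[OF i L(3)]
      by (intro bexI[of _ "ext i (?p + min_ext k i ?p)"] bexI[of _ "(0, ?p + min_ext k i ?p)"]) (auto simp: loc_def)
    moreover have "A_loc i ?w v = 0" if "v \<in> V_I_loc i + (\<Sum>m\<in>ifaces_of i - {k}. V_F m)" for v
    proof -
      obtain u q where uq: "u \<in> X i" "q \<in> rest" "v = (u, q)"
        using \<open>v \<in> V_I_loc i + _\<close> unfolding mem_V_I_loc_plus sv by auto
      have "q \<in> Lambda" using uq(2) rest_facts(2) by blast
      thus ?thesis unfolding uq(3) using A_loc_loc[OF i L(3) _ uq(1)] min_ext(2)[OF L(1) uq(2)] by simp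
    qed
    ultimately show "?w \<in> V_loc i \<and> (\<forall>x\<in>F k. snd ?w x = ?p x) \<and>
      (\<forall>v\<in>V_I_loc i + (\<Sum>m\<in>ifaces_of i - {k}. V_F m). A_loc i ?w v = 0)"
      using min_ext_component[OF p] by simp
  next
    fix w assume w: "w \<in> V_loc i \<and> (\<forall>x\<in>F k. snd w x = ?p x) \<and>
      (\<forall>v\<in>V_I_loc i + (\<Sum>m\<in>ifaces_of i - {k}. V_F m). A_loc i w v = 0)"
    obtain u q where uq: "u \<in> X i" "q \<in> Lambda_loc i" "w = (u, q)"
      using w unfolding V_loc_def mem_V_I_loc_plus sv Lambda_loc_def by auto
    obtain q1 q2 where q: "q = q1 + q2" "q1 \<in> MF k" "q2 \<in> rest"
      using uq(2) unfolding rest_facts(6) by (rule set_plus_elim)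
    have qL: "q \<in> Lambda" "q2 \<in> Lambda"
      using q rest_facts(2) k_MF(2) subspace_add[OF subspace_Lambda] by blast+
    have r0: "(0, 0) \<in> (\<Sum>m\<in>ifaces_of i - {k}. V_F m)" using subspace_0[OF rest_facts(1)] unfolding sv by blast
    have X0: "0 \<in> X i" using subspace_0[OF subspace_X] .
    have "A_loc i (u, q) v = 0" if "v \<in> V_I_loc i" for v
    proof -
      have "v \<in> V_I_loc i + (\<Sum>m\<in>ifaces_of i - {k}. V_F m)"
        using set_plus_intro[OF that r0] by (simp add: zero_prod_def[symmetric])
      thus ?thesis using w uq(3) by blast
    qed
    hence u: "u = ext i q" using A_loc_harmonic_iff[OF i qL(1) uq(1)] by blast
    \<comment> \<open>On \<open>F k\<close> the part \<open>q2\<close> vanishes and the value is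
      prescribed; off \<open>F k\<close> both multipliers are zero.\<close>
    have q1p: "q1 = ?p"
    proof
      fix x
      obtain f where f: "\<And>m. m \<in> ifaces_of i - {k} \<Longrightarrow> f m \<in> MF m" "q2 = (\<Sum>m\<in>ifaces_of i - {k}. f m)"
        using set_sum_memberE[OF finite_Diff[OF finite_ifaces_of] q(3)] by metis
      show "q1 x = ?p x"
      proof (cases "x \<in> F k")
        case True
        have "f m x = 0" if "m \<in> ifaces_of i - {k}" for m
          using MF_outside[OF f(1)[OF that]] F_disjoint[OF k_MF(1) _ True] F_subset_F_closed[of m] ifaces_of_subset that by blast
        hence "q2 x = 0" unfolding f(2) by (simp add: sum_fun_apply)
        thus ?thesis using w True uq(3) q(1) by auto
      qed (use MF_outside[OF q(2)] MF_outside[OF p] in simp)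
    qed
    have "min_ext k i ?p = q2"
    proof (rule min_ext_unique[OF L(1) q(3)])
      fix v assume v: "v \<in> rest"
      have "(0, v) \<in> V_I_loc i + (\<Sum>m\<in>ifaces_of i - {k}. V_F m)"
        unfolding mem_V_I_loc_plus sv using v X0 by (intro bexI[of _ 0] bexI[of _ "(0, v)"]) auto
      hence "A_loc i (loc i q) (0, v) = 0" using w uq(3) u by (simp add: loc_def)
      thus "schur i (?p + q2) v = 0"
        using A_loc_loc[OF i qL(1) _ X0, of v] v rest_facts(2) q(1) q1p by auto
    qed
    thus "w = ?w" using uq(3) u q(1) q1p by (simp add: loc_def)
  qed
qed

end

end

section \<open>Dual and primal multipliers\<close>

lemma sum_insert_None:
  "(\<Sum>j\<in>insert None (Some ` {1..n :: nat}). d j) = d None + (\<Sum>i\<in>{1..n}. d (Some i))"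
  for d :: "nat option \<Rightarrow> 'v::real_vector"
  by (subst sum.insert) (auto simp: sum.reindex)

context mortar_discretization
begin

section \<open>The two sides of an interface\<close>

definition opp :: "nat \<Rightarrow> nat \<Rightarrow> nat"
  where "opp k i = (if i = fst (iface P k) then snd (iface P k) else fst (iface P k))"

lemma opp:
  assumes i: "i \<in> {1..N}" and k: "k \<in> ifaces_of i"
  shows "opp k i \<in> {1..N}" "k \<in> ifaces_of (opp k i)" "(i, opp k i) \<in> sides k" "opp k (opp k i) = i"
proof -
  have kM: "k \<in> {1..M}" using k mem_MF_sub by blast
  note s = iface_sides[OF kM]
  have io: "i = fst (iface P k) \<or> i = snd (iface P k)" using mem_ifaces_of[OF kM i] k by blast
  show o: "opp k i \<in> {1..N}" using s by (simp add: opp_def)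
  show "k \<in> ifaces_of (opp k i)" using mem_ifaces_of[OF kM o] by (auto simp: opp_def)
  show "(i, opp k i) \<in> sides k" "opp k (opp k i) = i"
    using io s(1) by (auto simp: sides_def opp_def prod_eq_iff)
qed

lemma fst_snd_ifaces:
  assumes k: "k \<in> {1..M}"
  shows "k \<in> ifaces_of (fst (iface P k))" "k \<in> ifaces_of (snd (iface P k))"
    "opp k (fst (iface P k)) = snd (iface P k)" "opp k (snd (iface P k)) = fst (iface P k)"
  using iface_sides[OF k] mem_ifaces_of[OF k] by (auto simp: opp_def)

text \<open>Double counting of incident pairs, using that every interface has two distinct sides. It
  passes between the sum over subdomains in the energy and the sum over interfaces in the jump
  estimate.\<close>

lemma sum_sides:
  fixes f :: "nat \<Rightarrow> nat \<Rightarrow> 'v::comm_monoid_add"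
  shows "(\<Sum>i\<in>{1..N}. \<Sum>k\<in>ifaces_of i. f i k) = (\<Sum>k\<in>{1..M}. f (fst (iface P k)) k + f (snd (iface P k)) k)"
proof -
  have "(\<Sum>i\<in>{1..N}. \<Sum>k\<in>ifaces_of i. f i k) = (\<Sum>i\<in>{1..N}. \<Sum>k\<in>{1..M}. if k \<in> ifaces_of i then f i k else 0)"
  proof (rule sum.cong[OF refl])
    fix i
    have "{1..M} \<inter> ifaces_of i = ifaces_of i" using ifaces_of_subset by blast
    thus "(\<Sum>k\<in>ifaces_of i. f i k) = (\<Sum>k\<in>{1..M}. if k \<in> ifaces_of i then f i k else 0)"
      using sum.inter_restrict[of "{1..M}" "f i" "ifaces_of i"] by simp
  qed
  also have "\<dots> = (\<Sum>k\<in>{1..M}. \<Sum>i\<in>{1..N}. if k \<in> ifaces_of i then f i k else 0)" by (rule sum.swap)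
  also have "\<dots> = (\<Sum>k\<in>{1..M}. f (fst (iface P k)) k + f (snd (iface P k)) k)"
  proof (rule sum.cong[OF refl])
    fix k assume k: "k \<in> {1..M}"
    note s = iface_sides[OF k]
    have "(\<Sum>i\<in>{1..N}. if k \<in> ifaces_of i then f i k else 0) = (\<Sum>i\<in>{fst (iface P k), snd (iface P k)}. f i k)"
      by (rule sum.mono_neutral_cong_right) (use s(3,4) mem_ifaces_of[OF k] in auto)
    thus "(\<Sum>i\<in>{1..N}. if k \<in> ifaces_of i then f i k else 0) = f (fst (iface P k)) k + f (snd (iface P k)) k"
      using s(1) by simp
  qed
  finally show ?thesis .
qed

lemma card_ifaces_of: "i \<in> {1..N} \<Longrightarrow> card (ifaces_of i) \<le> C_F"
  unfolding C_F_def by (rule Max_ge) auto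

end

context adaptive_bddc
begin

text \<open>The transformed multiplier basis. Its images under \<open>glob\<close>,
  \<open>loc i\<close> and \<open>bar k i\<close> are \<open>phi_hat\<close>,
  \<open>phi_tilde\<close> and \<open>phi_bar_tilde\<close>.\<close>

definition beta :: "nat \<Rightarrow> nat \<Rightarrow> plane \<Rightarrow> real"
  where "beta k l = mat_op (ndof k) (mbasis P k) (Tmat P k) (mbasis P k l)"

definition MF_Delta :: "nat \<Rightarrow> (plane \<Rightarrow> real) set"
  where "MF_Delta k = span (beta k ` {..<nDelta P k})"

definition MF_Pi :: "nat \<Rightarrow> (plane \<Rightarrow> real) set"
  where "MF_Pi k = span (beta k ` {nDelta P k..<ndof k})"

definition D_mul :: "nat \<Rightarrow> nat \<Rightarrow> (plane \<Rightarrow> real) \<Rightarrow> plane \<Rightarrow> real"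
  where "D_mul k i = mat_op (ndof k) (mbasis P k) (Dmat P k i)"

definition D_check_mul :: "nat \<Rightarrow> nat \<Rightarrow> (plane \<Rightarrow> real) \<Rightarrow> plane \<Rightarrow> real"
  where "D_check_mul k i = mat_op (ndof k) (beta k) (Dcheck_mat P k i)"

definition bar :: "nat \<Rightarrow> nat \<Rightarrow> (plane \<Rightarrow> real) \<Rightarrow> pairfun"
  where "bar k i p = loc i (p + min_ext k i p)"

lemma Tmat: "k \<in> {1..M} \<Longrightarrow> Tmat P k \<in> carrier_mat (ndof k) (ndof k)" "k \<in> {1..M} \<Longrightarrow> invertible_mat (Tmat P k)"
  using T_matrix by auto

lemma frame_beta: "k \<in> {1..M} \<Longrightarrow> frame (ndof k) (beta k)"
  and span_beta: "k \<in> {1..M} \<Longrightarrow> span (beta k ` {..<ndof k}) = MF k"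
  using transformed_frame[OF frame_mbasis Tmat] span_mbasis by (auto simp: beta_def[abs_def])

lemma nDelta_le: "k \<in> {1..M} \<Longrightarrow> nDelta P k \<le> ndof k"
  using splitting by blast

lemma MF_Delta_MF: "k \<in> {1..M} \<Longrightarrow> MF_Delta k \<subseteq> MF k" and MF_Pi_MF: "k \<in> {1..M} \<Longrightarrow> MF_Pi k \<subseteq> MF k"
proof -
  assume k: "k \<in> {1..M}"
  show "MF_Delta k \<subseteq> MF k" "MF_Pi k \<subseteq> MF k"
    unfolding MF_Delta_def MF_Pi_def span_beta[OF k, symmetric]
    using nDelta_le[OF k] by (intro span_mono image_mono; auto)+
qed

lemma subspace_MF_Delta: "subspace (MF_Delta k)" and subspace_MF_Pi: "subspace (MF_Pi k)"
  by (simp_all add: MF_Delta_def MF_Pi_def)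

lemma MF_split:
  assumes k: "k \<in> {1..M}" and p: "p \<in> MF k"
  obtains d q where "d \<in> MF_Delta k" "q \<in> MF_Pi k" "p = d + q"
proof -
  have "{..<ndof k} = {..<nDelta P k} \<union> {nDelta P k..<ndof k}" using nDelta_le[OF k] by auto
  hence "p \<in> span (beta k ` {..<nDelta P k} \<union> beta k ` {nDelta P k..<ndof k})"
    using p span_beta[OF k] by (simp add: image_Un)
  thus thesis using that unfolding span_Un MF_Delta_def MF_Pi_def by blast
qed

lemma MF_Delta_MF_Pi_zero:
  assumes k: "k \<in> {1..M}" and d: "d \<in> MF_Delta k" and q: "q \<in> MF_Pi k" and z: "d + q = 0"
  shows "d = 0" "q = 0"
proof -
  have "{..<nDelta P k} \<subseteq> {..<ndof k}" "{nDelta P k..<ndof k} \<subseteq> {..<ndof k}"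
    "{..<nDelta P k} \<inter> {nDelta P k..<ndof k} = {}" using nDelta_le[OF k] by auto
  from frame_span_Int[OF frame_beta[OF k] this d[unfolded MF_Delta_def] q[unfolded MF_Pi_def] z]
  show "d = 0" "q = 0" .
qed

text \<open>One matrix acts in all the bases, and these are images of the multiplier basis; hence
  the transformation commutes with the map \<open>f\<close>.\<close>

lemma T_op_image:
  assumes k: "k \<in> {1..M}" and l: "l < ndof k" and b: "\<And>l. l < ndof k \<Longrightarrow> b l = f (mbasis P k l)"
    and f: "lin_on (MF k) f" "inj_on f (MF k)"
  shows "T_op k b (b l) = f (beta k l)"
proof -
  have "T_op k b (b l) = mat_op (ndof k) (\<lambda>l. f (mbasis P k l)) (Tmat P k) (f (mbasis P k l))"
    unfolding T_op_def using mat_op_cong[of "ndof k" b "\<lambda>l. f (mbasis P k l)"] b l by simp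
  also have "\<dots> = f (beta k l)"
    unfolding beta_def
    by (rule mat_op_image[where b = "mbasis P k" and f = f])
      (use frame_mbasis[OF k] f span_mbasis[OF k] mbasis_MF[OF k l] in auto)
  finally show ?thesis .
qed

lemma lin_on_MF: "k \<in> {1..M} \<Longrightarrow> lin_on Lambda f \<Longrightarrow> lin_on (MF k) f"
  using lin_on_subset MF_subset_Lambda by blast

lemma phi_hat_eq: "k \<in> {1..M} \<Longrightarrow> l < ndof k \<Longrightarrow> phi_hat k l = glob (beta k l)"
  unfolding phi_hat_def by (rule T_op_image) (auto simp: phi_eq lin_on_MF lin_on_glob inj_glob)

lemma phi_tilde_eq: "k \<in> {1..M} \<Longrightarrow> i \<in> {1..N} \<Longrightarrow> l < ndof k \<Longrightarrow> phi_tilde k i l = loc i (beta k l)"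
  unfolding phi_tilde_def by (rule T_op_image) (auto simp: phi_loc_eq lin_on_MF lin_on_loc inj_loc)

lemma phi_bar_tilde_eq:
  assumes i: "i \<in> {1..N}" and k: "k \<in> ifaces_of i" and l: "l < ndof k"
  shows "phi_bar_tilde k i l = bar k i (beta k l)"
  unfolding phi_bar_tilde_def
proof (rule T_op_image[OF mem_MF_sub[OF k] l])
  show "lin_on (MF k) (bar k i)" "inj_on (bar k i) (MF k)"
    using lin_on_min_ext[OF i k] inj_min_ext[OF i k] by (simp_all add: bar_def[abs_def])
qed (simp add: phi_bar_eq[OF i k] bar_def)

text \<open>Both bases are copies of \<open>beta k\<close>, so the change of basis keeps the
  multiplier and only exchanges the map applied to it.\<close>

lemma basis_change_eq:
  assumes k: "k \<in> {1..M}" and b: "\<And>l. l < ndof k \<Longrightarrow> b l = f (beta k l)" "\<And>l. l < ndof k \<Longrightarrow> d l = g (beta k l)"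
    and fg: "lin_on Lambda f" "inj_on f (MF k)" "lin_on Lambda g" and p: "p \<in> MF k"
  shows "basis_change (ndof k) b d (f p) = g p"
proof -
  have "basis_change (ndof k) b d = basis_change (ndof k) (\<lambda>l. f (beta k l)) (\<lambda>l. g (beta k l))"
    using b by (intro basis_change_cong) auto
  thus ?thesis
    using basis_change_image[OF frame_beta[OF k], of f g p] lin_on_MF[OF k fg(1)] lin_on_MF[OF k fg(3)]
      fg(2) p span_beta[OF k] by simp
qed

lemma T_to_loc_glob: "k \<in> {1..M} \<Longrightarrow> i \<in> {1..N} \<Longrightarrow> p \<in> MF k \<Longrightarrow> T_to_loc k i (glob p) = loc i p"
  and T_from_loc_loc: "k \<in> {1..M} \<Longrightarrow> i \<in> {1..N} \<Longrightarrow> p \<in> MF k \<Longrightarrow> T_from_loc k i (loc i p) = glob p"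
  and T_swap_loc: "k \<in> {1..M} \<Longrightarrow> i \<in> {1..N} \<Longrightarrow> j \<in> {1..N} \<Longrightarrow> p \<in> MF k \<Longrightarrow> T_swap k i j (loc i p) = loc j p"
  unfolding T_to_loc_def T_from_loc_def T_swap_def
  by (rule basis_change_eq; auto simp: phi_hat_eq phi_tilde_eq lin_on_glob lin_on_loc inj_glob inj_loc)+

lemma D_op_loc:
  assumes k: "k \<in> {1..M}" and i: "i \<in> {1..N}" and p: "p \<in> MF k"
  shows "D_op k j i (loc i p) = loc i (D_mul k j p)"
proof -
  have "mat_op (ndof k) (phi_loc k i) = mat_op (ndof k) (\<lambda>l. loc i (mbasis P k l))"
    by (rule mat_op_cong) (simp add: phi_loc_eq[OF k i])
  thus ?thesis unfolding D_op_def D_mul_def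
    using mat_op_image[OF frame_mbasis[OF k], of "loc i" p] lin_on_MF[OF k lin_on_loc[OF i]] inj_loc p span_mbasis[OF k]
    by simp
qed

lemma D_check_glob:
  assumes k: "k \<in> {1..M}" and p: "p \<in> MF k"
  shows "D_check k j (glob p) = glob (D_check_mul k j p)"
proof -
  have "mat_op (ndof k) (phi_hat k) = mat_op (ndof k) (\<lambda>l. glob (beta k l))"
    by (rule mat_op_cong) (simp add: phi_hat_eq[OF k])
  thus ?thesis unfolding D_check_def D_check_mul_def
    using mat_op_image[OF frame_beta[OF k], of glob p] lin_on_MF[OF k lin_on_glob] inj_glob p span_beta[OF k]
    by simp
qed

lemma D_check_loc_loc:
  assumes k: "k \<in> {1..M}" and i: "i \<in> {1..N}" and p: "p \<in> MF k"
  shows "D_check_loc k j i (loc i p) = loc i (D_check_mul k j p)"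
proof -
  have "mat_op (ndof k) (phi_tilde k i) = mat_op (ndof k) (\<lambda>l. loc i (beta k l))"
    by (rule mat_op_cong) (simp add: phi_tilde_eq[OF k i])
  thus ?thesis unfolding D_check_loc_def D_check_mul_def
    using mat_op_image[OF frame_beta[OF k], of "loc i" p] lin_on_MF[OF k lin_on_loc[OF i]] inj_loc p span_beta[OF k]
    by simp
qed

lemma D_mul_MF: "k \<in> {1..M} \<Longrightarrow> D_mul k j p \<in> MF k"
  unfolding D_mul_def using mat_op_in_span span_mbasis by blast

lemma D_check_mul_MF: "k \<in> {1..M} \<Longrightarrow> D_check_mul k j p \<in> MF k"
  unfolding D_check_mul_def using mat_op_in_span span_beta by blast

lemma lin_on_D_mul: "k \<in> {1..M} \<Longrightarrow> (i, j) \<in> sides k \<Longrightarrow> lin_on (MF k) (D_mul k i)"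
  unfolding D_mul_def using lin_on_mat_op[OF frame_mbasis, of k] span_mbasis[of k] D_matrices by fastforce

lemma Dcheck_mat: 
  "k \<in> {1..M} \<Longrightarrow> (i, j) \<in> sides k \<Longrightarrow> Dcheck_mat P k i \<in> carrier_mat (ndof k) (ndof k)"
  "k \<in> {1..M} \<Longrightarrow> (i, j) \<in> sides k \<Longrightarrow> Dcheck_mat P k i + Dcheck_mat P k j = 1\<^sub>m (ndof k)"
  using Dcheck_matrices by fastforce+

lemma sides_sym: "(i, j) \<in> sides k \<Longrightarrow> (j, i) \<in> sides k"
  by (auto simp: sides_def prod_eq_iff)

lemma lin_on_D_check_mul: "k \<in> {1..M} \<Longrightarrow> (i, j) \<in> sides k \<Longrightarrow> lin_on (MF k) (D_check_mul k i)"
  unfolding D_check_mul_def using lin_on_mat_op[OF frame_beta Dcheck_mat(1)] span_beta[of k] by metis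

lemma D_check_mul_partition:
  assumes k: "k \<in> {1..M}" and ij: "(i, j) \<in> sides k" and p: "p \<in> MF k"
  shows "D_check_mul k i p + D_check_mul k j p = p"
  using mat_op_add[OF frame_beta[OF k] Dcheck_mat(1)[OF k ij] Dcheck_mat(1)[OF k sides_sym[OF ij]], of p]
    Dcheck_mat(2)[OF k ij] mat_op_one[OF frame_beta[OF k], of p] p span_beta[OF k]
  by (simp add: D_check_mul_def)

section \<open>Energy of the scaled jumps\<close>

lemma lin_on_span_sum:
  assumes f: "lin_on V f" and V: "subspace V" and b: "\<And>l. l \<in> A \<Longrightarrow> b l \<in> V"
  shows "f (\<Sum>l\<in>A. c l *\<^sub>R b l) = (\<Sum>l\<in>A. c l *\<^sub>R f (b l))"
proof -
  have "f (\<Sum>l\<in>A. c l *\<^sub>R b l) = (\<Sum>l\<in>A. f (c l *\<^sub>R b l))"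
    by (rule lin_on_sum[OF f V]) (use b subspace_scale[OF V] in auto)
  also have "\<dots> = (\<Sum>l\<in>A. c l *\<^sub>R f (b l))"
    by (intro sum.cong refl lin_on_scale[OF f] b)
  finally show ?thesis .
qed

lemma beta_MF: "k \<in> {1..M} \<Longrightarrow> l < ndof k \<Longrightarrow> beta k l \<in> MF k"
  using span_beta span_base by (metis imageI lessThan_iff)

text \<open>The requirement on the primal space in terms of multipliers. Its right-hand side is the
  energy of the minimal extension of \<open>d + q\<close>, which is at most that of any multiplier
  of the subdomain with this component on interface \<open>k\<close>; thus \<open>r\<close> is
  arbitrary. The free primal part of the requirement is filled with \<open>q\<close>.\<close>

lemma adaptive_schur:
  assumes i: "i \<in> {1..N}" and k: "k \<in> ifaces_of i" and d: "d \<in> MF_Delta k" and q: "q \<in> MF_Pi k"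
    and r: "r \<in> (\<Sum>m\<in>ifaces_of i - {k}. MF m)"
    and \<Theta>: "0 \<le> \<Theta>"
  shows "schur i (D_mul k (opp k i) d) (D_mul k (opp k i) d) +
      schur (opp k i) (D_mul k i d) (D_mul k i d) \<le> \<Theta> * schur i (d + q + r) (d + q + r)"
proof -
  let ?j = "opp k i" and ?n = "ndof k" and ?m = "nDelta P k"
  have kM: "k \<in> {1..M}" using k mem_MF_sub by blast
  note o = opp[OF i k]
  have mn: "?m \<le> ?n" using splitting kM by blast
  obtain c where c: "d = (\<Sum>l<?m. c l *\<^sub>R beta k l)"
    using span_image_sums[of "{..<?m}" d "beta k"] d unfolding MF_Delta_def by blast
  obtain e where e: "q = (\<Sum>l\<in>{?m..<?n}. e l *\<^sub>R beta k l)"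
    using span_image_sums[of "{?m..<?n}" q "beta k"] q unfolding MF_Pi_def by blast
  \<comment> \<open>Primal coefficients follow the dual ones in the basis, whereas the vector
    \<open>v\<close> is indexed from 0; hence the shift by \<open>?m\<close>.\<close>
  define w v where "w = Matrix.vec ?m c" and "v = Matrix.vec (?n - ?m) (\<lambda>l. e (?m + l))"
  have dM: "d \<in> MF k" "q \<in> MF k" using d q MF_Delta_MF[OF kM] MF_Pi_MF[OF kM] by auto
  have wD: "(\<Sum>l<?m. vec_index w l *\<^sub>R phi_tilde k a l) = loc a d" if a: "a \<in> {1..N}" for a
  proof -
    have "(\<Sum>l<?m. vec_index w l *\<^sub>R phi_tilde k a l) = (\<Sum>l<?m. c l *\<^sub>R loc a (beta k l))"
      by (intro sum.cong refl) (use mn in \<open>simp add: w_def phi_tilde_eq[OF kM a]\<close>)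
    thus ?thesis unfolding c
      using lin_on_span_sum[OF lin_on_MF[OF kM lin_on_loc[OF a]] subspace_MF[OF kM], of "{..<?m}" "beta k" c]
        beta_MF[OF kM] mn by simp
  qed
  have barlin: "lin_on (MF k) (bar k i)" using lin_on_min_ext[OF i k] by (simp add: bar_def[abs_def])
  have wbD: "(\<Sum>l<?m. vec_index w l *\<^sub>R phi_bar_tilde k i l) = bar k i d"
  proof -
    have "(\<Sum>l<?m. vec_index w l *\<^sub>R phi_bar_tilde k i l) = (\<Sum>l<?m. c l *\<^sub>R bar k i (beta k l))"
      by (intro sum.cong refl) (use mn in \<open>simp add: w_def phi_bar_tilde_eq[OF i k]\<close>)
    thus ?thesis unfolding c
      using lin_on_span_sum[OF barlin subspace_MF[OF kM], of "{..<?m}" "beta k" c] beta_MF[OF kM] mn by simp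
  qed
  have wbP: "(\<Sum>l<?n - ?m. vec_index v l *\<^sub>R phi_bar_tilde k i (?m + l)) = bar k i q"
  proof -
    have "(\<Sum>l<?n - ?m. vec_index v l *\<^sub>R phi_bar_tilde k i (?m + l))
      = (\<Sum>l<?n - ?m. e (?m + l) *\<^sub>R bar k i (beta k (?m + l)))"
      by (intro sum.cong refl) (simp add: v_def phi_bar_tilde_eq[OF i k])
    also have "\<dots> = (\<Sum>l\<in>{?m..<?n}. e l *\<^sub>R bar k i (beta k l))"
      by (rule sum.reindex_bij_witness[of _ "\<lambda>l. l - ?m" "\<lambda>l. ?m + l"]) auto
    finally show ?thesis unfolding e
      using lin_on_span_sum[OF barlin subspace_MF[OF kM], of "{?m..<?n}" "beta k" e] beta_MF[OF kM] by simp
  qed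
  have wv: "w \<in> carrier_vec ?m" "v \<in> carrier_vec (?n - ?m)" by (auto simp: w_def v_def)
  have ab: "adaptive_bound \<Theta> k i ?j" using adaptive kM o(3) by blast
  have "A_loc i (D_op k ?j i (loc i d)) (D_op k ?j i (loc i d)) + A_loc ?j (D_op k i ?j (loc ?j d)) (D_op k i ?j (loc ?j d))
    \<le> \<Theta> * A_loc i (bar k i d + bar k i q) (bar k i d + bar k i q)"
    using ab[unfolded adaptive_bound_def Let_def, rule_format, OF wv]
    by (simp only: wD[OF i] wD[OF o(1)] wbD wbP)
  moreover have "A_loc i (D_op k ?j i (loc i d)) (D_op k ?j i (loc i d)) = schur i (D_mul k ?j d) (D_mul k ?j d)"
    unfolding D_op_loc[OF kM i dM(1)]
    by (rule A_loc_loc_loc[OF i]) (use D_mul_MF[OF kM] MF_subset_Lambda[OF kM] in blast)+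
  moreover have "A_loc ?j (D_op k i ?j (loc ?j d)) (D_op k i ?j (loc ?j d)) = schur ?j (D_mul k i d) (D_mul k i d)"
    unfolding D_op_loc[OF kM o(1) dM(1)]
    by (rule A_loc_loc_loc[OF o(1)]) (use D_mul_MF[OF kM] MF_subset_Lambda[OF kM] in blast)+
  ultimately have 1: "schur i (D_mul k ?j d) (D_mul k ?j d) + schur ?j (D_mul k i d) (D_mul k i d)
    \<le> \<Theta> * A_loc i (bar k i (d + q)) (bar k i (d + q))"
    using lin_on_add[OF barlin dM] by simp
  have dqM: "d + q \<in> MF k" using dM subspace_add[OF subspace_MF[OF kM]] by blast
  have dqL: "d + q \<in> Lambda" using dqM MF_subset_Lambda[OF kM] by blast
  have "d + q + min_ext k i (d + q) \<in> Lambda"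
    using min_ext(1)[OF i k dqL] rest_facts(2)[OF i k] dqL subspace_add[OF subspace_Lambda] by blast
  hence 2: "A_loc i (bar k i (d + q)) (bar k i (d + q)) =
    schur i (d + q + min_ext k i (d + q)) (d + q + min_ext k i (d + q))"
    unfolding bar_def by (intro A_loc_loc_loc[OF i])
  have 3: "\<dots> \<le> schur i (d + q + r) (d + q + r)" by (rule schur_min_ext_le[OF i k dqM r])
  show ?thesis using 1[unfolded 2] mult_left_mono[OF 3 \<Theta>] by (rule order_trans)
qed

text \<open>Through this comparison the bound required of the first scaling passes to the second
  one, which the averaging operator uses.\<close>

lemma check_schur:
  assumes i: "i \<in> {1..N}" and k: "k \<in> ifaces_of i" and d: "d \<in> MF_Delta k"
  shows "schur i (D_check_mul k (opp k i) d) (D_check_mul k (opp k i) d) +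
      schur (opp k i) (D_check_mul k i d) (D_check_mul k i d)
    \<le> schur i (D_mul k (opp k i) d) (D_mul k (opp k i) d) + schur (opp k i) (D_mul k i d) (D_mul k i d)"
proof -
  let ?j = "opp k i"
  have kM: "k \<in> {1..M}" using k mem_MF_sub by blast
  note o = opp[OF i k]
  have dM: "d \<in> MF k" using d MF_Delta_MF[OF kM] by auto
  have "W_loc_Delta k i = loc i ` MF_Delta k"
  proof -
    have "phi_tilde k i ` {..<nDelta P k} = (\<lambda>l. loc i (beta k l)) ` {..<nDelta P k}"
      by (intro image_cong refl) (use nDelta_le[OF kM] in \<open>auto simp: phi_tilde_eq[OF kM i]\<close>)
    thus ?thesis unfolding W_loc_Delta_def MF_Delta_def
      using span_image_lin_on[OF lin_on_MF[OF kM lin_on_loc[OF i]] subspace_MF[OF kM], of "{..<nDelta P k}" "beta k"]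
        beta_MF[OF kM] nDelta_le[OF kM] by fastforce
  qed
  hence "loc i d \<in> W_loc_Delta k i" using d by blast
  moreover have "check_bound k i ?j" using check kM o(3) by blast
  moreover have sw: "T_swap k i ?j (loc i d) = loc ?j d" using T_swap_loc[OF kM i o(1) dM] .
  ultimately have "A_loc i (D_check_loc k ?j i (loc i d)) (D_check_loc k ?j i (loc i d)) +
    A_loc ?j (D_check_loc k i ?j (loc ?j d)) (D_check_loc k i ?j (loc ?j d))
    \<le> A_loc i (D_op k ?j i (loc i d)) (D_op k ?j i (loc i d)) + A_loc ?j (D_op k i ?j (loc ?j d)) (D_op k i ?j (loc ?j d))"
    unfolding check_bound_def Let_def by metis
  moreover have L: "D_mul k a d \<in> Lambda" "D_check_mul k a d \<in> Lambda" for a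
    using D_mul_MF[OF kM] D_check_mul_MF[OF kM] MF_subset_Lambda[OF kM] by blast+
  ultimately show ?thesis
    by (simp only: D_op_loc[OF kM i dM] D_op_loc[OF kM o(1) dM] D_check_loc_loc[OF kM i dM]
        D_check_loc_loc[OF kM o(1) dM] A_loc_loc_loc[OF i L(1) L(1)] A_loc_loc_loc[OF i L(2) L(2)]
        A_loc_loc_loc[OF o(1) L(1) L(1)] A_loc_loc_loc[OF o(1) L(2) L(2)])
qed

end

section \<open>Coordinates on the partially coupled space\<close>

context adaptive_bddc
begin

text \<open>\<open>(d, q)\<close> are coordinates on \<open>W_tilde\<close>: \<open>d i k\<close> is the dual multiplier on interface \<open>k\<close> seen from
  subdomain \<open>i\<close>, and \<open>q k\<close> is the primal one, which both sides share.\<close>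
definition assemble :: "(nat \<Rightarrow> nat \<Rightarrow> plane \<Rightarrow> real) \<Rightarrow> (nat \<Rightarrow> plane \<Rightarrow> real) \<Rightarrow> pairfun"
  where "assemble d q = (\<Sum>i\<in>{1..N}. \<Sum>k\<in>ifaces_of i. loc i (d i k)) + (\<Sum>k\<in>{1..M}. glob (q k))"

definition dual_coords :: "nat \<Rightarrow> (nat \<Rightarrow> plane \<Rightarrow> real) \<Rightarrow> bool"
  where "dual_coords i d \<longleftrightarrow> (\<forall>k\<in>ifaces_of i. d k \<in> MF_Delta k)"

definition primal_coords :: "(nat \<Rightarrow> plane \<Rightarrow> real) \<Rightarrow> bool"
  where "primal_coords q \<longleftrightarrow> (\<forall>k\<in>{1..M}. q k \<in> MF_Pi k)"

definition tilde_coords :: "(nat \<Rightarrow> nat \<Rightarrow> plane \<Rightarrow> real) \<Rightarrow> (nat \<Rightarrow> plane \<Rightarrow> real) \<Rightarrow> bool"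
  where "tilde_coords d q \<longleftrightarrow> (\<forall>i\<in>{1..N}. dual_coords i (d i)) \<and> primal_coords q"

lemma MF_Delta_Lambda: "k \<in> {1..M} \<Longrightarrow> p \<in> MF_Delta k \<Longrightarrow> p \<in> Lambda"
  and MF_Pi_Lambda: "k \<in> {1..M} \<Longrightarrow> p \<in> MF_Pi k \<Longrightarrow> p \<in> Lambda"
  using MF_Delta_MF MF_Pi_MF MF_subset_Lambda by blast+

lemma span_glob:
  assumes k: "k \<in> {1..M}" and A: "A \<subseteq> {..<ndof k}"
  shows "span (phi_hat k ` A) = glob ` span (beta k ` A)"
proof -
  have "phi_hat k ` A = (\<lambda>l. glob (beta k l)) ` A"
    by (rule image_cong[OF refl]) (use A phi_hat_eq[OF k] in auto)
  moreover have "beta k ` A \<subseteq> MF k" using A beta_MF[OF k] by auto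
  moreover have "finite A" using A finite_subset by blast
  ultimately show ?thesis
    using span_image_lin_on[OF lin_on_MF[OF k lin_on_glob] subspace_MF[OF k]] by metis
qed

lemma W_Delta_eq: "k \<in> {1..M} \<Longrightarrow> W_Delta k = glob ` MF_Delta k"
  unfolding W_Delta_def MF_Delta_def by (rule span_glob) (use nDelta_le in force)+

lemma W_Pi_k_eq: "k \<in> {1..M} \<Longrightarrow> W_Pi_k k = glob ` MF_Pi k"
  unfolding W_Pi_k_def MF_Pi_def by (rule span_glob) auto

lemma W_eq:
  assumes k: "k \<in> {1..M}"
  shows "W k = glob ` MF k"
proof -
  have "phi k ` {..<ndof k} = (\<lambda>l. glob (mbasis P k l)) ` {..<ndof k}"
    by (rule image_cong[OF refl]) (use phi_eq[OF k] in auto)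
  moreover have "mbasis P k ` {..<ndof k} \<subseteq> MF k" using mbasis_MF[OF k] by auto
  ultimately show ?thesis unfolding W_def
    using span_image_lin_on[OF lin_on_MF[OF k lin_on_glob] subspace_MF[OF k], of "{..<ndof k}" "mbasis P k"]
      span_mbasis[OF k] by simp
qed

lemma W_loc_Delta_eq:
  assumes i: "i \<in> {1..N}" and k: "k \<in> {1..M}"
  shows "W_loc_Delta k i = loc i ` MF_Delta k"
proof -
  have "phi_tilde k i ` {..<nDelta P k} = (\<lambda>l. loc i (beta k l)) ` {..<nDelta P k}"
    by (rule image_cong[OF refl]) (use nDelta_le[OF k] in \<open>auto simp: phi_tilde_eq[OF k i]\<close>)
  moreover have "beta k ` {..<nDelta P k} \<subseteq> MF k" using nDelta_le[OF k] beta_MF[OF k] by auto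
  ultimately show ?thesis unfolding W_loc_Delta_def MF_Delta_def
    using span_image_lin_on[OF lin_on_MF[OF k lin_on_loc[OF i]] subspace_MF[OF k], of "{..<nDelta P k}" "beta k"]
    by simp
qed

lemma subspace_W_Pi: "subspace W_Pi" and subspace_W_dual: "subspace (W_dual i)"
  and subspace_W_tilde: "subspace W_tilde" and subspace_W_hat: "subspace W_hat"
  unfolding W_tilde_def W_dual_def W_Pi_def W_hat_def W_Pi_k_def W_loc_Delta_def W_def
  by (intro subspace_set_plus subspace_set_sum subspace_span)+

lemma fin_dim_W_tilde: "fin_dim W_tilde" and fin_dim_W_hat: "fin_dim W_hat"
  unfolding W_tilde_def W_dual_def W_Pi_def W_hat_def W_Pi_k_def W_loc_Delta_def W_def
  by (intro fin_dim_set_plus fin_dim_set_sum fin_dim_span finite_imageI finite_lessThan finite_atLeastLessThan)+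

lemma W_dualI:
  assumes "i \<in> {1..N}" "dual_coords i d"
  shows "(\<Sum>k\<in>ifaces_of i. loc i (d k)) \<in> W_dual i"
  unfolding W_dual_def
  by (rule set_sum_memberI[OF finite_ifaces_of])
    (use assms mem_MF_sub in \<open>auto simp: W_loc_Delta_eq dual_coords_def\<close>)

lemma image_set_sum:
  assumes fin: "finite I" and x: "x \<in> (\<Sum>k\<in>I. f ` V k)"
  shows "\<exists>d. (\<forall>k\<in>I. d k \<in> V k) \<and> x = (\<Sum>k\<in>I. f (d k))"
proof -
  obtain g where g: "\<And>k. k \<in> I \<Longrightarrow> g k \<in> f ` V k" "x = (\<Sum>k\<in>I. g k)"
    using set_sum_memberE[OF fin x] by metis
  define d where "d k = (SOME p. p \<in> V k \<and> g k = f p)" for k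
  have "d k \<in> V k \<and> g k = f (d k)" if "k \<in> I" for k
    unfolding d_def by (rule someI_ex) (use g(1)[OF that] in auto)
  thus ?thesis using g(2) by (intro exI[of _ d]) auto
qed

lemma W_dualE:
  assumes i: "i \<in> {1..N}" and x: "x \<in> W_dual i"
  shows "\<exists>d. dual_coords i d \<and> x = (\<Sum>k\<in>ifaces_of i. loc i (d k))"
proof -
  have "W_dual i = (\<Sum>k\<in>ifaces_of i. loc i ` MF_Delta k)"
    unfolding W_dual_def by (rule sum.cong[OF refl]) (use W_loc_Delta_eq[OF i] mem_MF_sub in blast)
  thus ?thesis using image_set_sum[OF finite_ifaces_of] x unfolding dual_coords_def by metis
qed

lemma W_PiI: "primal_coords q \<Longrightarrow> (\<Sum>k\<in>{1..M}. glob (q k)) \<in> W_Pi"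
  unfolding W_Pi_def by (rule set_sum_memberI) (auto simp: W_Pi_k_eq primal_coords_def)

lemma W_PiE:
  assumes x: "x \<in> W_Pi"
  shows "\<exists>q. primal_coords q \<and> x = (\<Sum>k\<in>{1..M}. glob (q k))"
proof -
  have "W_Pi = (\<Sum>k\<in>{1..M}. glob ` MF_Pi k)"
    unfolding W_Pi_def by (rule sum.cong[OF refl]) (rule W_Pi_k_eq)
  thus ?thesis using image_set_sum[of "{1..M}"] x unfolding primal_coords_def by (metis finite_atLeastAtMost)
qed

lemma tilde_coords_from_parts:
  assumes "\<And>i. i \<in> {1..N} \<Longrightarrow> f i \<in> W_dual i" "y \<in> W_Pi"
  obtains d q where "tilde_coords d q" "\<And>i. i \<in> {1..N} \<Longrightarrow> f i = (\<Sum>k\<in>ifaces_of i. loc i (d i k))"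
    "y = (\<Sum>k\<in>{1..M}. glob (q k))"
proof -
  define d where "d i = (SOME d. dual_coords i d \<and> f i = (\<Sum>k\<in>ifaces_of i. loc i (d k)))" for i
  have d: "dual_coords i (d i) \<and> f i = (\<Sum>k\<in>ifaces_of i. loc i (d i k))" if "i \<in> {1..N}" for i
    unfolding d_def by (rule someI_ex[OF W_dualE[OF that assms(1)[OF that]]])
  obtain q where "primal_coords q" "y = (\<Sum>k\<in>{1..M}. glob (q k))" using W_PiE[OF assms(2)] by blast
  thus thesis using that[of d q] d unfolding tilde_coords_def by blast
qed

lemma W_tildeI: "tilde_coords d q \<Longrightarrow> assemble d q \<in> W_tilde"
  unfolding assemble_def W_tilde_def tilde_coords_def
  by (intro set_plus_intro set_sum_memberI W_dualI W_PiI) auto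

lemma W_tildeE:
  assumes "w \<in> W_tilde"
  obtains d q where "tilde_coords d q" "w = assemble d q"
proof -
  obtain x y where xy: "w = x + y" "x \<in> (\<Sum>i\<in>{1..N}. W_dual i)" "y \<in> W_Pi"
    using assms unfolding W_tilde_def by (rule set_plus_elim)
  obtain f where f: "\<And>i. i \<in> {1..N} \<Longrightarrow> f i \<in> W_dual i" "x = (\<Sum>i\<in>{1..N}. f i)"
    using set_sum_memberE[OF _ xy(2)] by (metis finite_atLeastAtMost)
  obtain d q where "tilde_coords d q" "\<And>i. i \<in> {1..N} \<Longrightarrow> f i = (\<Sum>k\<in>ifaces_of i. loc i (d i k))"
    "y = (\<Sum>k\<in>{1..M}. glob (q k))" using tilde_coords_from_parts[OF f(1) xy(3)] by metis
  thus thesis using that[of d q] xy(1) f(2) by (simp add: assemble_def)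
qed

text \<open>The multiplier as subdomain \<open>i\<close> sees it: its own dual parts together with
  the shared primal parts. It is the second component of \<open>local_part\<close>.\<close>

definition skeleton :: "(nat \<Rightarrow> nat \<Rightarrow> plane \<Rightarrow> real) \<Rightarrow> (nat \<Rightarrow> plane \<Rightarrow> real) \<Rightarrow> nat \<Rightarrow> plane \<Rightarrow> real"
  where "skeleton d q i = (\<Sum>k\<in>ifaces_of i. d i k + q k)"

lemma tilde_coordsD:
  assumes "tilde_coords d q"
  shows "i \<in> {1..N} \<Longrightarrow> k \<in> ifaces_of i \<Longrightarrow> d i k \<in> MF_Delta k" "k \<in> {1..M} \<Longrightarrow> q k \<in> MF_Pi k"
    "i \<in> {1..N} \<Longrightarrow> k \<in> ifaces_of i \<Longrightarrow> d i k \<in> MF k" "k \<in> {1..M} \<Longrightarrow> q k \<in> MF k"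
    "i \<in> {1..N} \<Longrightarrow> k \<in> ifaces_of i \<Longrightarrow> d i k + q k \<in> MF k"
proof -
  show 1: "i \<in> {1..N} \<Longrightarrow> k \<in> ifaces_of i \<Longrightarrow> d i k \<in> MF_Delta k" "k \<in> {1..M} \<Longrightarrow> q k \<in> MF_Pi k" for i k
    using assms by (auto simp: tilde_coords_def dual_coords_def primal_coords_def)
  show 2: "i \<in> {1..N} \<Longrightarrow> k \<in> ifaces_of i \<Longrightarrow> d i k \<in> MF k" "k \<in> {1..M} \<Longrightarrow> q k \<in> MF k" for i k
    using 1 MF_Delta_MF MF_Pi_MF mem_MF_sub by blast+
  show "i \<in> {1..N} \<Longrightarrow> k \<in> ifaces_of i \<Longrightarrow> d i k + q k \<in> MF k"
    using 2 mem_MF_sub subspace_add[OF subspace_MF] by blast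
qed

lemma skeleton_Lambda_loc: "tilde_coords d q \<Longrightarrow> i \<in> {1..N} \<Longrightarrow> skeleton d q i \<in> Lambda_loc i"
  unfolding skeleton_def Lambda_loc_def by (rule set_sum_memberI[OF finite_ifaces_of]) (rule tilde_coordsD(5))

lemma Lambda_loc_Lambda: "p \<in> Lambda_loc i \<Longrightarrow> p \<in> Lambda"
  using set_sum_MF_subset_Lambda[OF ifaces_of_subset] unfolding Lambda_loc_def by blast

text \<open>A primal multiplier extends by zero into subdomains not adjacent to its interface.
  Regrouping by subdomain therefore leaves one extension of one multiplier in each.\<close>

lemma fst_assemble:
  assumes c: "tilde_coords d q"
  shows "fst (assemble d q) = (\<Sum>i\<in>{1..N}. ext i (skeleton d q i))"
proof -
  note D = tilde_coordsD[OF c]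
  have "fst (assemble d q) = (\<Sum>i\<in>{1..N}. (\<Sum>k\<in>ifaces_of i. ext i (d i k)) + (\<Sum>k\<in>{1..M}. ext i (q k)))"
    by (simp add: assemble_def loc_def glob_def fst_sum sum.distrib sum.swap[of _ "{1..M}" "{1..N}"])
  also have "\<dots> = (\<Sum>i\<in>{1..N}. ext i (skeleton d q i))"
  proof (rule sum.cong[OF refl])
    fix i assume i: "i \<in> {1..N}"
    have L: "d i k \<in> Lambda" "q k \<in> Lambda" "d i k + q k \<in> Lambda" if "k \<in> ifaces_of i" for k
      using D(3,5)[OF i that] D(4)[OF mem_MF_sub[OF that]] MF_subset_Lambda[OF mem_MF_sub[OF that]] by auto
    have "(\<Sum>k\<in>{1..M}. ext i (q k)) = (\<Sum>k\<in>ifaces_of i. ext i (q k))"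
      by (rule sum.mono_neutral_right) (use ifaces_of_subset ext_not_side[OF i] D(4) in auto)
    moreover have "ext i (skeleton d q i) = (\<Sum>k\<in>ifaces_of i. ext i (d i k + q k))"
      unfolding skeleton_def by (rule lin_on_sum[OF lin_on_ext[OF i] subspace_Lambda L(3)])
    moreover have "\<dots> = (\<Sum>k\<in>ifaces_of i. ext i (d i k) + ext i (q k))"
      by (rule sum.cong[OF refl]) (use lin_on_add[OF lin_on_ext[OF i]] L in blast)
    ultimately show "(\<Sum>k\<in>ifaces_of i. ext i (d i k)) + (\<Sum>k\<in>{1..M}. ext i (q k)) = ext i (skeleton d q i)"
      by (simp add: sum.distrib)
  qed
  finally show ?thesis .
qed

text \<open>Disjoint supports separate the interfaces, and on each interface the dual and primal
  spans are independent.\<close>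

lemma skeleton_eq_zero:
  assumes c: "tilde_coords d q" and z: "\<And>i. i \<in> {1..N} \<Longrightarrow> skeleton d q i = 0"
  shows "i \<in> {1..N} \<Longrightarrow> k \<in> ifaces_of i \<Longrightarrow> d i k = 0" "k \<in> {1..M} \<Longrightarrow> q k = 0"
proof -
  note D = tilde_coordsD[OF c]
  have *: "d i k = 0 \<and> q k = 0" if i: "i \<in> {1..N}" and k: "k \<in> ifaces_of i" for i k
  proof -
    have "d i k + q k = 0"
      by (rule MF_sum_eq_zero[OF ifaces_of_subset _ _ k, of "\<lambda>k. d i k + q k"])
        (use D(5)[OF i] z[OF i] in \<open>auto simp: skeleton_def\<close>)
    thus ?thesis using MF_Delta_MF_Pi_zero[OF mem_MF_sub[OF k] D(1)[OF i k] D(2)[OF mem_MF_sub[OF k]]] by blast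
  qed
  show "i \<in> {1..N} \<Longrightarrow> k \<in> ifaces_of i \<Longrightarrow> d i k = 0" using * by blast
  show "k \<in> {1..M} \<Longrightarrow> q k = 0" using *[OF iface_sides(3) fst_snd_ifaces(1)] by blast
qed

text \<open>Directness of the decomposition of \<open>W_tilde\<close>. The second component is not
  enough, because the dual parts of the two sides of an interface add up there. The first component
  separates the subdomains, and \<open>ext_eq_zero\<close> recovers each skeleton from it.\<close>

lemma assemble_eq_zero:
  assumes c: "tilde_coords d q" and z: "assemble d q = 0"
  shows "i \<in> {1..N} \<Longrightarrow> k \<in> ifaces_of i \<Longrightarrow> d i k = 0" "k \<in> {1..M} \<Longrightarrow> q k = 0"
proof -
  have eX: "ext i (skeleton d q i) \<in> X i" if "i \<in> {1..N}" for i
    using ext_harmonic(1)[OF that Lambda_loc_Lambda[OF skeleton_Lambda_loc[OF c that]]] .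
  have "skeleton d q i = 0" if i: "i \<in> {1..N}" for i
  proof -
    have s0: "(\<Sum>i\<in>{1..N}. ext i (skeleton d q i)) = 0" using fst_assemble[OF c] z by simp
    have "ext i (skeleton d q i) x = 0 x" for x
      using sum_X_apply[OF i eX, of x] X_outside[OF eX[OF i], of x] s0 by (cases "x \<in> Sub P i") auto
    hence "ext i (skeleton d q i) = 0" by (rule ext)
    thus ?thesis using ext_eq_zero[OF i skeleton_Lambda_loc[OF c i]] by blast
  qed
  note s = skeleton_eq_zero[OF c this]
  show "i \<in> {1..N} \<Longrightarrow> k \<in> ifaces_of i \<Longrightarrow> d i k = 0" "k \<in> {1..M} \<Longrightarrow> q k = 0" using s by blast+
qed

lemma R_assemble:
  assumes c: "tilde_coords d q"
  shows "i \<in> {1..N} \<Longrightarrow> R_Delta i (assemble d q) = (\<Sum>k\<in>ifaces_of i. loc i (d i k))"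
    and "R_Pi (assemble d q) = (\<Sum>k\<in>{1..M}. glob (q k))"
proof -
  let ?I = "insert None (Some ` {1..N})"
  define D where "D = case_option (\<Sum>k\<in>{1..M}. glob (q k)) (\<lambda>i. \<Sum>k\<in>ifaces_of i. loc i (d i k))"
  have sumD: "(\<Sum>j\<in>?I. D j) = assemble d q"
    unfolding sum_insert_None by (simp add: D_def assemble_def)
  have proj: "dsum_proj ?I (case_option W_Pi W_dual) j (\<Sum>j\<in>?I. D j) = D j" if "j \<in> ?I" for j
  proof (rule dsum_proj_eq[OF _ _ _ _ that])
    show "finite ?I" by simp
    show "subspace (case_option W_Pi W_dual j)" for j
      using subspace_W_Pi subspace_W_dual by (cases j) auto
    show "D j \<in> case_option W_Pi W_dual j" if "j \<in> ?I" for j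
      using that c W_PiI W_dualI by (auto simp: D_def tilde_coords_def)
  next
    fix e :: "nat option \<Rightarrow> pairfun" and j
    assume e: "\<And>j. j \<in> ?I \<Longrightarrow> e j \<in> case_option W_Pi W_dual j" and z: "(\<Sum>j\<in>?I. e j) = 0" and j: "j \<in> ?I"
    have eS: "e (Some i) \<in> W_dual i" if "i \<in> {1..N}" for i using e[of "Some i"] that by auto
    have eN: "e None \<in> W_Pi" using e[of None] by simp
    obtain d' q' where d': "tilde_coords d' q'" "\<And>i. i \<in> {1..N} \<Longrightarrow> e (Some i) = (\<Sum>k\<in>ifaces_of i. loc i (d' i k))"
      "e None = (\<Sum>k\<in>{1..M}. glob (q' k))"
      using tilde_coords_from_parts[of "\<lambda>i. e (Some i)" "e None"] eS eN by metis
    have "assemble d' q' = 0" using z d'(2,3) unfolding sum_insert_None by (simp add: assemble_def add.commute)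
    note zz = assemble_eq_zero[OF d'(1) this]
    have "e (Some i) = 0" if "i \<in> {1..N}" for i
      unfolding d'(2)[OF that]
      by (rule sum.neutral) (use zz(1)[OF that] lin_on_zero[OF lin_on_loc[OF that] subspace_Lambda] in auto)
    moreover have "e None = 0" unfolding d'(3)
      by (rule sum.neutral) (use zz(2) lin_on_zero[OF lin_on_glob subspace_Lambda] in auto)
    ultimately show "e j = 0" using j by auto
  qed
  show "R_Delta i (assemble d q) = (\<Sum>k\<in>ifaces_of i. loc i (d i k))" if "i \<in> {1..N}"
    using proj[of "Some i"] that unfolding sumD by (simp add: R_Delta_def D_def)
  show "R_Pi (assemble d q) = (\<Sum>k\<in>{1..M}. glob (q k))"
    using proj[of None] unfolding sumD by (simp add: R_Pi_def D_def)
qed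

text \<open>Within a single subdomain the multiplier component does separate the summands, as each
  interface occurs once.\<close>

lemma R_k_Delta_sum:
  assumes i: "i \<in> {1..N}" and d: "dual_coords i d" and k: "k \<in> ifaces_of i"
  shows "R_k_Delta i k (\<Sum>m\<in>ifaces_of i. loc i (d m)) = loc i (d k)"
  unfolding R_k_Delta_def
proof (rule dsum_proj_eq[OF finite_ifaces_of _ _ _ k])
  show "subspace (W_loc_Delta m i)" for m unfolding W_loc_Delta_def by (rule subspace_span)
  show "loc i (d m) \<in> W_loc_Delta m i" if "m \<in> ifaces_of i" for m
    using d that W_loc_Delta_eq[OF i mem_MF_sub[OF that]] by (auto simp: dual_coords_def)
next
  fix e m assume e: "\<And>m. m \<in> ifaces_of i \<Longrightarrow> e m \<in> W_loc_Delta m i" and z: "sum e (ifaces_of i) = 0"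
    and m: "m \<in> ifaces_of i"
  have el: "e m = loc i (snd (e m)) \<and> snd (e m) \<in> MF m" if "m \<in> ifaces_of i" for m
    using e[OF that] W_loc_Delta_eq[OF i mem_MF_sub[OF that]] MF_Delta_MF[OF mem_MF_sub[OF that]] by auto
  have "snd (sum e (ifaces_of i)) = 0" using z by simp
  hence "(\<Sum>m\<in>ifaces_of i. snd (e m)) = 0" by (simp add: snd_sum)
  hence "snd (e m) = 0" using MF_sum_eq_zero[OF ifaces_of_subset _ _ m, of "\<lambda>m. snd (e m)"] el by blast
  thus "e m = 0" using el[OF m] lin_on_zero[OF lin_on_loc[OF i] subspace_Lambda] by metis
qed

lemma R_k_Pi_sum:
  assumes q: "primal_coords q" and k: "k \<in> {1..M}"
  shows "R_k_Pi k (\<Sum>m\<in>{1..M}. glob (q m)) = glob (q k)"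
  unfolding R_k_Pi_def
proof (rule dsum_proj_eq[OF _ _ _ _ k])
  show "subspace (W_Pi_k m)" for m unfolding W_Pi_k_def by (rule subspace_span)
  show "glob (q m) \<in> W_Pi_k m" if "m \<in> {1..M}" for m
    using q that W_Pi_k_eq[OF that] by (auto simp: primal_coords_def)
next
  fix e m assume e: "\<And>m. m \<in> {1..M} \<Longrightarrow> e m \<in> W_Pi_k m" and z: "sum e {1..M} = 0" and m: "m \<in> {1..M}"
  have el: "e m = glob (snd (e m)) \<and> snd (e m) \<in> MF m" if "m \<in> {1..M}" for m
    using e[OF that] W_Pi_k_eq[OF that] MF_Pi_MF[OF that] by auto
  have "snd (sum e {1..M}) = 0" using z by simp
  hence "(\<Sum>m\<in>{1..M}. snd (e m)) = 0" by (simp add: snd_sum)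
  hence "snd (e m) = 0" using MF_sum_eq_zero[OF order_refl _ _ m, of "\<lambda>m. snd (e m)"] el by blast
  thus "e m = 0" using el[OF m] lin_on_zero[OF lin_on_glob subspace_Lambda] by metis
qed simp

lemma local_part_assemble:
  assumes c: "tilde_coords d q" and i: "i \<in> {1..N}"
  shows "local_part i (assemble d q) = loc i (skeleton d q i)"
proof -
  note D = tilde_coordsD[OF c]
  have "local_part i (assemble d q) = (\<Sum>k\<in>ifaces_of i. loc i (d i k) + T_to_loc k i (glob (q k)))"
    unfolding local_part_def R_assemble(1)[OF c i] R_assemble(2)[OF c]
    by (rule sum.cong[OF refl]) (use c i R_k_Delta_sum R_k_Pi_sum mem_MF_sub in \<open>auto simp: tilde_coords_def\<close>)
  also have "\<dots> = (\<Sum>k\<in>ifaces_of i. loc i (d i k + q k))"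
  proof (rule sum.cong[OF refl])
    fix k assume k: "k \<in> ifaces_of i"
    note kM = mem_MF_sub[OF k]
    show "loc i (d i k) + T_to_loc k i (glob (q k)) = loc i (d i k + q k)"
      using T_to_loc_glob[OF kM i D(4)[OF kM]] D(3)[OF i k] D(4)[OF kM] MF_subset_Lambda[OF kM]
        lin_on_add[OF lin_on_loc[OF i]] by simp
  qed
  also have "\<dots> = loc i (skeleton d q i)"
    unfolding skeleton_def
    by (rule lin_on_sum[OF lin_on_loc[OF i] subspace_Lambda, symmetric])
      (use D(5)[OF i] MF_subset_Lambda mem_MF_sub in blast)
  finally show ?thesis .
qed

lemma A_tilde_assemble:
  assumes c: "tilde_coords d q" and c': "tilde_coords d' q'"
  shows "A_tilde (assemble d q) (assemble d' q') = (\<Sum>i=1..N. schur i (skeleton d q i) (skeleton d' q' i))"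
  unfolding A_tilde_def
  by (rule sum.cong[OF refl])
    (simp add: local_part_assemble[OF c] local_part_assemble[OF c'] A_loc_loc_loc
      Lambda_loc_Lambda[OF skeleton_Lambda_loc[OF c]] Lambda_loc_Lambda[OF skeleton_Lambda_loc[OF c']])

lemma tilde_coords_linear:
  assumes c: "tilde_coords d q" and c': "tilde_coords d' q'"
  shows "tilde_coords (\<lambda>i k. d i k + d' i k) (\<lambda>k. q k + q' k)"
    "tilde_coords (\<lambda>i k. r *\<^sub>R d i k) (\<lambda>k. r *\<^sub>R q k)"
    "assemble (\<lambda>i k. d i k + d' i k) (\<lambda>k. q k + q' k) = assemble d q + assemble d' q'"
    "assemble (\<lambda>i k. r *\<^sub>R d i k) (\<lambda>k. r *\<^sub>R q k) = r *\<^sub>R assemble d q"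
    "skeleton (\<lambda>i k. d i k + d' i k) (\<lambda>k. q k + q' k) i = skeleton d q i + skeleton d' q' i"
    "skeleton (\<lambda>i k. r *\<^sub>R d i k) (\<lambda>k. r *\<^sub>R q k) i = r *\<^sub>R skeleton d q i"
proof -
  show "tilde_coords (\<lambda>i k. d i k + d' i k) (\<lambda>k. q k + q' k)" "tilde_coords (\<lambda>i k. r *\<^sub>R d i k) (\<lambda>k. r *\<^sub>R q k)"
    using c c' subspace_add[OF subspace_MF_Delta] subspace_add[OF subspace_MF_Pi] subspace_scale[OF subspace_MF_Delta]
      subspace_scale[OF subspace_MF_Pi]
    unfolding tilde_coords_def dual_coords_def primal_coords_def by blast+
  have L: "d i k \<in> Lambda" "d' i k \<in> Lambda" if "i \<in> {1..N}" "k \<in> ifaces_of i" for i k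
    using tilde_coordsD(3)[OF c that] tilde_coordsD(3)[OF c' that] MF_subset_Lambda[OF mem_MF_sub[OF that(2)]] by auto
  have Lq: "q k \<in> Lambda" "q' k \<in> Lambda" if "k \<in> {1..M}" for k
    using tilde_coordsD(4)[OF c that] tilde_coordsD(4)[OF c' that] MF_subset_Lambda[OF that] by auto
  have "(\<Sum>i\<in>{1..N}. \<Sum>k\<in>ifaces_of i. loc i (d i k + d' i k)) =
    (\<Sum>i\<in>{1..N}. \<Sum>k\<in>ifaces_of i. loc i (d i k) + loc i (d' i k))"
    by (intro sum.cong refl lin_on_add[OF lin_on_loc] L)
  moreover have "(\<Sum>k\<in>{1..M}. glob (q k + q' k)) = (\<Sum>k\<in>{1..M}. glob (q k) + glob (q' k))"
    by (intro sum.cong refl lin_on_add[OF lin_on_glob] Lq)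
  ultimately show "assemble (\<lambda>i k. d i k + d' i k) (\<lambda>k. q k + q' k) = assemble d q + assemble d' q'"
    by (simp add: assemble_def sum.distrib)
  have "(\<Sum>i\<in>{1..N}. \<Sum>k\<in>ifaces_of i. loc i (r *\<^sub>R d i k)) =
    (\<Sum>i\<in>{1..N}. \<Sum>k\<in>ifaces_of i. r *\<^sub>R loc i (d i k))"
    by (intro sum.cong refl lin_on_scale[OF lin_on_loc] L)
  moreover have "(\<Sum>k\<in>{1..M}. glob (r *\<^sub>R q k)) = (\<Sum>k\<in>{1..M}. r *\<^sub>R glob (q k))"
    by (intro sum.cong refl lin_on_scale[OF lin_on_glob] Lq)
  ultimately show "assemble (\<lambda>i k. r *\<^sub>R d i k) (\<lambda>k. r *\<^sub>R q k) = r *\<^sub>R assemble d q"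
    by (simp add: assemble_def scaleR_add_right scaleR_sum_right)
  show "skeleton (\<lambda>i k. d i k + d' i k) (\<lambda>k. q k + q' k) i = skeleton d q i + skeleton d' q' i"
    unfolding skeleton_def sum.distrib[symmetric] by (rule sum.cong[OF refl]) (simp add: ac_simps)
  show "skeleton (\<lambda>i k. r *\<^sub>R d i k) (\<lambda>k. r *\<^sub>R q k) i = r *\<^sub>R skeleton d q i"
    unfolding skeleton_def scaleR_sum_right by (simp add: scaleR_add_right)
qed

text \<open>Each local energy is definite in its own skeleton, and the skeletons together determine
  all coordinates by \<open>skeleton_eq_zero\<close>.\<close>

lemma spd_A_tilde: "spd_on W_tilde A_tilde"
proof (rule spd_onI)
  fix x y assume "x \<in> W_tilde" "y \<in> W_tilde"
  thus "A_tilde x y = A_tilde y x"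
    by (elim W_tildeE) (simp add: A_tilde_assemble schur_sym)
next
  fix x y z assume "x \<in> W_tilde" "y \<in> W_tilde" "z \<in> W_tilde"
  then obtain d q d' q' e r where c: "tilde_coords d q" "x = assemble d q" "tilde_coords d' q'" "y = assemble d' q'"
    "tilde_coords e r" "z = assemble e r" by (meson W_tildeE)
  note l = tilde_coords_linear[OF c(1,3)]
  have "schur i (skeleton d q i + skeleton d' q' i) (skeleton e r i) =
    schur i (skeleton d q i) (skeleton e r i) + schur i (skeleton d' q' i) (skeleton e r i)" if i: "i \<in> {1..N}" for i
    by (rule lin_on_add[OF lin_on_schur_left[OF i]])
      (use Lambda_loc_Lambda skeleton_Lambda_loc c i in blast)+
  thus "A_tilde (x + y) z = A_tilde x z + A_tilde y z"
    unfolding c(2,4,6) l(3)[symmetric] A_tilde_assemble[OF l(1) c(5)] A_tilde_assemble[OF c(1,5)]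
      A_tilde_assemble[OF c(3,5)] l(5) by (simp add: sum.distrib)
next
  fix s x z assume "x \<in> W_tilde" "z \<in> W_tilde"
  then obtain d q e r where c: "tilde_coords d q" "x = assemble d q" "tilde_coords e r" "z = assemble e r"
    by (meson W_tildeE)
  note l = tilde_coords_linear[OF c(1,1)]
  have "schur i (s *\<^sub>R skeleton d q i) (skeleton e r i) = s *\<^sub>R schur i (skeleton d q i) (skeleton e r i)" if i: "i \<in> {1..N}" for i
    by (rule lin_on_scale[OF lin_on_schur_left[OF i]])
      (use Lambda_loc_Lambda skeleton_Lambda_loc c i in blast)+
  thus "A_tilde (s *\<^sub>R x) z = s * A_tilde x z"
    unfolding c(2,4) l(4)[symmetric] A_tilde_assemble[OF l(2) c(3)] A_tilde_assemble[OF c(1,3)] l(6)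
    by (simp add: sum_distrib_left)
next
  fix x assume x: "x \<in> W_tilde" "x \<noteq> 0"
  then obtain d q where c: "tilde_coords d q" "x = assemble d q" by (meson W_tildeE)
  have nn: "0 \<le> schur i (skeleton d q i) (skeleton d q i)" if "i \<in> {1..N}" for i
    using schur_nonneg[OF that Lambda_loc_Lambda[OF skeleton_Lambda_loc[OF c(1) that]]] .
  have "\<exists>i\<in>{1..N}. skeleton d q i \<noteq> 0"
  proof (rule ccontr)
    assume "\<not> ?thesis"
    hence "skeleton d q i = 0" if "i \<in> {1..N}" for i using that by blast
    note z = skeleton_eq_zero[OF c(1) this]
    have "(\<Sum>i\<in>{1..N}. \<Sum>k\<in>ifaces_of i. loc i (d i k)) = 0"
      by (intro sum.neutral ballI) (use z(1) lin_on_zero[OF lin_on_loc subspace_Lambda] in auto)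
    moreover have "(\<Sum>k\<in>{1..M}. glob (q k)) = 0"
      by (intro sum.neutral ballI) (use z(2) lin_on_zero[OF lin_on_glob subspace_Lambda] in auto)
    ultimately show False using x(2) c(2) by (simp add: assemble_def)
  qed
  then obtain i where i: "i \<in> {1..N}" "skeleton d q i \<noteq> 0" by blast
  have "0 < schur i (skeleton d q i) (skeleton d q i)"
    using spd_on_pos[OF spd_schur[OF i(1)] skeleton_Lambda_loc[OF c(1) i(1)] i(2)] .
  thus "0 < A_tilde x x"
    unfolding c(2) A_tilde_assemble[OF c(1,1)] using i(1) nn by (intro sum_pos2[of _ i]) auto
qed

end

section \<open>The averaging operator and the condition number\<close>

text \<open>Riesz representation inside \<open>V\<close> of the functional
  \<open>\<lambda>v. ip (L v) y\<close> gives existence, definiteness on \<open>V\<close>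
  uniqueness.\<close>

lemma adjoint_on_eq:
  assumes V: "fin_dim V" "subspace V" and U: "subspace U" "V \<subseteq> U" and ip: "spd_on U ip"
    and L: "lin_on V L" "\<And>v. v \<in> V \<Longrightarrow> L v \<in> U" and y: "y \<in> U"
  shows "adjoint_on ip V L y \<in> V" "v \<in> V \<Longrightarrow> ip (L v) y = ip v (adjoint_on ip V L y)"
proof -
  have ipV: "spd_on V ip" using spd_on_subset[OF ip U(2)] .
  have "lin_on V (\<lambda>v. ip (L v) y)"
    using lin_on_add[OF L(1)] lin_on_scale[OF L(1)] lin_on_add[OF spd_on_lin[OF ip y]]
      lin_on_scale[OF spd_on_lin[OF ip y]] L(2) by (intro lin_onI) simp_all
  then obtain x where x: "x \<in> V" "\<forall>v\<in>V. ip x v = ip (L v) y"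
    using riesz_subspace[OF V ipV] by blast
  have x': "\<forall>v\<in>V. ip (L v) y = ip v x" using x spd_on_sym[OF ipV] by metis
  have "adjoint_on ip V L y = x"
    unfolding adjoint_on_def
  proof (rule the_equality)
    fix z assume z: "z \<in> V \<and> (\<forall>v\<in>V. ip (L v) y = ip v z)"
    show "z = x"
      by (rule spd_on_unique[OF ipV V(2)]) (use z x x' spd_on_sym[OF ipV] in metis)+
  qed (use x x' in blast)
  thus "adjoint_on ip V L y \<in> V" "v \<in> V \<Longrightarrow> ip (L v) y = ip v (adjoint_on ip V L y)" using x x' by auto
qed

context adaptive_bddc
begin

lemma MF_split_family:
  assumes "\<And>k. k \<in> {1..M} \<Longrightarrow> p k \<in> MF k"
  obtains d q where "\<And>k. k \<in> {1..M} \<Longrightarrow> d k \<in> MF_Delta k" "primal_coords q" "\<And>k. k \<in> {1..M} \<Longrightarrow> p k = d k + q k"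
proof -
  have "\<forall>k\<in>{1..M}. \<exists>z. fst z \<in> MF_Delta k \<and> snd z \<in> MF_Pi k \<and> p k = fst z + snd z"
    using MF_split[OF _ assms] by (metis fst_conv snd_conv)
  then obtain z where "\<forall>k\<in>{1..M}. fst (z k) \<in> MF_Delta k \<and> snd (z k) \<in> MF_Pi k \<and> p k = fst (z k) + snd (z k)"
    using bchoice by meson
  thus thesis using that[of "\<lambda>k. fst (z k)" "\<lambda>k. snd (z k)"] by (simp add: primal_coords_def)
qed

lemma glob_sum:
  assumes "\<And>k. k \<in> {1..M} \<Longrightarrow> p k \<in> MF k"
  shows "glob (\<Sum>k\<in>{1..M}. p k) = (\<Sum>k\<in>{1..M}. glob (p k))"
  by (rule lin_on_sum[OF lin_on_glob subspace_Lambda]) (use assms MF_subset_Lambda in blast)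

lemma W_hatI: "(\<And>k. k \<in> {1..M} \<Longrightarrow> p k \<in> MF k) \<Longrightarrow> glob (\<Sum>k\<in>{1..M}. p k) \<in> W_hat"
  unfolding W_hat_def by (subst glob_sum) (auto intro!: set_sum_memberI simp: W_eq)

lemma W_hatE:
  assumes "w \<in> W_hat"
  obtains p where "\<And>k. k \<in> {1..M} \<Longrightarrow> p k \<in> MF k" "w = glob (\<Sum>k\<in>{1..M}. p k)"
proof -
  have "W_hat = (\<Sum>k\<in>{1..M}. glob ` MF k)"
    unfolding W_hat_def by (rule sum.cong[OF refl]) (rule W_eq)
  then obtain p where p: "\<forall>k\<in>{1..M}. p k \<in> MF k" "w = (\<Sum>k\<in>{1..M}. glob (p k))"
    using image_set_sum[of "{1..M}" w glob MF] assms by auto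
  thus thesis using that[of p] glob_sum[of p] by simp
qed

text \<open>In contrast to \<open>W_tilde\<close>, each interface carries a single dual multiplier
  here, so the second component alone shows that the sum is direct.\<close>

lemma hat_parts:
  assumes d: "\<And>k. k \<in> {1..M} \<Longrightarrow> d k \<in> MF_Delta k" and q: "primal_coords q"
  shows "k \<in> {1..M} \<Longrightarrow> hat_Delta k (glob (\<Sum>m\<in>{1..M}. d m + q m)) = glob (d k)"
    and "hat_Pi (glob (\<Sum>m\<in>{1..M}. d m + q m)) = (\<Sum>m\<in>{1..M}. glob (q m))"
proof -
  let ?I = "insert None (Some ` {1..M})"
  define D where "D = case_option (\<Sum>k\<in>{1..M}. glob (q k)) (\<lambda>k. glob (d k))"
  have L: "d k \<in> Lambda" "q k \<in> Lambda" if "k \<in> {1..M}" for k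
    using d[OF that] q that MF_Delta_Lambda[OF that] MF_Pi_Lambda[OF that] by (auto simp: primal_coords_def)
  have "glob (\<Sum>m\<in>{1..M}. d m + q m) = (\<Sum>m\<in>{1..M}. glob (d m + q m))"
    by (rule lin_on_sum[OF lin_on_glob subspace_Lambda]) (use L subspace_add[OF subspace_Lambda] in blast)
  also have "\<dots> = (\<Sum>m\<in>{1..M}. glob (d m) + glob (q m))"
    by (rule sum.cong[OF refl]) (rule lin_on_add[OF lin_on_glob L])
  finally have sumD: "(\<Sum>j\<in>?I. D j) = glob (\<Sum>m\<in>{1..M}. d m + q m)"
    unfolding sum_insert_None by (simp add: D_def sum.distrib add.commute)
  have proj: "dsum_proj ?I (case_option W_Pi W_Delta) j (\<Sum>j\<in>?I. D j) = D j" if "j \<in> ?I" for j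
  proof (rule dsum_proj_eq[OF _ _ _ _ that])
    show "finite ?I" by simp
    show "subspace (case_option W_Pi W_Delta j)" for j
      using subspace_W_Pi by (cases j) (auto simp: W_Delta_def)
    show "D j \<in> case_option W_Pi W_Delta j" if "j \<in> ?I" for j
      using that W_PiI[OF q] d W_Delta_eq by (auto simp: D_def)
  next
    fix e :: "nat option \<Rightarrow> pairfun" and j
    assume e: "\<And>j. j \<in> ?I \<Longrightarrow> e j \<in> case_option W_Pi W_Delta j" and z: "(\<Sum>j\<in>?I. e j) = 0" and j: "j \<in> ?I"
    have eS: "e (Some k) = glob (snd (e (Some k))) \<and> snd (e (Some k)) \<in> MF_Delta k" if "k \<in> {1..M}" for k
      using e[of "Some k"] that W_Delta_eq[OF that] by auto
    have eN: "e None \<in> W_Pi" using e[of None] by simp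
    obtain q' where q': "primal_coords q'" "e None = (\<Sum>k\<in>{1..M}. glob (q' k))" using W_PiE[OF eN] by blast
    have "snd (\<Sum>j\<in>?I. e j) = 0" using z by simp
    hence "(\<Sum>k\<in>{1..M}. snd (e (Some k)) + q' k) = 0"
      unfolding sum_insert_None by (simp add: q'(2) snd_sum sum.distrib add.commute)
    moreover have "snd (e (Some k)) + q' k \<in> MF k" if "k \<in> {1..M}" for k
      using eS[OF that] q'(1) that MF_Delta_MF[OF that] MF_Pi_MF[OF that] subspace_add[OF subspace_MF[OF that]]
      unfolding primal_coords_def by blast
    ultimately have "snd (e (Some k)) + q' k = 0" if "k \<in> {1..M}" for k
      using MF_sum_eq_zero[OF order_refl _ _ that, of "\<lambda>k. snd (e (Some k)) + q' k"] by blast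
    hence zz: "snd (e (Some k)) = 0 \<and> q' k = 0" if "k \<in> {1..M}" for k
      using MF_Delta_MF_Pi_zero[OF that] eS[OF that] q'(1) that unfolding primal_coords_def by blast
    note g0 = lin_on_zero[OF lin_on_glob subspace_Lambda]
    have "e (Some k) = 0" if "k \<in> {1..M}" for k using eS[OF that] zz[OF that] g0 by metis
    moreover have "e None = 0" unfolding q'(2)
      by (rule sum.neutral) (use zz g0 in auto)
    ultimately show "e j = 0" using j by auto
  qed
  show "hat_Delta k (glob (\<Sum>m\<in>{1..M}. d m + q m)) = glob (d k)" if "k \<in> {1..M}"
    using proj[of "Some k"] that unfolding sumD by (simp add: hat_Delta_def D_def)
  show "hat_Pi (glob (\<Sum>m\<in>{1..M}. d m + q m)) = (\<Sum>m\<in>{1..M}. glob (q m))"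
    using proj[of None] unfolding sumD by (simp add: hat_Pi_def D_def)
qed

lemma const_tilde_coords:
  "(\<And>k. k \<in> {1..M} \<Longrightarrow> d k \<in> MF_Delta k) \<Longrightarrow> primal_coords q \<Longrightarrow> tilde_coords (\<lambda>i. d) q"
  using mem_MF_sub by (auto simp: tilde_coords_def dual_coords_def)

text \<open>\<open>W_hat\<close> sits in \<open>W_tilde\<close> as the coordinates whose dual
  multipliers agree on the two sides; each \<open>T_to_loc\<close> supplies one copy.\<close>

lemma I_Gamma_glob:
  assumes d: "\<And>k. k \<in> {1..M} \<Longrightarrow> d k \<in> MF_Delta k" and q: "primal_coords q"
  shows "I_Gamma (glob (\<Sum>k\<in>{1..M}. d k + q k)) = assemble (\<lambda>i. d) q"
proof -
  have "(\<Sum>k=1..M. T_to_loc k (fst (iface P k)) (hat_Delta k (glob (\<Sum>k\<in>{1..M}. d k + q k))) +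
      T_to_loc k (snd (iface P k)) (hat_Delta k (glob (\<Sum>k\<in>{1..M}. d k + q k)))) =
    (\<Sum>k=1..M. loc (fst (iface P k)) (d k) + loc (snd (iface P k)) (d k))"
  proof (rule sum.cong[OF refl])
    fix k assume k: "k \<in> {1..M}"
    have "d k \<in> MF k" using d[OF k] MF_Delta_MF[OF k] by blast
    thus "T_to_loc k (fst (iface P k)) (hat_Delta k (glob (\<Sum>k\<in>{1..M}. d k + q k))) +
      T_to_loc k (snd (iface P k)) (hat_Delta k (glob (\<Sum>k\<in>{1..M}. d k + q k))) =
      loc (fst (iface P k)) (d k) + loc (snd (iface P k)) (d k)"
      using hat_parts(1)[OF d q k] T_to_loc_glob[OF k] iface_sides(3,4)[OF k] by simp
  qed
  also have "\<dots> = (\<Sum>i\<in>{1..N}. \<Sum>k\<in>ifaces_of i. loc i (d k))"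
    using sum_sides[of "\<lambda>i k. loc i (d k)"] by simp
  finally show ?thesis
    using hat_parts(2)[of d q, OF d q] by (simp add: I_Gamma_def assemble_def add.commute)
qed

lemma skeleton_const: "(\<And>k. k \<in> {1..M} \<Longrightarrow> p k = d k + q k) \<Longrightarrow> skeleton (\<lambda>i. d) q i = (\<Sum>k\<in>ifaces_of i. p k)"
  unfolding skeleton_def by (rule sum.cong[OF refl]) (use mem_MF_sub in auto)

lemma I_Gamma_coords:
  assumes p: "\<And>k. k \<in> {1..M} \<Longrightarrow> p k \<in> MF k"
  obtains d q where "\<And>k. k \<in> {1..M} \<Longrightarrow> d k \<in> MF_Delta k" "primal_coords q"
    "tilde_coords (\<lambda>i. d) q" "glob (\<Sum>k\<in>{1..M}. p k) = glob (\<Sum>k\<in>{1..M}. d k + q k)"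
    "I_Gamma (glob (\<Sum>k\<in>{1..M}. p k)) = assemble (\<lambda>i. d) q" "\<And>i. skeleton (\<lambda>i. d) q i = (\<Sum>k\<in>ifaces_of i. p k)"
proof -
  obtain d q where dq: "\<And>k. k \<in> {1..M} \<Longrightarrow> d k \<in> MF_Delta k" "primal_coords q" "\<And>k. k \<in> {1..M} \<Longrightarrow> p k = d k + q k"
    using MF_split_family[of p] p by metis
  have e: "(\<Sum>k\<in>{1..M}. p k) = (\<Sum>k\<in>{1..M}. d k + q k)" by (rule sum.cong[OF refl]) (rule dq(3))
  show thesis
    by (rule that[OF dq(1,2) const_tilde_coords[OF dq(1,2)]])
      (simp_all only: e I_Gamma_glob[OF dq(1,2)] skeleton_const[OF dq(3)])
qed

lemma W_hat_coords:
  assumes w: "w \<in> W_hat"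
  shows "\<exists>d q. (\<forall>k\<in>{1..M}. d k \<in> MF_Delta k) \<and> primal_coords q \<and> tilde_coords (\<lambda>i. d) q \<and>
    w = glob (\<Sum>k\<in>{1..M}. d k + q k) \<and> I_Gamma w = assemble (\<lambda>i. d) q"
proof -
  obtain p where p: "\<And>k. k \<in> {1..M} \<Longrightarrow> p k \<in> MF k" "w = glob (\<Sum>k\<in>{1..M}. p k)"
    using w by (rule W_hatE) blast
  show ?thesis
  proof (rule I_Gamma_coords[of p])
    fix d q
    assume "\<And>k. k \<in> {1..M} \<Longrightarrow> d k \<in> MF_Delta k" "primal_coords q" "tilde_coords (\<lambda>i. d) q"
      "glob (\<Sum>k\<in>{1..M}. p k) = glob (\<Sum>k\<in>{1..M}. d k + q k)"
      "I_Gamma (glob (\<Sum>k\<in>{1..M}. p k)) = assemble (\<lambda>i. d) q"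
    thus ?thesis unfolding p(2) by (intro exI[of _ d] exI[of _ q]) simp
  qed (rule p(1))
qed

definition average :: "(nat \<Rightarrow> nat \<Rightarrow> plane \<Rightarrow> real) \<Rightarrow> (nat \<Rightarrow> plane \<Rightarrow> real) \<Rightarrow> nat \<Rightarrow> plane \<Rightarrow> real"
  where "average d q k = D_check_mul k (fst (iface P k)) (d (fst (iface P k)) k) +
    D_check_mul k (snd (iface P k)) (d (snd (iface P k)) k) + q k"

lemma average_MF: "tilde_coords d q \<Longrightarrow> k \<in> {1..M} \<Longrightarrow> average d q k \<in> MF k"
  unfolding average_def
  by (intro subspace_add[OF subspace_MF] D_check_mul_MF tilde_coordsD(4))

lemma average_side:
  assumes i: "i \<in> {1..N}" and k: "k \<in> ifaces_of i"
  shows "average d q k = D_check_mul k i (d i k) + D_check_mul k (opp k i) (d (opp k i) k) + q k"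
  using mem_ifaces_of[OF mem_MF_sub[OF k] i] k fst_snd_ifaces(3,4)[OF mem_MF_sub[OF k]]
  by (auto simp: average_def add.commute)

lemma E_D_assemble:
  assumes c: "tilde_coords d q"
  shows "E_D (assemble d q) = glob (\<Sum>k\<in>{1..M}. average d q k)"
proof -
  note D = tilde_coordsD[OF c]
  have 1: "R_Delta_Gamma i (R_Delta i (assemble d q)) = (\<Sum>k\<in>ifaces_of i. glob (D_check_mul k i (d i k)))"
    if i: "i \<in> {1..N}" for i
    unfolding R_Delta_Gamma_def R_assemble(1)[OF c i]
  proof (rule sum.cong[OF refl])
    fix k assume k: "k \<in> ifaces_of i"
    have "dual_coords i (d i)" using c i by (auto simp: tilde_coords_def)
    thus "D_check k i (T_from_loc k i (R_k_Delta i k (\<Sum>k\<in>ifaces_of i. loc i (d i k)))) = glob (D_check_mul k i (d i k))"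
      using R_k_Delta_sum[OF i _ k] T_from_loc_loc[OF mem_MF_sub[OF k] i D(3)[OF i k]]
        D_check_glob[OF mem_MF_sub[OF k] D(3)[OF i k]] by simp
  qed
  have "E_D (assemble d q) = (\<Sum>i\<in>{1..N}. \<Sum>k\<in>ifaces_of i. glob (D_check_mul k i (d i k))) + (\<Sum>k\<in>{1..M}. glob (q k))"
    unfolding E_D_def R_assemble(2)[OF c] using 1 by simp
  also have "\<dots> = (\<Sum>k\<in>{1..M}. glob (D_check_mul k (fst (iface P k)) (d (fst (iface P k)) k)) +
     glob (D_check_mul k (snd (iface P k)) (d (snd (iface P k)) k)) + glob (q k))"
    unfolding sum_sides[of "\<lambda>i k. glob (D_check_mul k i (d i k))"] by (simp add: sum.distrib)
  also have "\<dots> = (\<Sum>k\<in>{1..M}. glob (average d q k))"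
  proof (rule sum.cong[OF refl])
    fix k assume k: "k \<in> {1..M}"
    have L: "D_check_mul k i x \<in> Lambda" "q k \<in> Lambda" for i x
      using D_check_mul_MF[OF k] D(4)[OF k] MF_subset_Lambda[OF k] by blast+
    show "glob (D_check_mul k (fst (iface P k)) (d (fst (iface P k)) k)) +
     glob (D_check_mul k (snd (iface P k)) (d (snd (iface P k)) k)) + glob (q k) = glob (average d q k)"
      unfolding average_def
      using L subspace_add[OF subspace_Lambda L(1) L(1)] by (simp add: lin_on_add[OF lin_on_glob])
  qed
  also have "\<dots> = glob (\<Sum>k\<in>{1..M}. average d q k)" using glob_sum[OF average_MF[OF c]] by simp
  finally show ?thesis .
qed

lemma E_D_W_hat: "u \<in> W_tilde \<Longrightarrow> E_D u \<in> W_hat"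
  by (elim W_tildeE) (simp only: E_D_assemble W_hatI average_MF)

lemma I_Gamma_W_tilde: "w \<in> W_hat \<Longrightarrow> I_Gamma w \<in> W_tilde"
  using W_hat_coords W_tildeI by metis

text \<open>Both sides carry the same dual multiplier and the two weights sum to the
  identity.\<close>

lemma E_D_I_Gamma:
  assumes w: "w \<in> W_hat"
  shows "E_D (I_Gamma w) = w"
proof -
  obtain d q where dq0: "\<forall>k\<in>{1..M}. d k \<in> MF_Delta k" "tilde_coords (\<lambda>i. d) q"
    "w = glob (\<Sum>k\<in>{1..M}. d k + q k)" "I_Gamma w = assemble (\<lambda>i. d) q"
    using W_hat_coords[OF w] by blast
  note dq = dq0(1)[rule_format] dq0(2-4)
  have "average (\<lambda>i. d) q k = d k + q k" if k: "k \<in> {1..M}" for k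
    unfolding average_def
    using D_check_mul_partition[OF k, of "fst (iface P k)" "snd (iface P k)" "d k"] dq(1)[OF k] MF_Delta_MF[OF k]
    by (auto simp: sides_def)
  hence "(\<Sum>k\<in>{1..M}. average (\<lambda>i. d) q k) = (\<Sum>k\<in>{1..M}. d k + q k)" by (intro sum.cong refl)
  thus ?thesis using E_D_assemble[OF dq(2)] dq(3,4) by simp
qed

lemma lin_on_E_D: "lin_on W_tilde E_D"
proof (rule lin_onI)
  fix x y assume "x \<in> W_tilde" "y \<in> W_tilde"
  then obtain d q d' q' where c: "tilde_coords d q" "x = assemble d q" "tilde_coords d' q'" "y = assemble d' q'"
    by (meson W_tildeE)
  note l = tilde_coords_linear[OF c(1,3)]
  have "average (\<lambda>i k. d i k + d' i k) (\<lambda>k. q k + q' k) k = average d q k + average d' q' k"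
    if k: "k \<in> {1..M}" for k
  proof -
    note D = tilde_coordsD(3)[OF c(1) iface_sides(3)[OF k] fst_snd_ifaces(1)[OF k]]
      tilde_coordsD(3)[OF c(3) iface_sides(3)[OF k] fst_snd_ifaces(1)[OF k]]
      tilde_coordsD(3)[OF c(1) iface_sides(4)[OF k] fst_snd_ifaces(2)[OF k]]
      tilde_coordsD(3)[OF c(3) iface_sides(4)[OF k] fst_snd_ifaces(2)[OF k]]
    have s: "(fst (iface P k), snd (iface P k)) \<in> sides k" "(snd (iface P k), fst (iface P k)) \<in> sides k"
      by (auto simp: sides_def prod.swap_def)
    show ?thesis unfolding average_def
      lin_on_add[OF lin_on_D_check_mul[OF k s(1)] D(1,2)] lin_on_add[OF lin_on_D_check_mul[OF k s(2)] D(3,4)]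
      by (simp add: ac_simps)
  qed
  hence "(\<Sum>k\<in>{1..M}. average (\<lambda>i k. d i k + d' i k) (\<lambda>k. q k + q' k) k) =
    (\<Sum>k\<in>{1..M}. average d q k) + (\<Sum>k\<in>{1..M}. average d' q' k)"
    unfolding sum.distrib[symmetric] by (intro sum.cong refl)
  thus "E_D (x + y) = E_D x + E_D y"
    unfolding c(2,4) l(3)[symmetric] E_D_assemble[OF l(1)] E_D_assemble[OF c(1)] E_D_assemble[OF c(3)]
    using lin_on_add[OF lin_on_glob sum_MF_Lambda sum_MF_Lambda, OF order_refl average_MF[OF c(1)] order_refl average_MF[OF c(3)]]
    by simp
next
  fix r x assume "x \<in> W_tilde"
  then obtain d q where c: "tilde_coords d q" "x = assemble d q" by (meson W_tildeE)
  note l = tilde_coords_linear[OF c(1,1)]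
  have "average (\<lambda>i k. r *\<^sub>R d i k) (\<lambda>k. r *\<^sub>R q k) k = r *\<^sub>R average d q k"
    if k: "k \<in> {1..M}" for k
  proof -
    note D = tilde_coordsD(3)[OF c(1) iface_sides(3)[OF k] fst_snd_ifaces(1)[OF k]]
      tilde_coordsD(3)[OF c(1) iface_sides(4)[OF k] fst_snd_ifaces(2)[OF k]]
    have s: "(fst (iface P k), snd (iface P k)) \<in> sides k" "(snd (iface P k), fst (iface P k)) \<in> sides k"
      by (auto simp: sides_def prod.swap_def)
    show ?thesis unfolding average_def
      lin_on_scale[OF lin_on_D_check_mul[OF k s(1)] D(1)] lin_on_scale[OF lin_on_D_check_mul[OF k s(2)] D(2)]
      by (simp add: scaleR_add_right)
  qed
  hence "(\<Sum>k\<in>{1..M}. average (\<lambda>i k. r *\<^sub>R d i k) (\<lambda>k. r *\<^sub>R q k) k) = r *\<^sub>R (\<Sum>k\<in>{1..M}. average d q k)"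
    unfolding scaleR_sum_right by (intro sum.cong refl)
  thus "E_D (r *\<^sub>R x) = r *\<^sub>R E_D x"
    unfolding c(2) l(4)[symmetric] E_D_assemble[OF l(2)] E_D_assemble[OF c(1)]
    using lin_on_scale[OF lin_on_glob sum_MF_Lambda, OF order_refl average_MF[OF c(1)]] by simp
qed

lemma lin_on_I_Gamma: "lin_on W_hat I_Gamma"
proof (rule lin_onI)
  fix x y assume xy: "x \<in> W_hat" "y \<in> W_hat"
  obtain d q where c0: "\<forall>k\<in>{1..M}. d k \<in> MF_Delta k" "primal_coords q"
    "tilde_coords (\<lambda>i. d) q" "x = glob (\<Sum>k\<in>{1..M}. d k + q k)" "I_Gamma x = assemble (\<lambda>i. d) q"
    using W_hat_coords[OF xy(1)] by blast
  obtain d' q' where c0': "\<forall>k\<in>{1..M}. d' k \<in> MF_Delta k" "primal_coords q'"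
    "tilde_coords (\<lambda>i. d') q'" "y = glob (\<Sum>k\<in>{1..M}. d' k + q' k)" "I_Gamma y = assemble (\<lambda>i. d') q'"
    using W_hat_coords[OF xy(2)] by blast
  note c = c0(1)[rule_format] c0(2-5) and c' = c0'(1)[rule_format] c0'(2-5)
  note l = tilde_coords_linear[OF c(3) c'(3)]
  have dd: "d k + d' k \<in> MF_Delta k" if "k \<in> {1..M}" for k
    using c(1)[OF that] c'(1)[OF that] subspace_add[OF subspace_MF_Delta] by blast
  have qq: "primal_coords (\<lambda>k. q k + q' k)" using l(1) by (simp add: tilde_coords_def)
  have L: "d k + q k \<in> MF k" "d' k + q' k \<in> MF k" if "k \<in> {1..M}" for k
    using c(1,2) c'(1,2) that MF_Delta_MF[OF that] MF_Pi_MF[OF that] subspace_add[OF subspace_MF[OF that]]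
    unfolding primal_coords_def by blast+
  have "x + y = glob ((\<Sum>k\<in>{1..M}. d k + q k) + (\<Sum>k\<in>{1..M}. d' k + q' k))"
    unfolding c(4) c'(4)
    by (rule lin_on_add[OF lin_on_glob sum_MF_Lambda sum_MF_Lambda, symmetric, OF order_refl L(1) order_refl L(2)])
  also have "(\<Sum>k\<in>{1..M}. d k + q k) + (\<Sum>k\<in>{1..M}. d' k + q' k) = (\<Sum>k\<in>{1..M}. (d k + d' k) + (q k + q' k))"
    unfolding sum.distrib[symmetric] by (rule sum.cong[OF refl]) (simp add: ac_simps)
  finally show "I_Gamma (x + y) = I_Gamma x + I_Gamma y"
    using I_Gamma_glob[OF dd qq] l(3) c(5) c'(5) by simp
next
  fix r x assume x: "x \<in> W_hat"
  obtain d q where c0: "\<forall>k\<in>{1..M}. d k \<in> MF_Delta k" "primal_coords q"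
    "tilde_coords (\<lambda>i. d) q" "x = glob (\<Sum>k\<in>{1..M}. d k + q k)" "I_Gamma x = assemble (\<lambda>i. d) q"
    using W_hat_coords[OF x] by blast
  note c = c0(1)[rule_format] c0(2-5)
  note l = tilde_coords_linear[OF c(3) c(3)]
  have dd: "r *\<^sub>R d k \<in> MF_Delta k" if "k \<in> {1..M}" for k
    using c(1)[OF that] subspace_scale[OF subspace_MF_Delta] by blast
  have qq: "primal_coords (\<lambda>k. r *\<^sub>R q k)" using l(2)[of r] by (simp add: tilde_coords_def)
  have L: "d k + q k \<in> MF k" if "k \<in> {1..M}" for k
    using c(1,2) that MF_Delta_MF[OF that] MF_Pi_MF[OF that] subspace_add[OF subspace_MF[OF that]]
    unfolding primal_coords_def by blast
  have "r *\<^sub>R x = glob (r *\<^sub>R (\<Sum>k\<in>{1..M}. d k + q k))"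
    unfolding c(4) by (rule lin_on_scale[OF lin_on_glob sum_MF_Lambda, symmetric, OF order_refl L])
  also have "r *\<^sub>R (\<Sum>k\<in>{1..M}. d k + q k) = (\<Sum>k\<in>{1..M}. r *\<^sub>R d k + r *\<^sub>R q k)"
    unfolding scaleR_sum_right by (simp add: scaleR_add_right)
  finally show "I_Gamma (r *\<^sub>R x) = r *\<^sub>R I_Gamma x"
    using I_Gamma_glob[OF dd qq] l(4)[of r] c(5) by simp
qed

lemma loc_ambient: "i \<in> {1..N} \<Longrightarrow> p \<in> Lambda \<Longrightarrow> loc i p \<in> ambient"
proof -
  assume i: "i \<in> {1..N}" and p: "p \<in> Lambda"
  have "(\<Sum>j\<in>{1..N}. if j = i then ext i p else 0) \<in> (\<Sum>i\<in>{1..N}. X i)"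
    by (rule set_sum_memberI) (use ext_harmonic(1)[OF i p] subspace_0[OF subspace_X] in auto)
  thus ?thesis using i p by (simp add: ambient_def loc_def)
qed

lemma glob_ambient: "p \<in> Lambda \<Longrightarrow> glob p \<in> ambient"
  unfolding ambient_def glob_def using ext_harmonic(1) by (auto intro!: set_sum_memberI)

lemma W_hat_ambient: "W_hat \<subseteq> ambient"
proof
  fix w assume "w \<in> W_hat"
  then obtain p where p: "\<And>k. k \<in> {1..M} \<Longrightarrow> p k \<in> MF k" "w = glob (\<Sum>k\<in>{1..M}. p k)" by (rule W_hatE) blast
  thus "w \<in> ambient" using glob_ambient[OF sum_MF_Lambda[OF order_refl]] by blast
qed

lemma W_tilde_ambient: "W_tilde \<subseteq> ambient"
proof
  fix w assume "w \<in> W_tilde"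
  then obtain d q where c: "tilde_coords d q" "w = assemble d q" by (rule W_tildeE)
  show "w \<in> ambient" unfolding c(2) assemble_def
    by (intro subspace_add[OF subspace_ambient] subspace_sum[OF subspace_ambient] loc_ambient glob_ambient)
      (use tilde_coordsD(3,4)[OF c(1)] MF_subset_Lambda mem_MF_sub in blast)+
qed

lemma spd_ip: "spd_on ambient ip"
  by (rule spd_onI) (use ip_sym ip_linear ip_pos in blast)+

lemma S_tilde:
  assumes u: "u \<in> W_tilde"
  shows "S_tilde u \<in> W_tilde" "v \<in> W_tilde \<Longrightarrow> ip (S_tilde u) v = A_tilde u v"
proof -
  have ipW: "spd_on W_tilde ip" using spd_on_subset[OF spd_ip W_tilde_ambient] .
  obtain s where s: "s \<in> W_tilde" "\<forall>v\<in>W_tilde. ip s v = A_tilde u v"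
    using riesz_subspace[OF fin_dim_W_tilde subspace_W_tilde ipW
      spd_on_lin_right[OF spd_A_tilde subspace_W_tilde u]] by blast
  have "S_tilde u = s"
    unfolding S_tilde_def
    by (rule the_equality) (use s spd_on_unique[OF ipW subspace_W_tilde] in auto)
  thus "S_tilde u \<in> W_tilde" "v \<in> W_tilde \<Longrightarrow> ip (S_tilde u) v = A_tilde u v" using s by auto
qed

text \<open>\<open>inv_into\<close> is meaningful on the range of \<open>S_tilde\<close> only; Riesz
  representation in the inner product \<open>A_tilde\<close> shows that every \<open>z\<close> of
  \<open>W_tilde\<close> belongs to it.\<close>

lemma S_tilde_inv:
  assumes z: "z \<in> W_tilde"
  shows "S_tilde_inv z \<in> W_tilde" "v \<in> W_tilde \<Longrightarrow> A_tilde (S_tilde_inv z) v = ip z v"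
proof -
  have ipW: "spd_on W_tilde ip" using spd_on_subset[OF spd_ip W_tilde_ambient] .
  obtain u where u: "u \<in> W_tilde" "\<forall>v\<in>W_tilde. A_tilde u v = ip z v"
    using riesz_subspace[OF fin_dim_W_tilde subspace_W_tilde spd_A_tilde
      spd_on_lin_right[OF ipW subspace_W_tilde z]] by blast
  have "S_tilde u = z"
    by (rule spd_on_unique[OF ipW subspace_W_tilde S_tilde(1)[OF u(1)] z]) (use S_tilde(2)[OF u(1)] u in simp)
  hence zi: "z \<in> S_tilde ` W_tilde" using u(1) by blast
  show i: "S_tilde_inv z \<in> W_tilde" unfolding S_tilde_inv_def by (rule inv_into_into[OF zi])
  have "S_tilde (S_tilde_inv z) = z" unfolding S_tilde_inv_def by (rule f_inv_into_f[OF zi])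
  thus "v \<in> W_tilde \<Longrightarrow> A_tilde (S_tilde_inv z) v = ip z v" using S_tilde(2)[OF i] by metis
qed

section \<open>The jump estimate\<close>

text \<open>Writing \<open>D\<close> for the weights,
  \<open>d_i - D_i d_i - D_j d_j = D_j (d_i - d_j)\<close>, because the two weights sum to the
  identity.\<close>

lemma jump_component:
  assumes c: "tilde_coords d q" and i: "i \<in> {1..N}" and k: "k \<in> ifaces_of i"
  shows "d i k + q k - average d q k = D_check_mul k (opp k i) (d i k - d (opp k i) k)"
proof -
  note kM = mem_MF_sub[OF k] and o = opp[OF i k]
  note D = tilde_coordsD(3)[OF c i k] tilde_coordsD(3)[OF c o(1,2)]
  have "D_check_mul k (opp k i) (d i k - d (opp k i) k) =
      D_check_mul k (opp k i) (d i k) - D_check_mul k (opp k i) (d (opp k i) k)"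
    by (rule lin_on_diff[OF lin_on_D_check_mul[OF kM sides_sym[OF o(3)]] subspace_MF[OF kM] D])
  moreover have "d i k = D_check_mul k i (d i k) + D_check_mul k (opp k i) (d i k)"
    using D_check_mul_partition[OF kM o(3) D(1)] by simp
  ultimately show ?thesis unfolding average_side[OF i k] by (simp add: algebra_simps)
qed

lemma schur_add_diff_bounds:
  assumes i: "i \<in> {1..N}" and x: "x \<in> Lambda" and y: "y \<in> Lambda"
  shows "schur i (x - y) (x - y) \<le> 2 * schur i x x + 2 * schur i y y"
  unfolding schur_def
    lin_on_diff[OF lin_on_ext[OF i] subspace_Lambda x y]
  by (rule spd_on_diff_bound[OF spd_a_form[OF i] subspace_X ext_harmonic(1)[OF i x] ext_harmonic(1)[OF i y]])

lemma schur_sum_bound: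
  assumes i: "i \<in> {1..N}" and x: "\<And>k. k \<in> A \<Longrightarrow> x k \<in> Lambda"
  shows "schur i (\<Sum>k\<in>A. x k) (\<Sum>k\<in>A. x k) \<le> real (card A) * (\<Sum>k\<in>A. schur i (x k) (x k))"
proof -
  have "ext i (\<Sum>k\<in>A. x k) = (\<Sum>k\<in>A. ext i (x k))"
    by (rule lin_on_sum[OF lin_on_ext[OF i] subspace_Lambda x])
  thus ?thesis unfolding schur_def
    using spd_on_sum_bound[OF spd_a_form[OF i] subspace_X, of A "\<lambda>k. ext i (x k)"] ext_harmonic(1)[OF i x] by simp
qed

lemma schur_uminus: "i \<in> {1..N} \<Longrightarrow> x \<in> Lambda \<Longrightarrow> schur i (- x) (- x) = schur i x x"
proof -
  assume i: "i \<in> {1..N}" and x: "x \<in> Lambda"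
  define y where "y = (-1) *\<^sub>R x"
  have y: "y \<in> Lambda" unfolding y_def using subspace_scale[OF subspace_Lambda x] .
  have "schur i y y = (-1) *\<^sub>R schur i x y"
    using lin_on_scale[OF lin_on_schur_left[OF i y] x, of "-1"] unfolding y_def .
  also have "schur i x y = schur i y x" by (rule schur_sym)
  also have "\<dots> = (-1) *\<^sub>R schur i x x"
    using lin_on_scale[OF lin_on_schur_left[OF i x] x, of "-1"] unfolding y_def .
  finally have "schur i y y = schur i x x" by simp
  thus ?thesis unfolding y_def scaleR_minus1_left .
qed

text \<open>On each interface the jump \<open>u - I_Gamma (E_D u)\<close> sees only the dual parts of the two sides:
  the primal parts are shared and cancel.  This is where the requirement defining the adaptive
  primal space enters.\<close>
lemma interface_jump_bound:
  assumes c: "tilde_coords d q" and k: "k \<in> {1..M}" and \<Theta>: "0 \<le> \<Theta>"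
  defines "i \<equiv> fst (iface P k)" and "j \<equiv> snd (iface P k)"
  shows "schur i (D_check_mul k j (d i k - d j k)) (D_check_mul k j (d i k - d j k)) +
    schur j (D_check_mul k i (d j k - d i k)) (D_check_mul k i (d j k - d i k))
    \<le> 2 * \<Theta> * (schur i (skeleton d q i) (skeleton d q i) + schur j (skeleton d q j) (skeleton d q j))"
proof -
  note s = iface_sides(3,4)[OF k, folded i_def j_def] and f = fst_snd_ifaces[OF k, folded i_def j_def]
  note D = tilde_coordsD[OF c]
  have di: "d i k \<in> MF_Delta k" "d j k \<in> MF_Delta k" using D(1)[OF s(1) f(1)] D(1)[OF s(2) f(2)] .
  have dm: "d i k - d j k \<in> MF_Delta k" using di subspace_diff[OF subspace_MF_Delta] by blast
  have L: "D_check_mul k a x \<in> Lambda" "D_mul k a x \<in> Lambda" for a x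
    using D_check_mul_MF[OF k] D_mul_MF[OF k] MF_subset_Lambda[OF k] by blast+
  have sij: "(i, j) \<in> sides k" "(j, i) \<in> sides k" using opp(3)[OF s(1) f(1)] opp(3)[OF s(2) f(2)] f by auto
  have dM: "d i k \<in> MF k" "d j k \<in> MF k" "d i k - d j k \<in> MF k" using di dm MF_Delta_MF[OF k] by auto
  let ?Q = "\<lambda>x. schur i (D_mul k j x) (D_mul k j x) + schur j (D_mul k i x) (D_mul k i x)"
  \<comment> \<open>Seen from \<open>j\<close> the jump has the opposite sign. Energies are even, so
    one application of \<open>check_schur\<close>, from side \<open>i\<close>, covers both
    terms.\<close>
  have neg: "D_check_mul k i (d j k - d i k) = - D_check_mul k i (d i k - d j k)"
    using lin_on_diff[OF lin_on_D_check_mul[OF k sij(1)] subspace_MF[OF k]] dM by simp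
  have "schur i (D_check_mul k j (d i k - d j k)) (D_check_mul k j (d i k - d j k)) +
    schur j (D_check_mul k i (d j k - d i k)) (D_check_mul k i (d j k - d i k)) \<le> ?Q (d i k - d j k)"
    using check_schur[OF s(1) f(1) dm] unfolding f(3) neg schur_uminus[OF s(2) L(1)] .
  \<comment> \<open>The requirement controls a dual part by one subdomain at a time, so the two
    parts are separated before it is applied.\<close>
  also have "\<dots> \<le> 2 * ?Q (d i k) + 2 * ?Q (d j k)"
    unfolding lin_on_diff[OF lin_on_D_mul[OF k sij(1)] subspace_MF[OF k] dM(1,2)]
      lin_on_diff[OF lin_on_D_mul[OF k sij(2)] subspace_MF[OF k] dM(1,2)]
    using add_mono[OF schur_add_diff_bounds[OF s(1) L(2)[of j "d i k"] L(2)[of j "d j k"]]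
      schur_add_diff_bounds[OF s(2) L(2)[of i "d i k"] L(2)[of i "d j k"]]]
    by (simp only: distrib_left ac_simps)
  also have "\<dots> \<le> 2 * (\<Theta> * schur i (skeleton d q i) (skeleton d q i)) + 2 * (\<Theta> * schur j (skeleton d q j) (skeleton d q j))"
  proof -
    \<comment> \<open>What the skeleton carries on the other interfaces serves as the competitor
      \<open>r\<close> to the minimal extension.\<close>
    have sk: "\<exists>r\<in>(\<Sum>m\<in>ifaces_of a - {k}. MF m). skeleton d q a = d a k + q k + r"
      if "a \<in> {1..N}" "k \<in> ifaces_of a" for a
    proof -
      have "skeleton d q a = d a k + q k + (\<Sum>m\<in>ifaces_of a - {k}. d a m + q m)"
        unfolding skeleton_def by (rule sum.remove[OF finite_ifaces_of that(2)])
      moreover have "(\<Sum>m\<in>ifaces_of a - {k}. d a m + q m) \<in> (\<Sum>m\<in>ifaces_of a - {k}. MF m)"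
        by (rule set_sum_memberI) (use finite_ifaces_of D(5)[OF that(1)] in auto)
      ultimately show ?thesis by blast
    qed
    obtain r where r: "r \<in> (\<Sum>m\<in>ifaces_of i - {k}. MF m)" "skeleton d q i = d i k + q k + r" using sk[OF s(1) f(1)] by blast
    obtain r' where r': "r' \<in> (\<Sum>m\<in>ifaces_of j - {k}. MF m)" "skeleton d q j = d j k + q k + r'" using sk[OF s(2) f(2)] by blast
    have "?Q (d i k) \<le> \<Theta> * schur i (skeleton d q i) (skeleton d q i)"
      using adaptive_schur[OF s(1) f(1) di(1) D(2)[OF k] r(1) \<Theta>] unfolding f(3) r(2) .
    moreover have "?Q (d j k) \<le> \<Theta> * schur j (skeleton d q j) (skeleton d q j)"
      using adaptive_schur[OF s(2) f(2) di(2) D(2)[OF k] r'(1) \<Theta>] unfolding f(4) r'(2) by simp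
    ultimately show ?thesis by simp
  qed
  finally show ?thesis by (simp add: algebra_simps)
qed

lemma averaging_bound:
  assumes u: "u \<in> W_tilde" and \<Theta>: "1 \<le> \<Theta>"
  shows "A_tilde (I_Gamma (E_D u)) (I_Gamma (E_D u)) \<le> (2 + 4 * (real C_F)\<^sup>2) * \<Theta> * A_tilde u u"
proof -
  obtain d q where c: "tilde_coords d q" "u = assemble d q" using u by (rule W_tildeE)
  note D = tilde_coordsD[OF c(1)]
  note avM = average_MF[OF c(1)]
  obtain d' q' where c': "tilde_coords (\<lambda>i. d') q'" "I_Gamma (E_D u) = assemble (\<lambda>i. d') q'"
    "\<And>i. skeleton (\<lambda>i. d') q' i = (\<Sum>k\<in>ifaces_of i. average d q k)"
    using I_Gamma_coords[of "average d q"] avM E_D_assemble[OF c(1)] c(2) by metis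
  define jump where "jump i k = D_check_mul k (opp k i) (d i k - d (opp k i) k)" for i k
  let ?s = "\<lambda>i. schur i (skeleton d q i) (skeleton d q i)"
  have J: "jump i k \<in> Lambda" if "k \<in> ifaces_of i" for i k
    unfolding jump_def using D_check_mul_MF[OF mem_MF_sub[OF that]] MF_subset_Lambda[OF mem_MF_sub[OF that]] by blast
  have sL: "skeleton d q i \<in> Lambda" if "i \<in> {1..N}" for i
    using Lambda_loc_Lambda[OF skeleton_Lambda_loc[OF c(1) that]] .
  have s0: "0 \<le> ?s i" if "i \<in> {1..N}" for i using schur_nonneg[OF that sL[OF that]] .
  \<comment> \<open>The new skeleton is the old one minus the jumps: the squared difference costs
    the factor 2, and adding the jumps of one subdomain costs the number of its interfaces.\<close>
  have loc_bound: "schur i (skeleton (\<lambda>i. d') q' i) (skeleton (\<lambda>i. d') q' i)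
    \<le> 2 * ?s i + 2 * (real C_F * (\<Sum>k\<in>ifaces_of i. schur i (jump i k) (jump i k)))" if i: "i \<in> {1..N}" for i
  proof -
    have "skeleton d q i - (\<Sum>k\<in>ifaces_of i. average d q k) = (\<Sum>k\<in>ifaces_of i. d i k + q k - average d q k)"
      unfolding skeleton_def by (rule sum_subtractf[symmetric])
    also have "\<dots> = (\<Sum>k\<in>ifaces_of i. jump i k)"
      unfolding jump_def by (rule sum.cong[OF refl]) (rule jump_component[OF c(1) i])
    finally have e: "skeleton (\<lambda>i. d') q' i = skeleton d q i - (\<Sum>k\<in>ifaces_of i. jump i k)"
      unfolding c'(3) by (simp add: algebra_simps)
    have JL: "(\<Sum>k\<in>ifaces_of i. jump i k) \<in> Lambda" by (rule subspace_sum[OF subspace_Lambda J])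
    have n: "0 \<le> (\<Sum>k\<in>ifaces_of i. schur i (jump i k) (jump i k))"
      by (rule sum_nonneg) (rule schur_nonneg[OF i J])
    have "schur i (\<Sum>k\<in>ifaces_of i. jump i k) (\<Sum>k\<in>ifaces_of i. jump i k)
      \<le> real (card (ifaces_of i)) * (\<Sum>k\<in>ifaces_of i. schur i (jump i k) (jump i k))"
      by (rule schur_sum_bound[OF i J])
    also have "\<dots> \<le> real C_F * (\<Sum>k\<in>ifaces_of i. schur i (jump i k) (jump i k))"
      by (rule mult_right_mono[OF _ n]) (use card_ifaces_of[OF i] in simp)
    finally show ?thesis
      unfolding e using schur_add_diff_bounds[OF i sL[OF i] JL] by linarith
  qed
  have jumps: "(\<Sum>i\<in>{1..N}. \<Sum>k\<in>ifaces_of i. schur i (jump i k) (jump i k)) \<le> 2 * \<Theta> * (real C_F * (\<Sum>i\<in>{1..N}. ?s i))"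
  proof -
    have "(\<Sum>i\<in>{1..N}. \<Sum>k\<in>ifaces_of i. schur i (jump i k) (jump i k)) =
      (\<Sum>k\<in>{1..M}. schur (fst (iface P k)) (jump (fst (iface P k)) k) (jump (fst (iface P k)) k) +
        schur (snd (iface P k)) (jump (snd (iface P k)) k) (jump (snd (iface P k)) k))"
      by (rule sum_sides)
    also have "\<dots> \<le> (\<Sum>k\<in>{1..M}. 2 * \<Theta> * (?s (fst (iface P k)) + ?s (snd (iface P k))))"
    proof (rule sum_mono)
      fix k assume k: "k \<in> {1..M}"
      show "schur (fst (iface P k)) (jump (fst (iface P k)) k) (jump (fst (iface P k)) k) +
        schur (snd (iface P k)) (jump (snd (iface P k)) k) (jump (snd (iface P k)) k)
        \<le> 2 * \<Theta> * (?s (fst (iface P k)) + ?s (snd (iface P k)))"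
        unfolding jump_def fst_snd_ifaces(3,4)[OF k] by (rule interface_jump_bound[OF c(1) k]) (use \<Theta> in simp)
    qed
    \<comment> \<open>Back to subdomains: an energy occurs once for every interface of its
      subdomain, which brings in the second factor \<open>C_F\<close>.\<close>
    also have "\<dots> = 2 * \<Theta> * (\<Sum>i\<in>{1..N}. \<Sum>k\<in>ifaces_of i. ?s i)"
      unfolding sum_sides[of "\<lambda>i k. ?s i"] sum_distrib_left ..
    also have "\<dots> \<le> 2 * \<Theta> * (\<Sum>i\<in>{1..N}. real C_F * ?s i)"
    proof (intro mult_left_mono sum_mono)
      fix i assume i: "i \<in> {1..N}"
      have "(\<Sum>k\<in>ifaces_of i. ?s i) = real (card (ifaces_of i)) * ?s i" by simp
      also have "\<dots> \<le> real C_F * ?s i"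
        by (rule mult_right_mono[OF _ s0[OF i]]) (use card_ifaces_of[OF i] in simp)
      finally show "(\<Sum>k\<in>ifaces_of i. ?s i) \<le> real C_F * ?s i" .
    qed (use \<Theta> in simp)
    finally show ?thesis by (simp add: sum_distrib_left)
  qed
  have au: "A_tilde u u = (\<Sum>i\<in>{1..N}. ?s i)" unfolding c(2) by (rule A_tilde_assemble[OF c(1) c(1)])
  have au0: "0 \<le> A_tilde u u" unfolding au by (rule sum_nonneg) (rule s0)
  have "A_tilde (I_Gamma (E_D u)) (I_Gamma (E_D u)) =
      (\<Sum>i\<in>{1..N}. schur i (skeleton (\<lambda>i. d') q' i) (skeleton (\<lambda>i. d') q' i))"
    unfolding c'(2) by (rule A_tilde_assemble[OF c'(1) c'(1)])
  also have "\<dots> \<le> (\<Sum>i\<in>{1..N}. 2 * ?s i + 2 * (real C_F * (\<Sum>k\<in>ifaces_of i. schur i (jump i k) (jump i k))))"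
    by (rule sum_mono) (rule loc_bound)
  also have "\<dots> = 2 * A_tilde u u + 2 * (real C_F * (\<Sum>i\<in>{1..N}. \<Sum>k\<in>ifaces_of i. schur i (jump i k) (jump i k)))"
    by (simp add: au sum.distrib sum_distrib_left)
  also have "\<dots> \<le> 2 * A_tilde u u + 2 * (real C_F * (2 * \<Theta> * (real C_F * A_tilde u u)))"
    by (intro add_left_mono mult_left_mono jumps[folded au]) auto
  \<comment> \<open>Here \<open>1 \<le> \<Theta>\<close> absorbs the term that carries no tolerance,
    so that the bound becomes a multiple of \<open>\<Theta>\<close>.\<close>
  also have "\<dots> \<le> 2 * (\<Theta> * A_tilde u u) + 2 * (real C_F * (2 * \<Theta> * (real C_F * A_tilde u u)))"
    using mult_right_mono[OF \<Theta> au0] by simp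
  also have "\<dots> = (2 + 4 * (real C_F)\<^sup>2) * \<Theta> * A_tilde u u" by (simp add: power2_eq_square algebra_simps)
  finally show ?thesis .
qed

lemma cond_number_le:
  assumes \<Theta>: "1 \<le> \<Theta>"
  shows "cond_number \<le> (2 + 4 * (real C_F)\<^sup>2) * \<Theta>"
proof -
  \<comment> \<open>\<open>G_hat\<close> without its last factor \<open>E_D\<close>. It sends
    \<open>w\<close> to the energy representative of
    \<open>\<lambda>u. A_tilde (I_Gamma w) (I_Gamma (E_D u))\<close>.\<close>
  define Y where "Y w = S_tilde_inv (adjoint_on ip W_tilde E_D (S_hat w))" for w
  obtain B where B: "finite B" "W_hat \<subseteq> span B" using fin_dim_W_hat by (auto simp: fin_dim_def)
  have ED: "E_D v \<in> ambient" if "v \<in> W_tilde" for v using E_D_W_hat[OF that] W_hat_ambient by blast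
  have IG: "I_Gamma v \<in> ambient" if "v \<in> W_hat" for v using I_Gamma_W_tilde[OF that] W_tilde_ambient by blast
  note adjI = adjoint_on_eq[OF fin_dim_W_hat subspace_W_hat subspace_ambient W_hat_ambient spd_ip lin_on_I_Gamma IG]
  note adjE = adjoint_on_eq[OF fin_dim_W_tilde subspace_W_tilde subspace_ambient W_tilde_ambient spd_ip lin_on_E_D ED]
  \<comment> \<open>An interface exists, and a nonzero multiplier on it yields the nonzero vector of
    \<open>W_hat\<close> that the spectral argument starts from.\<close>
  have M1: "1 \<in> {1..M}" using some_interface by simp
  obtain p where p: "p \<in> MF 1" "p \<noteq> 0" using MF_nonzero[OF M1] by blast
  have "glob (\<Sum>k\<in>{1..M}. if k = 1 then p else 0) \<in> W_hat"
    by (rule W_hatI) (use p(1) subspace_0[OF subspace_MF] in auto)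
  hence w0: "glob p \<in> W_hat" using some_interface by simp
  have w0': "glob p \<noteq> 0" using p(2) snd_glob[of p] by (metis snd_zero)
  have "Max (eigenvalues_on W_hat G_hat) / Min (eigenvalues_on W_hat G_hat) \<le> (2 + 4 * (real C_F)\<^sup>2) * \<Theta>"
  proof (rule averaging_spectrum[OF subspace_W_hat B w0 w0' subspace_W_tilde spd_A_tilde lin_on_I_Gamma
        I_Gamma_W_tilde lin_on_E_D E_D_W_hat E_D_I_Gamma, where Y = Y])
    fix w assume w: "w \<in> W_hat"
    note SI = S_tilde[OF I_Gamma_W_tilde[OF w]]
    have SIa: "S_tilde (I_Gamma w) \<in> ambient" using SI(1) W_tilde_ambient by blast
    have Sh: "S_hat w \<in> W_hat" unfolding S_hat_def comp_def by (rule adjI(1)[OF _ SIa])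
    have Sh2: "ip (I_Gamma v) (S_tilde (I_Gamma w)) = ip v (S_hat w)" if "v \<in> W_hat" for v
      unfolding S_hat_def comp_def by (rule adjI(2)[OF _ SIa that])
    have Sha: "S_hat w \<in> ambient" using Sh W_hat_ambient by blast
    note z = adjE(1)[OF _ Sha] adjE(2)[OF _ Sha]
    show YW: "Y w \<in> W_tilde" unfolding Y_def by (rule S_tilde_inv(1)[OF z(1)])
    \<comment> \<open>\<open>S_tilde_inv\<close> turns the energy product into \<open>ip\<close>;
      the two adjoints then move \<open>E_D\<close> and \<open>I_Gamma\<close> onto
      \<open>u\<close>, and \<open>S_tilde\<close> turns \<open>ip\<close> back into the
      energy.\<close>
    show "A_tilde (Y w) u = A_tilde (I_Gamma w) (I_Gamma (E_D u))" if u: "u \<in> W_tilde" for u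
    proof -
      have za: "adjoint_on ip W_tilde E_D (S_hat w) \<in> ambient" using z(1) W_tilde_ambient by blast
      have "A_tilde (Y w) u = ip (adjoint_on ip W_tilde E_D (S_hat w)) u"
        unfolding Y_def by (rule S_tilde_inv(2)[OF z(1) u])
      also have "\<dots> = ip u (adjoint_on ip W_tilde E_D (S_hat w))" by (rule ip_sym)
      also have "\<dots> = ip (E_D u) (S_hat w)" by (rule z(2)[OF _ u, symmetric])
      also have "\<dots> = ip (I_Gamma (E_D u)) (S_tilde (I_Gamma w))" using Sh2[OF E_D_W_hat[OF u]] by simp
      also have "\<dots> = ip (S_tilde (I_Gamma w)) (I_Gamma (E_D u))" by (rule ip_sym)
      also have "\<dots> = A_tilde (I_Gamma w) (I_Gamma (E_D u))"
        by (rule SI(2)[OF I_Gamma_W_tilde[OF E_D_W_hat[OF u]]])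
      finally show ?thesis .
    qed
    show "G_hat w = E_D (Y w)" by (simp add: G_hat_def Y_def)
  qed (use averaging_bound \<Theta> in auto)
  thus ?thesis by (simp add: cond_number_def lambda_max_def lambda_min_def)
qed

end

theorem theorem5p1:
  shows "\<exists>C :: nat \<Rightarrow> real. (\<forall>m. 0 < C m) \<and>
    (\<forall>(P :: bddc_data) \<Theta>. 1 \<le> \<Theta> \<and> adaptive_bddc P \<Theta> \<longrightarrow>
      bddc.cond_number P \<le> C (bddc.C_F P) * \<Theta>)"
\<comment> \<open>The witness is chosen before \<open>P\<close> and \<open>\<Theta>\<close> and so
  depends on the number of interfaces alone; the summand 2 keeps it positive at 0.\<close>
proof (intro exI[of _ "\<lambda>m. 2 + 4 * (real m)\<^sup>2"] conjI allI impI)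
  fix m show "0 < 2 + 4 * (real m)\<^sup>2" by (simp add: add_pos_nonneg)
next
  fix P :: bddc_data and \<Theta> assume "1 \<le> \<Theta> \<and> adaptive_bddc P \<Theta>"
  thus "bddc.cond_number P \<le> (2 + 4 * (real (bddc.C_F P))\<^sup>2) * \<Theta>"
    using adaptive_bddc.cond_number_le by blast
qed

end
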